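(* There exist absolute constants $c_1,c_2\in(0,1)$, $c>0$ and $C>0$ such that the following holds. Let $A\in\mathbb{R}^{n\times m}$ satisfy $A=XZY^T+E$ with $X\in\mathbb{R}^{n\times k}$, $Z\in\mathbb{R}^{k\times k}$, $Y\in\mathbb{R}^{m\times k}$, $E\in\mathbb{R}^{n\times m}$, $\mathrm{rank}(XZY^T)=k$ and $\|E\|\le\varepsilon$. Assume that $Z=\mathrm{blkdiag}(Z_1,Z_2,Z_3)$ with $Z_i\in\mathbb{R}^{k_i\times k_i}$, $k_1+k_2+k_3=k$, and that $X=\begin{bmatrix}X_1&X_2&X_3\end{bmatrix}$, $Y=\begin{bmatrix}Y_1&Y_2&Y_3\end{bmatrix}$ with $X_i\in\mathbb{R}^{n\times k_i}$, $Y_i\in\mathbb{R}^{m\times k_i}$. Assume further that $\begin{bmatrix}X_1&X_2\end{bmatrix}$ and $\begin{bmatrix}Y_1&Y_3\end{bmatrix}$ have orthonormal columns and are $\mu$-coherent, and that $X_3$ and $Y_2$ have orthonormal columns, each column having at most $\beta$ nonzero entries. Run one full iteration of the iterative randomized sRRQR algorithm (described in the context) on $A$ with $$\ell_0=\alpha\mu(k_1+k_2),\quad \ell_1^{\mathrm{sRRQR,col}}=k_1+k_2,\quad \ell_1^{\mathrm{new,col}}=\alpha\mu(k_1+k_3),$$ $$\ell_1^{\mathrm{sRRQR,row}}=\ell_1^{\mathrm{sRRQR,col}}+\ell_1^{\mathrm{new,col}},\quad \ell_1^{\mathrm{new,row}}=0,$$ let $\ell=\max\{\ell_0,\ell_1^{\mathrm{sRRQR,col}},\ell_1^{\mathrm{new,col}}\}$,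 and assume $\varepsilon\sqrt{nmk/\ell}\le c\,\sigma_k(XZY^T)$. Then the resulting index sets $I_1$ and $J_1$ satisfy $$\left\|A-A(:,J_1)A(:,J_1)^\dagger\,A\,A(I_1,:)^\dagger A(I_1,:)\right\|\le C\,\varepsilon\, n\sqrt{mk}\cdot\frac{\sigma_1(XZY^T)}{\sigma_k(XZY^T)}\cdot\left(\|X^\dagger\|+\|Y^\dagger\|\right)$$ with probability at least $$1-k\left(\frac{\beta\ell}{n}+\frac{\beta\ell}{m}+c_1^{\alpha}+c_2^{\alpha}\right).$$
   Context: Notation: $\|\cdot\|$ is the spectral norm; $M^\dagger$ is the Moore-Penrose pseudoinverse; $A(I,:)$ and $A(:,J)$ are the submatrices of $A$ with rows indexed by $I$, respectively columns indexed by $J$; $\sigma_i$ is the $i$-th largest singular value; $\|\cdot\|_{\max}$ is the maximum absolute value of the entries. Coherence: a matrix $U\in\mathbb{R}^{n\times r}$ with orthonormal columns is $\mu$-coherent if $\mu=n\|U\|_{\max}^2$ (with $n$ the number of rows of $U$). Strong rank-revealing QR (sRRQR), with parameter $\eta=1$: a rank-$r$ sRRQR factorization of $M\in\mathbb{R}^{p\times q}$ is $MP=Q\begin{bmatrix}A_r&B_r\\0&C_r\end{bmatrix}$ with $P$ a permutation matrix, $Q$ orthogonal, $A_r\in\mathbb{R}^{r\times r}$, such that (a) $\sigma_i(A_r)\ge\sigma_i(M)/\sqrt{1+r(q-r)}$ for $1\le i\le r$; (b) $\sigma_j(C_r)\le\sigma_{r+j}(M)\sqrt{1+r(q-r)}$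 for $1\le j\le \min\{p,q\}-r$; (c) $\|A_r^{-1}B_r\|_{\max}\le1$ (when $A_r$ is invertible). "Selecting $r$ columns of $M$ by sRRQR" (applying sRRQR with parameter $r$) means taking the indices of the $r$ columns of $M$ that are moved to the first $r$ positions by $P$. One full iteration of the iterative randomized sRRQR algorithm on $A\in\mathbb{R}^{n\times m}$: 1. Select $\ell_0$ row indices $I_0\subset\{1,\dots,n\}$ uniformly at random (without replacement). 2. Select $\ell_1^{\mathrm{sRRQR,col}}$ columns of $A(I_0,:)$ by sRRQR. 3. Let the column index set $J_1$ consist of these indices together with $\ell_1^{\mathrm{new,col}}$ new indices from $\{1,\dots,m\}$ selected uniformly at random (without replacement, independently of $I_0$). 4. Select $\ell_1^{\mathrm{sRRQR,row}}$ columns of $A(:,J_1)^T$ by sRRQR, i.e. row indices of $A$. 5. Let the row index set $I_1$ consist of these indices together with $\ell_1^{\mathrm{new,row}}$ new indices from $\{1,\dots,n\}$ selected uniformly at random. The prescribed numbers of indices are understood to be integers, and $\alpha>0$ is a real parameter. *)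

theory Defs
  imports
    "HOL-Probability.Probability"
    "HOL-Combinatorics.Permutations"
    "Jordan_Normal_Form.Char_Poly"
    "Jordan_Normal_Form.DL_Rank"
    "Jordan_Normal_Form.DL_Submatrix"
begin

text \<open>
  Matrices are \<open>real mat\<close> (dimensions are natural numbers), and rows and columns are
  numbered from \<open>0\<close>; \<open>{1,\<dots>,n}\<close> becomes \<open>{0..<n}\<close>.
\<close>

definition vec_l2norm :: "real Matrix.vec \<Rightarrow> real" where
  "vec_l2norm v = sqrt (scalar_prod v v)"

definition spectral_norm :: "real mat \<Rightarrow> real" where
  "spectral_norm M =
     Sup {vec_l2norm (M *\<^sub>v v) | v. v \<in> carrier_vec (dim_col M) \<and> vec_l2norm v \<le> 1}"

text \<open>The inserted \<open>0\<close> only matters for matrices without entries, whose max norm is \<open>0\<close>.\<close>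

definition max_norm :: "real mat \<Rightarrow> real" where
  "max_norm M = Max (insert 0 {\<bar>M $$ (i, j)\<bar> | i j. i < dim_row M \<and> j < dim_col M})"

text \<open>
  The square roots of the \<open>min {p, q}\<close> largest eigenvalues of \<open>M\<^sup>T M\<close>, counted with
  multiplicity and listed in non-increasing order.
\<close>

definition singular_values :: "real mat \<Rightarrow> real list" where
  "singular_values M =
     take (min (dim_row M) (dim_col M))
       (map sqrt (rev (sorted_list_of_multiset
          (proots (char_poly (transpose_mat M * M))))))"

text \<open>The index of \<open>\<sigma>\<close> starts at \<open>1\<close>.\<close>

definition sing_val :: "nat \<Rightarrow> real mat \<Rightarrow> real" where
  "sing_val i M =
     (if 1 \<le> i \<and> i \<le> min (dim_row M) (dim_col M) then singular_values M ! (i - 1) else 0)"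

definition is_pinv :: "real mat \<Rightarrow> real mat \<Rightarrow> bool" where
  "is_pinv M G \<longleftrightarrow>
     G \<in> carrier_mat (dim_col M) (dim_row M) \<and>
     M * G * M = M \<and> G * M * G = G \<and>
     transpose_mat (M * G) = M * G \<and> transpose_mat (G * M) = G * M"

definition pinv :: "real mat \<Rightarrow> real mat" where
  "pinv M = (THE G. is_pinv M G)"

definition hcat :: "nat \<Rightarrow> real mat list \<Rightarrow> real mat" where
  "hcat n Ms = mat_of_cols n (concat (map cols Ms))"

abbreviation sub_rows :: "real mat \<Rightarrow> nat set \<Rightarrow> real mat" where
  "sub_rows A I \<equiv> submatrix A I UNIV"

abbreviation sub_cols :: "real mat \<Rightarrow> nat set \<Rightarrow> real mat" where
  "sub_cols A J \<equiv> submatrix A UNIV J"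

definition orthonormal_cols :: "real mat \<Rightarrow> bool" where
  "orthonormal_cols U \<longleftrightarrow> transpose_mat U * U = 1\<^sub>m (dim_col U)"

text \<open>
  A matrix without columns has no entries, so its coherence is undefined; it is taken to be
  \<open>\<mu>\<close>-coherent for every \<open>\<mu>\<close>. This keeps empty blocks from forcing \<open>\<mu> = 0\<close>.
\<close>

definition coherent :: "real \<Rightarrow> real mat \<Rightarrow> bool" where
  "coherent \<mu> U \<longleftrightarrow>
     orthonormal_cols U \<and> (dim_col U = 0 \<or> \<mu> = real (dim_row U) * (max_norm U)\<^sup>2)"

definition sparse_cols :: "nat \<Rightarrow> real mat \<Rightarrow> bool" where
  "sparse_cols \<beta> U \<longleftrightarrow>
     (\<forall>j < dim_col U. card {i. i < dim_row U \<and> U $$ (i, j) \<noteq> 0} \<le> \<beta>)"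

text \<open>Right multiplication by \<open>perm_mat q \<pi>\<close> moves column \<open>\<pi> j\<close> to position \<open>j\<close>.\<close>

definition perm_mat :: "nat \<Rightarrow> (nat \<Rightarrow> nat) \<Rightarrow> real mat" where
  "perm_mat q \<pi> = Matrix.mat q q (\<lambda>(i, j). if i = \<pi> j then 1 else 0)"

definition srrqr_factorization ::
  "nat \<Rightarrow> real mat \<Rightarrow> (nat \<Rightarrow> nat) \<Rightarrow> real mat \<Rightarrow> real mat \<Rightarrow> real mat \<Rightarrow> real mat \<Rightarrow> bool"
where
  "srrqr_factorization r M \<pi> Q Ar Br Cr \<longleftrightarrow>
     (let p = dim_row M; q = dim_col M; f = sqrt (1 + real r * (real q - real r)) in
        r \<le> min p q \<and>
        \<pi> permutes {0..<q} \<and>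
        Q \<in> carrier_mat p p \<and> transpose_mat Q * Q = 1\<^sub>m p \<and>
        Ar \<in> carrier_mat r r \<and> Br \<in> carrier_mat r (q - r) \<and> Cr \<in> carrier_mat (p - r) (q - r) \<and>
        M * perm_mat q \<pi> = Q * four_block_mat Ar Br (0\<^sub>m (p - r) r) Cr \<and>
        (\<forall>i. 1 \<le> i \<and> i \<le> r \<longrightarrow> sing_val i Ar \<ge> sing_val i M / f) \<and>
        (\<forall>j. 1 \<le> j \<and> j \<le> min p q - r \<longrightarrow> sing_val j Cr \<le> sing_val (r + j) M * f) \<and>
        (\<forall>G \<in> carrier_mat r r. inverts_mat Ar G \<and> inverts_mat G Ar \<longrightarrow> max_norm (G * Br) \<le> 1))"

text \<open>
  An sRRQR factorization is not unique, so an implementation of it is modelled by an arbitrary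
  function \<open>S\<close>, where \<open>S r M\<close> is the set of selected columns of \<open>M\<close>.
\<close>

definition srrqr_selection :: "(nat \<Rightarrow> real mat \<Rightarrow> nat set) \<Rightarrow> bool" where
  "srrqr_selection S \<longleftrightarrow>
     (\<forall>M r. r \<le> min (dim_row M) (dim_col M) \<longrightarrow>
        (\<exists>\<pi> Q Ar Br Cr. srrqr_factorization r M \<pi> Q Ar Br Cr \<and> S r M = \<pi> ` {0..<r}))"

text \<open>
  A rank-\<open>r\<close> sRRQR factorization of a \<open>p \<times> q\<close> matrix exists only for \<open>r \<le> min {p, q}\<close>. The
  requested number is cut off there, because the number of rows of \<open>A(:,J\<^sub>1)\<^sup>T\<close> is random: the
  uniformly drawn column indices may coincide with indices selected by sRRQR.
\<close>

definition srrqr_select ::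
  "(nat \<Rightarrow> real mat \<Rightarrow> nat set) \<Rightarrow> nat \<Rightarrow> real mat \<Rightarrow> nat set"
where
  "srrqr_select S r M = S (min r (min (dim_row M) (dim_col M))) M"

text \<open>Sampling without replacement; meaningful for \<open>l \<le> n\<close>.\<close>

definition random_subset :: "nat \<Rightarrow> nat \<Rightarrow> nat set pmf" where
  "random_subset n l = pmf_of_set {I. I \<subseteq> {0..<n} \<and> card I = l}"

text \<open>The result is the pair \<open>(I\<^sub>1, J\<^sub>1)\<close>.\<close>

definition srrqr_iteration ::
  "(nat \<Rightarrow> real mat \<Rightarrow> nat set) \<Rightarrow> real mat \<Rightarrow> nat \<Rightarrow> nat \<Rightarrow> nat \<Rightarrow> nat \<Rightarrow> nat \<Rightarrow> (nat set \<times> nat set) pmf"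
where
  "srrqr_iteration S A l0 l_srrqr_col l_new_col l_srrqr_row l_new_row =
     do {
       I0 \<leftarrow> random_subset (dim_row A) l0;
       Jnew \<leftarrow> random_subset (dim_col A) l_new_col;
       let J1 = srrqr_select S l_srrqr_col (sub_rows A I0) \<union> Jnew;
       Inew \<leftarrow> random_subset (dim_row A) l_new_row;
       let I1 = srrqr_select S l_srrqr_row (transpose_mat (sub_cols A J1)) \<union> Inew;
       return_pmf (I1, J1)
     }"

end

theory Submission
  imports Defs
begin

text \<open>
  The heart of the matter is that, with the stated probability, the columns \<open>J\<^sub>1\<close> carry bounded
  coefficients: for every \<open>x\<close> there is a \<open>g\<close> supported on \<open>J\<^sub>1\<close> with \<open>Y\<^sup>T g = Y\<^sup>T x\<close> and
  \<open>\<parallel>g\<parallel> \<le> \<tau> \<parallel>x\<parallel>\<close>, where \<open>\<tau> = 11 \<surd>(m k)\<close>. If \<open>I\<^sub>0\<close> misses the nonzero rows of \<open>X\<^sub>3\<close>, then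
  \<open>A(I\<^sub>0,:)\<close> sees only the blocks 1 and 2, so its numerical rank is \<open>k\<^sub>1 + k\<^sub>2\<close>, and the interpolation
  matrix of the sRRQR factorization nearly reproduces these blocks. As its entries are at most 1 and
  \<open>Y\<^sub>2\<close> has few nonzero rows, the sRRQR columns yield the coefficients for block 2 with a small norm.
  The random columns miss the nonzero rows of \<open>Y\<^sub>2\<close>, and \<open>[Y\<^sub>1 Y\<^sub>3]\<close> is well conditioned on them, so
  they correct blocks 1 and 3 without disturbing block 2.

  This bounds the column error by \<open>\<epsilon> (1 + \<tau>)\<close>. It also gives \<open>\<sigma>\<^sub>k (A(:,J\<^sub>1)) \<ge> \<sigma>\<^sub>k / \<tau> - \<epsilon>\<close>, and then
  the sRRQR factorization of \<open>A(:,J\<^sub>1)\<^sup>T\<close> bounds the row error, except when \<open>\<epsilon>\<close> is so large that the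
  claim is trivial.

  That sampled rows of a coherent matrix are well conditioned is a matrix Chernoff bound for sampling
  without replacement. No matrix exponentials are needed: the potential \<open>tr ((a S + b)\<^sup>-\<^sup>p)\<close> of the
  sampled Gram matrix \<open>S\<close>, with \<open>p\<close> a power of two, decreases on average with every new row, and
  Markov's inequality turns this into a lower bound for the smallest eigenvalue.
\<close>

unbundle no vec_syntax and no inner_syntax

section \<open>The spectral theorem for real symmetric matrices\<close>

text \<open>The order sqrt (m k) of the coefficients rests on a cancellation. The sRRQR coefficients
  for block 2 may have size sqrt m, and correcting on l1 random columns amplifies by about sqrt (m /
  l1); the product alone would be too large. Coherence repairs this: a vector supported on k1 + k2
  columns has an image under \<open>[Y1 Y3]^T\<close> that is smaller by sqrt (\<mu> (k1 + k3) (k1 +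
  k2) / m), and as l1 \<ge> \<mu> (k1 + k3), this offsets the amplification up to a factor of order
  sqrt k. The factor n of the final bound is the sRRQR constant sqrt (1 + q (n - q)) \<le> n of the
  row selection; the condition number enters there too, through the size of a vector on the selected
  rows with a prescribed image under \<open>B^T\<close>. Two quantitative facts are read off from
  the claimed probability, which is at most 0 unless \<alpha> \<ge> 1 and k \<beta> l \<le> m. The
  second one keeps the sRRQR coefficients of size sqrt m. The exponent p is a power of two because
  the trace inequality is proved by repeated squaring; rounding \<alpha> to a power of two costs
  only a constant in the exponent.\<close>

lemma symmetric_real_eigenvalue_exists:
  fixes A :: "real mat"
  assumes A: "A \<in> carrier_mat n n" and sym: "transpose_mat A = A" and "0 < n"
  shows "\<exists>x. eigenvalue A x"
proof -
  let ?c = "map_mat complex_of_real A"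
  have cA: "?c \<in> carrier_mat n n" using A by simp
  have "degree (char_poly ?c) = n" using degree_monic_char_poly[OF cA] by simp
  then have "\<not> constant (poly (char_poly ?c))"
    using \<open>0 < n\<close> by (simp add: constant_degree)
  then obtain z where z: "poly (char_poly ?c) z = 0"
    using fundamental_theorem_of_algebra by blast
  then have "eigenvalue ?c z" using eigenvalue_root_char_poly[OF cA] by simp
  then obtain v where v: "v \<in> carrier_vec n" "v \<noteq> 0\<^sub>v n" "?c *\<^sub>v v = z \<cdot>\<^sub>v v"
    using A unfolding eigenvalue_def eigenvector_def by auto
  \<comment> \<open>With \<open>v\<close> a complex eigenvector for \<open>z\<close>,
    \<open>s\<close> is the Hermitian form of \<open>A\<close> at \<open>v\<close>. It equals
    \<open>z\<close> times the squared norm \<open>N\<close> and, by symmetry of \<open>A\<close>,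
    its own conjugate; hence \<open>z\<close> is real.\<close>
  define N where "N = (\<Sum>i<n. (cmod (v $ i))\<^sup>2)"
  define s where "s = (\<Sum>i<n. \<Sum>j<n. cnj (v $ i) * of_real (A $$ (i,j)) * v $ j)"
  have "(\<Sum>j<n. of_real (A $$ (i,j)) * v $ j) = z * v $ i" if "i < n" for i
  proof -
    have "(?c *\<^sub>v v) $ i = (\<Sum>j<n. of_real (A $$ (i,j)) * v $ j)"
      using that A v(1) by (simp add: scalar_prod_def lessThan_atLeast0)
    then show ?thesis using v that by simp
  qed
  then have "s = (\<Sum>i<n. cnj (v $ i) * (z * v $ i))"
    unfolding s_def by (intro sum.cong) (simp_all add: sum_distrib_left[symmetric] mult.assoc)
  also have "\<dots> = z * of_real N"
    unfolding N_def of_real_sum sum_distrib_left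
    by (intro sum.cong refl) (simp only: complex_norm_square mult.commute mult.left_commute)
  finally have s1: "s = z * of_real N" .
  have symA: "A $$ (i,j) = A $$ (j,i)" if "i < n" "j < n" for i j
    using arg_cong[OF sym, of "\<lambda>M. M $$ (j,i)"] that A by simp
  have "cnj s = (\<Sum>i<n. \<Sum>j<n. v $ i * of_real (A $$ (i,j)) * cnj (v $ j))"
    unfolding s_def by (simp add: cnj_sum)
  also have "\<dots> = (\<Sum>j<n. \<Sum>i<n. v $ i * of_real (A $$ (i,j)) * cnj (v $ j))"
    by (rule sum.swap)
  also have "\<dots> = s" unfolding s_def by (intro sum.cong refl) (simp add: symA mult_ac)
  finally have "cnj z * of_real N = z * of_real N" using s1 by simp
  moreover have "N > 0"
  proof -
    obtain i where "i < n" "v $ i \<noteq> 0" using v(1,2) by (metis eq_vecI carrier_vecD index_zero_vec)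
    then show ?thesis unfolding N_def by (intro sum_pos2[of _ i]) auto
  qed
  ultimately have "cnj z = z" by simp
  then have "z = of_real (Re z)" by (simp add: complex_eq_iff)
  with z have "poly (map_poly complex_of_real (char_poly A)) (of_real (Re z)) = 0"
    by (simp add: of_real_hom.char_poly_hom[OF A])
  then have "poly (char_poly A) (Re z) = 0" by (simp add: of_real_hom.poly_map_poly)
  then show ?thesis using eigenvalue_root_char_poly[OF A] by blast
qed

text \<open>A Householder reflection; if \<open>v\<close> is already the first unit vector, then \<open>2 / s\<close> is
  \<open>0\<close> and the formula gives the identity.\<close>

lemma householder_exists:
  fixes v :: "real Matrix.vec"
  assumes v: "v \<in> carrier_vec (Suc m)" and unit: "v \<bullet> v = 1"
  shows "\<exists>H \<in> carrier_mat (Suc m) (Suc m).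
    transpose_mat H = H \<and> H * H = 1\<^sub>m (Suc m) \<and> Matrix.col H 0 = v"
proof -
  define w where "w i = v $ i - (if i = 0 then 1 else 0)" for i
  define s where "s = (\<Sum>i<Suc m. w i * w i)"
  define c where "c = 2 / s"
  define H where "H = Matrix.mat (Suc m) (Suc m) (\<lambda>(i,j). (if i = j then 1 else 0) - c * w i * w j)"
  have cs: "c * c * s = 2 * c" by (simp add: c_def)
  have s2: "s = 2 - 2 * v $ 0"
  proof -
    have "s = (\<Sum>i<Suc m. v $ i * v $ i - 2 * (if i = 0 then v $ i else 0) + (if i = 0 then 1 else 0))"
      unfolding s_def w_def by (intro sum.cong) (auto simp: algebra_simps)
    also have "\<dots> = v \<bullet> v - 2 * v $ 0 + 1"
      using v by (simp add: sum.distrib sum_subtractf sum_distrib_left[symmetric] scalar_prod_def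
          lessThan_atLeast0 sum.delta del: sum.lessThan_Suc sum.op_ivl_Suc)
    finally show ?thesis using unit by simp
  qed
  \<comment> \<open>The unit norm gives s = 2 - 2 v_0 = -2 w_0. For s \<noteq> 0 this makes
    \<open>c * w 0\<close> equal to -1, so the reflection sends the first unit vector e to e + w =
    v.\<close>
  have w0: "c * w 0 * w i = - w i" if "i < Suc m" for i
  proof (cases "s = 0")
    case True
    then have "\<forall>j<Suc m. w j * w j = 0"
      unfolding s_def by (subst (asm) sum_nonneg_eq_0_iff) auto
    then show ?thesis using that by simp
  next
    case False
    then have "c * w 0 = -1" using s2 unfolding c_def w_def by (simp add: field_simps)
    then show ?thesis by simp
  qed
  have H: "H \<in> carrier_mat (Suc m) (Suc m)" unfolding H_def by simp
  moreover have "transpose_mat H = H" unfolding H_def by (intro eq_matI) auto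
  moreover have "H * H = 1\<^sub>m (Suc m)"
  proof (rule eq_matI)
    fix i j assume ij: "i < dim_row (1\<^sub>m (Suc m))" "j < dim_col (1\<^sub>m (Suc m))"
    then have "(H * H) $$ (i,j) = (\<Sum>l<Suc m. ((if i = l then 1 else 0) - c * w i * w l) *
       ((if l = j then 1 else 0) - c * w l * w j))"
      unfolding H_def by (simp add: scalar_prod_def lessThan_atLeast0 del: sum.lessThan_Suc sum.op_ivl_Suc)
    also have "\<dots> = (\<Sum>l<Suc m. (if l = i then (if i = j then 1 else 0) else 0)
        - (if l = i then c * w i * w j else 0) - (if l = j then c * w i * w j else 0)
        + c * c * w i * w j * (w l * w l))"
      by (intro sum.cong) (auto simp: algebra_simps)
    also have "\<dots> = (if i = j then 1 else 0) - 2 * c * w i * w j + c * c * s * w i * w j"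
      using ij unfolding s_def by (simp add: sum.distrib sum_subtractf sum_distrib_left[symmetric] sum.delta
          del: sum.lessThan_Suc sum.op_ivl_Suc)
    finally show "(H * H) $$ (i,j) = 1\<^sub>m (Suc m) $$ (i,j)" using ij cs by simp
  qed (use H in auto)
  moreover have "Matrix.col H 0 = v"
    using v w0 by (intro eq_vecI) (auto simp: H_def w_def mult_ac)
  ultimately show ?thesis by blast
qed

lemma mult_block_diag:
  fixes A1 :: "real mat"
  assumes "A1 \<in> carrier_mat a a" "A2 \<in> carrier_mat a a" "B1 \<in> carrier_mat b b" "B2 \<in> carrier_mat b b"
  shows "four_block_mat A1 (0\<^sub>m a b) (0\<^sub>m b a) B1 * four_block_mat A2 (0\<^sub>m a b) (0\<^sub>m b a) B2
    = four_block_mat (A1 * A2) (0\<^sub>m a b) (0\<^sub>m b a) (B1 * B2)"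
  using assms by (subst mult_four_block_mat[of _ a a _ b _ b _ _ a _ b]) auto

text \<open>Deflation: a unit eigenvector is made the first column of a symmetric orthogonal
  \<open>H\<close>, so that \<open>H * A * H\<close> splits into the eigenvalue and a smaller
  symmetric block, to which the induction hypothesis applies.\<close>

theorem real_spectral_theorem:
  fixes A :: "real mat"
  assumes "A \<in> carrier_mat n n" and "transpose_mat A = A"
  shows "\<exists>Q d. Q \<in> carrier_mat n n \<and> transpose_mat Q * Q = 1\<^sub>m n \<and>
    A = Q * mat_diag n d * transpose_mat Q"
  using assms
proof (induction n arbitrary: A)
  case 0
  then show ?case
    by (intro exI[of _ "1\<^sub>m 0"] exI[of _ "\<lambda>_. 0"]) (auto intro!: eq_matI)
next
  case (Suc m)
  let ?n = "Suc m"
  note A = Suc.prems(1)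
  obtain x where "eigenvalue A x" using symmetric_real_eigenvalue_exists[OF Suc.prems] by auto
  then obtain u where u: "u \<in> carrier_vec ?n" "u \<noteq> 0\<^sub>v ?n" "A *\<^sub>v u = x \<cdot>\<^sub>v u"
    using A unfolding eigenvalue_def eigenvector_def by auto
  have uu: "u \<bullet> u > 0"
  proof -
    obtain i where "i < ?n" "u $ i \<noteq> 0" using u(1,2) by (metis eq_vecI carrier_vecD index_zero_vec)
    then show ?thesis using u(1) unfolding scalar_prod_def
      by (intro sum_pos2[of _ i]) (auto simp: not_square_less_zero less_le)
  qed
  define v where "v = (1 / sqrt (u \<bullet> u)) \<cdot>\<^sub>v u"
  have v: "v \<in> carrier_vec ?n" using u unfolding v_def by simp
  have vv: "v \<bullet> v = 1" using u uu unfolding v_def by (simp add: real_sqrt_mult_self)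
  have Av: "A *\<^sub>v v = x \<cdot>\<^sub>v v"
    unfolding v_def using A u by (simp add: mult_mat_vec smult_smult_assoc mult.commute)
  obtain H where H: "H \<in> carrier_mat ?n ?n" "transpose_mat H = H" "H * H = 1\<^sub>m ?n"
    "Matrix.col H 0 = v" using householder_exists[OF v vv] by blast
  define B where "B = H * A * H"
  have B: "B \<in> carrier_mat ?n ?n" unfolding B_def using H A by simp
  have symB: "transpose_mat B = B"
    unfolding B_def using H A Suc.prems(2) by (simp add: transpose_mult[of _ ?n ?n _ ?n] assoc_mult_mat[of _ ?n ?n _ ?n _ ?n] mult_carrier_mat[of _ ?n ?n _ ?n])
  have "Matrix.col B 0 = H *\<^sub>v (A *\<^sub>v Matrix.col H 0)"
    unfolding B_def using H(1) A
    by (simp only: col_mult2[of _ ?n ?n _ ?n] mult_carrier_mat[of _ ?n ?n _ ?n] zero_less_Suc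
        assoc_mult_mat_vec[of _ ?n ?n _ ?n] col_carrier_vec[of 0 ?n _ ?n])
  also have "\<dots> = x \<cdot>\<^sub>v (H *\<^sub>v Matrix.col H 0)"
    using H v by (simp add: Av mult_mat_vec)
  also have "H *\<^sub>v Matrix.col H 0 = Matrix.col (H * H) 0"
    by (rule col_mult2[OF H(1) H(1), symmetric]) simp
  finally have colB: "Matrix.col B 0 = x \<cdot>\<^sub>v unit_vec ?n 0" using H by simp
  have B0: "B $$ (i,0) = (if i = 0 then x else 0)" if "i < ?n" for i
    using arg_cong[OF colB, of "\<lambda>v. v $ i"] that B by auto
  have B0': "B $$ (0,i) = (if i = 0 then x else 0)" if "i < ?n" for i
    using arg_cong[OF symB, of "\<lambda>v. v $$ (i,0)"] that B B0 by auto
  define A' where "A' = Matrix.mat m m (\<lambda>(i,j). B $$ (Suc i, Suc j))"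
  have A': "A' \<in> carrier_mat m m" unfolding A'_def by simp
  have "transpose_mat A' = A'"
  proof (rule eq_matI)
    fix i j assume "i < dim_row A'" "j < dim_col A'"
    then show "transpose_mat A' $$ (i,j) = A' $$ (i,j)"
      using arg_cong[OF symB, of "\<lambda>v. v $$ (Suc i,Suc j)"] B unfolding A'_def by auto
  qed (auto simp: A'_def)
  from Suc.IH[OF A' this] obtain Q' d' where Q': "Q' \<in> carrier_mat m m"
    "transpose_mat Q' * Q' = 1\<^sub>m m" "A' = Q' * mat_diag m d' * transpose_mat Q'" by blast
  define d where "d i = (case i of 0 \<Rightarrow> x | Suc j \<Rightarrow> d' j)" for i
  define F where "F = four_block_mat (1\<^sub>m 1) (0\<^sub>m 1 m) (0\<^sub>m m 1) Q'"
  have F: "F \<in> carrier_mat ?n ?n" unfolding F_def using Q'(1) by auto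
  have FT: "transpose_mat F = four_block_mat (1\<^sub>m 1) (0\<^sub>m 1 m) (0\<^sub>m m 1) (transpose_mat Q')"
    unfolding F_def using Q'(1) by (subst transpose_four_block_mat[of _ 1 1 _ m _ m]) auto
  have D: "mat_diag ?n d = four_block_mat (mat_diag 1 (\<lambda>_. x)) (0\<^sub>m 1 m) (0\<^sub>m m 1) (mat_diag m d')"
    by (intro eq_matI) (auto simp: mat_diag_def d_def split: nat.split)
  have BB: "B = four_block_mat (mat_diag 1 (\<lambda>_. x)) (0\<^sub>m 1 m) (0\<^sub>m m 1) A'"
    using B B0 B0' A' by (intro eq_matI) (auto simp: mat_diag_def A'_def)
  have o: "four_block_mat (1\<^sub>m 1) (0\<^sub>m 1 m) (0\<^sub>m m 1) (1\<^sub>m m) = 1\<^sub>m ?n"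
    by (intro eq_matI) auto
  have 1: "transpose_mat F * F = 1\<^sub>m ?n"
    unfolding FT unfolding F_def using Q' by (subst mult_block_diag) (auto simp: o)
  have 2: "F * mat_diag ?n d * transpose_mat F = B"
    unfolding FT D BB Q'(3) unfolding F_def using Q'(1)
    by (simp only: mult_block_diag[of _ 1 _ _ m] one_carrier_mat mat_diag_dim mult_carrier_mat[of _ m m _ m]
        transpose_carrier_mat left_mult_one_mat[of _ 1 1] right_mult_one_mat[of _ 1 1])
  let ?Q = "H * F"
  have "transpose_mat ?Q * ?Q = transpose_mat F * (H * H) * F"
    using H(1,2) F by (simp add: transpose_mult[of _ ?n ?n _ ?n] assoc_mult_mat[of _ ?n ?n _ ?n _ ?n] mult_carrier_mat[of _ ?n ?n _ ?n])
  also have "\<dots> = 1\<^sub>m ?n" using H(3) F 1 by simp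
  finally have 3: "transpose_mat ?Q * ?Q = 1\<^sub>m ?n" .
  have "?Q * mat_diag ?n d * transpose_mat ?Q = H * (F * mat_diag ?n d * transpose_mat F) * H"
    using H(1,2) F by (simp add: transpose_mult[of _ ?n ?n _ ?n] assoc_mult_mat[of _ ?n ?n _ ?n _ ?n] mult_carrier_mat[of _ ?n ?n _ ?n])
  also have "\<dots> = (H * H) * A * (H * H)"
    unfolding 2 B_def using H(1) A by (simp add: assoc_mult_mat[of _ ?n ?n _ ?n _ ?n] mult_carrier_mat[of _ ?n ?n _ ?n])
  also have "\<dots> = A" using H(3) A by simp
  finally show ?case using 3 H F by (intro exI[of _ ?Q] exI[of _ d]) auto
qed

section \<open>Singular values\<close>

text \<open>
  Vectors and matrices are treated as functions of their indices, with the dimensions as explicit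
  arguments; \<open>app k X\<close> is the action of a matrix with \<open>k\<close> columns, and \<open>tr X\<close> is the transpose.
\<close>

definition ip :: "nat \<Rightarrow> (nat \<Rightarrow> real) \<Rightarrow> (nat \<Rightarrow> real) \<Rightarrow> real" where
  "ip n x y = (\<Sum>i<n. x i * y i)"

definition nrm :: "nat \<Rightarrow> (nat \<Rightarrow> real) \<Rightarrow> real" where
  "nrm n x = sqrt (ip n x x)"

definition app :: "nat \<Rightarrow> (nat \<Rightarrow> nat \<Rightarrow> real) \<Rightarrow> (nat \<Rightarrow> real) \<Rightarrow> nat \<Rightarrow> real" where
  "app k X z i = (\<Sum>j<k. X i j * z j)"

definition tr :: "(nat \<Rightarrow> nat \<Rightarrow> real) \<Rightarrow> nat \<Rightarrow> nat \<Rightarrow> real" where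
  "tr X i j = X j i"

lemma tr_tr [simp]: "tr (tr X) = X" by (simp add: tr_def fun_eq_iff)

lemma ip_ge0 [simp]: "0 \<le> ip n x x" unfolding ip_def by (intro sum_nonneg) simp
lemma nrm_ge0 [simp]: "0 \<le> nrm n x" unfolding nrm_def by simp
lemma nrm_sq: "(nrm n x)\<^sup>2 = ip n x x" unfolding nrm_def by simp
lemma nrm_L2: "nrm n x = L2_set x {..<n}" unfolding nrm_def ip_def L2_set_def by (simp add: power2_eq_square)
lemma ip_commute: "ip n x y = ip n y x" unfolding ip_def by (simp add: mult.commute)

lemma nrm_triangle: "nrm n (\<lambda>i. x i + y i) \<le> nrm n x + nrm n y"
  unfolding nrm_L2 by (rule L2_set_triangle_ineq)

lemma nrm_minus: "nrm n (\<lambda>i. - x i) = nrm n x" unfolding nrm_def ip_def by simp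

lemma nrm_diff: "nrm n (\<lambda>i. x i - y i) \<le> nrm n x + nrm n y"
  using nrm_triangle[of n x "\<lambda>i. - y i"] by (simp add: nrm_minus)

lemma nrm_diff_ge: "nrm n x - nrm n y \<le> nrm n (\<lambda>i. x i - y i)"
  using nrm_triangle[of n "\<lambda>i. x i - y i" y] by simp

lemma ip_cauchy: "\<bar>ip n x y\<bar> \<le> nrm n x * nrm n y"
proof -
  have "\<bar>ip n x y\<bar> \<le> (\<Sum>i<n. \<bar>x i\<bar> * \<bar>y i\<bar>)"
    unfolding ip_def by (rule order_trans[OF sum_abs]) (simp add: abs_mult)
  then show ?thesis unfolding nrm_L2 using L2_set_mult_ineq[of x y "{..<n}"] by linarith
qed

lemma nrm_scale: "nrm n (\<lambda>i. a * x i) = \<bar>a\<bar> * nrm n x"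
proof -
  have "ip n (\<lambda>i. a * x i) (\<lambda>i. a * x i) = a\<^sup>2 * ip n x x"
    unfolding ip_def by (simp add: sum_distrib_left power2_eq_square mult_ac)
  then show ?thesis unfolding nrm_def by (simp add: real_sqrt_mult)
qed

lemma nrm_cong: "(\<And>i. i < n \<Longrightarrow> x i = y i) \<Longrightarrow> nrm n x = nrm n y"
  unfolding nrm_def ip_def by simp
lemma ip_cong: "(\<And>i. i < n \<Longrightarrow> x i = x' i) \<Longrightarrow> (\<And>i. i < n \<Longrightarrow> y i = y' i) \<Longrightarrow> ip n x y = ip n x' y'"
  unfolding ip_def by simp
lemma app_cong: "(\<And>j. j < k \<Longrightarrow> z j = z' j) \<Longrightarrow> app k X z i = app k X z' i"
  unfolding app_def by simp

lemma nrm_eq0: "nrm n x = 0 \<longleftrightarrow> (\<forall>i<n. x i = 0)"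
  unfolding nrm_L2 by (auto simp: L2_set_eq_0_iff)

lemma nrm_zero [simp]: "nrm n (\<lambda>i. 0) = 0" by (simp add: nrm_eq0)

lemma nrm_le_iff: "nrm n x \<le> nrm m y \<longleftrightarrow> ip n x x \<le> ip m y y" unfolding nrm_def by simp

lemma app_add: "app k X (\<lambda>j. y j + z j) i = app k X y i + app k X z i"
  unfolding app_def by (simp add: sum.distrib algebra_simps)
lemma app_diff: "app k X (\<lambda>j. y j - z j) i = app k X y i - app k X z i"
  unfolding app_def by (simp add: sum_subtractf algebra_simps)
lemma app_scale: "app k X (\<lambda>j. a * z j) i = a * app k X z i"
  unfolding app_def by (simp add: sum_distrib_left algebra_simps)
lemma app_zero [simp]: "app k X (\<lambda>j. 0) i = 0" unfolding app_def by simp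

lemma ip_diff: "ip n (\<lambda>i. x i - y i) z = ip n x z - ip n y z"
  unfolding ip_def by (simp add: sum_subtractf algebra_simps)
lemma ip_app: "ip n (app k X z) y = ip k z (app n (tr X) y)"
proof -
  have "ip n (app k X z) y = (\<Sum>i<n. \<Sum>j<k. X i j * z j * y i)"
    unfolding ip_def app_def by (simp add: sum_distrib_right)
  also have "\<dots> = (\<Sum>j<k. \<Sum>i<n. X i j * z j * y i)" by (rule sum.swap)
  also have "\<dots> = ip k z (app n (tr X) y)"
    unfolding ip_def app_def tr_def by (simp add: sum_distrib_left mult_ac)
  finally show ?thesis .
qed

lemma app_app: "app m A (app k B z) i = app k (\<lambda>i j. \<Sum>l<m. A i l * B l j) z i"
proof -
  have "app m A (app k B z) i = (\<Sum>l<m. \<Sum>j<k. A i l * B l j * z j)"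
    unfolding app_def by (simp add: sum_distrib_left mult.assoc)
  also have "\<dots> = (\<Sum>j<k. \<Sum>l<m. A i l * B l j * z j)" by (rule sum.swap)
  finally show ?thesis unfolding app_def by (simp add: sum_distrib_right)
qed

text \<open>With w the image of y under the transpose, |w|^2 = <y, B w> \<le> |y| s |w|, and one
  factor |w| cancels. Bounds for a matrix and for its transpose are thus interchangeable.\<close>

lemma app_adjoint_bound:
  assumes "\<And>x. nrm n (app m B x) \<le> s * nrm m x" and "0 \<le> s"
  shows "nrm m (app n (tr B) y) \<le> s * nrm n y"
proof (cases "nrm m (app n (tr B) y) = 0")
  case True
  then show ?thesis using assms(2) by simp
next
  case False
  let ?w = "app n (tr B) y"
  have "(nrm m ?w)\<^sup>2 = ip n y (app m B ?w)"
    unfolding nrm_sq using ip_app[of m n "tr B" y ?w] by simp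
  also have "\<dots> \<le> nrm n y * (s * nrm m ?w)"
    using ip_cauchy[of n y "app m B ?w"] assms(1)[of ?w]
    by (smt (verit) mult_left_mono nrm_ge0)
  finally have "nrm m ?w * nrm m ?w \<le> (s * nrm n y) * nrm m ?w"
    by (simp add: power2_eq_square mult_ac)
  then show ?thesis using False nrm_ge0[of m ?w] by (simp add: mult_le_cancel_right)
qed

section \<open>Homogeneous and square linear systems\<close>

text \<open>Padding with zero rows gives a square matrix whose last row vanishes, so its determinant
  is 0. This replaces dimension counts: it is used where subspaces must intersect and where too few
  indices lead to a contradiction.\<close>

lemma underdetermined_kernel:
  assumes "a < k"
  shows "\<exists>c. (\<exists>j<k. c j \<noteq> 0) \<and> (\<forall>i<a. app k W c i = 0)"
proof -
  define M where "M = Matrix.mat k k (\<lambda>(i,j). if i < a then W i j else 0)"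
  have M: "M \<in> carrier_mat k k" unfolding M_def by simp
  have "transpose_mat M *\<^sub>v unit_vec k (k - 1) = 0\<^sub>v k"
    using assms by (intro eq_vecI) (auto simp: M_def)
  moreover have "unit_vec k (k - 1) \<noteq> (0\<^sub>v k :: real Matrix.vec)"
  proof
    assume "unit_vec k (k - 1) = (0\<^sub>v k :: real Matrix.vec)"
    then have "unit_vec k (k - 1) $ (k - 1) = (0\<^sub>v k :: real Matrix.vec) $ (k - 1)" by simp
    then show False using assms by simp
  qed
  ultimately have "Determinant.det (transpose_mat M) = 0"
    using M by (intro det_0_iff_vec_prod_zero_field[of _ k, THEN iffD2] exI[of _ "unit_vec k (k - 1)"]) auto
  then have "Determinant.det M = 0" using det_transpose[OF M] by simp
  then obtain v where v: "v \<in> carrier_vec k" "v \<noteq> 0\<^sub>v k" "M *\<^sub>v v = 0\<^sub>v k"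
    using det_0_iff_vec_prod_zero_field[OF M] by auto
  have "app k W (($) v) i = 0" if "i < a" for i
  proof -
    have "(M *\<^sub>v v) $ i = app k W (($) v) i"
      using that assms v(1) unfolding M_def app_def by (simp add: scalar_prod_def lessThan_atLeast0)
    then show ?thesis using v(3) that assms by simp
  qed
  moreover have "\<exists>j<k. v $ j \<noteq> 0" using v(1,2) by (metis eq_vecI carrier_vecD index_zero_vec)
  ultimately show ?thesis by blast
qed

text \<open>The determinant cannot be 0, so the matrix has an inverse. Later a vector with
  prescribed coordinates is found by showing that a k-by-k system has trivial kernel.\<close>

lemma injective_imp_surjective:
  assumes "\<And>c. (\<forall>i<k. app k W c i = 0) \<Longrightarrow> (\<forall>j<k. c j = 0)"
  shows "\<exists>s. \<forall>i<k. app k W s i = t i"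
proof -
  define M where "M = Matrix.mat k k (\<lambda>(i,j). W i j)"
  have M: "M \<in> carrier_mat k k" unfolding M_def by simp
  have e: "(M *\<^sub>v v) $ i = app k W (($) v) i" if "i < k" "v \<in> carrier_vec k" for i v
      using that unfolding M_def app_def by (simp add: scalar_prod_def lessThan_atLeast0)
  have "Determinant.det M \<noteq> 0"
  proof
    assume "Determinant.det M = 0"
    then obtain v where v: "v \<in> carrier_vec k" "v \<noteq> 0\<^sub>v k" "M *\<^sub>v v = 0\<^sub>v k"
      using det_0_iff_vec_prod_zero_field[OF M] by auto
    then have "\<forall>i<k. app k W (($) v) i = 0" using e[of _ v] by simp
    then have "\<forall>j<k. v $ j = 0" by (rule assms)
    then show False using v(1,2) by (metis eq_vecI carrier_vecD index_zero_vec)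
  qed
  then obtain N where N: "N \<in> carrier_mat k k" "M * N = 1\<^sub>m k"
    using det_non_zero_imp_unit[OF M] unfolding Units_def ring_mat_def by auto
  let ?v = "Matrix.vec k t"
  have "M *\<^sub>v (N *\<^sub>v ?v) = ?v"
    using M N by (subst assoc_mult_mat_vec[symmetric, of _ k k _ k]) auto
  then have "\<forall>i<k. app k W (($) (N *\<^sub>v ?v)) i = t i"
    using e[of _ "N *\<^sub>v ?v"] N by (metis index_vec mult_mat_vec_carrier vec_carrier)
  then show ?thesis by blast
qed

text \<open>The columns of \<open>Q\<close> are orthonormal eigenvectors of \<open>M\<^sup>T M\<close>.\<close>

definition right_singular :: "nat \<Rightarrow> nat \<Rightarrow> (nat \<Rightarrow> nat \<Rightarrow> real) \<Rightarrow> (nat \<Rightarrow> nat \<Rightarrow> real) \<Rightarrow> (nat \<Rightarrow> real) \<Rightarrow> bool"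
where
  "right_singular p q M Q d \<longleftrightarrow>
     (\<forall>i<q. \<forall>j<q. (\<Sum>l<q. Q l i * Q l j) = (if i = j then 1 else 0)) \<and>
     (\<forall>i<q. \<forall>j<q. (\<Sum>l<q. Q i l * Q j l) = (if i = j then 1 else 0)) \<and>
     (\<forall>i<q. \<forall>j<q. (\<Sum>l<p. M l i * M l j) = (\<Sum>l<q. Q i l * d l * Q j l))"

lemma app_orthonormal:
  assumes "\<And>i j. i < k \<Longrightarrow> j < k \<Longrightarrow> (\<Sum>l<q. Q l i * Q l j) = (if i = j then 1 else 0)"
  shows "ip q (app k Q c) (app k Q c') = ip k c c'"
proof -
  have "ip q (app k Q c) (app k Q c') = ip k c (app q (tr Q) (app k Q c'))" by (rule ip_app)
  also have "\<dots> = ip k c c'"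
  proof (rule ip_cong)
    fix i assume "i < k"
    then have "app k (\<lambda>i j. \<Sum>l<q. tr Q i l * Q l j) c' i = (\<Sum>j<k. if i = j then c' j else 0)"
      unfolding app_def tr_def using assms by (intro sum.cong) auto
    then show "app q (tr Q) (app k Q c') i = c' i"
      unfolding app_app using \<open>i < k\<close> by simp
  qed simp
  finally show ?thesis .
qed

text \<open>In the coordinates given by the right singular vectors, the form <M x, M y> is diagonal
  with weights \<open>d\<close>. The singular value estimates below compare these weights.\<close>

lemma right_singular_norm:
  assumes "right_singular p q M Q d"
  shows "ip q (app q (tr Q) x) (app q (tr Q) x) = ip q x x"
    and "ip p (app q M x) (app q M y) = (\<Sum>l<q. d l * app q (tr Q) x l * app q (tr Q) y l)"
proof -
  show "ip q (app q (tr Q) x) (app q (tr Q) x) = ip q x x"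
    using assms unfolding right_singular_def by (intro app_orthonormal) (auto simp: tr_def)
  have "ip p (app q M x) (app q M y) = ip q x (app p (tr M) (app q M y))" by (rule ip_app)
  also have "\<dots> = ip q x (app q (\<lambda>i j. \<Sum>l<q. Q i l * (d l * Q j l)) y)"
    unfolding app_app unfolding app_def tr_def
  proof (intro ip_cong refl sum.cong)
    fix i j assume "i < q" "j \<in> {..<q}"
    then have "(\<Sum>l<p. M l i * M l j) = (\<Sum>l<q. Q i l * d l * Q j l)"
      using assms unfolding right_singular_def by simp
    then show "(\<Sum>l<p. M l i * M l j) * y j = (\<Sum>l<q. Q i l * (d l * Q j l)) * y j"
      by (simp add: mult.assoc)
  qed
  also have "\<dots> = ip q x (app q Q (app q (\<lambda>l j. d l * Q j l) y))"
    unfolding app_app ..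
  also have "\<dots> = ip q (app q (tr Q) x) (app q (\<lambda>l j. d l * Q j l) y)"
    using ip_app[of q q "tr Q" x "app q (\<lambda>l j. d l * Q j l) y"] by simp
  also have "\<dots> = (\<Sum>l<q. d l * app q (tr Q) x l * app q (tr Q) y l)"
    unfolding ip_def app_def[of q "\<lambda>l j. d l * Q j l"] app_def[of q "tr Q" y]
    by (simp add: tr_def sum_distrib_left mult_ac)
  finally show "ip p (app q M x) (app q M y) = (\<Sum>l<q. d l * app q (tr Q) x l * app q (tr Q) y l)" .
qed

definition ent :: "real mat \<Rightarrow> nat \<Rightarrow> nat \<Rightarrow> real" where "ent M i j = M $$ (i,j)"

lemma proots_prod_list: "proots (\<Prod>a\<leftarrow>xs. [:- a, 1:]) = mset (xs :: real list)"
proof (induction xs)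
  case (Cons a xs)
  have "(\<Prod>a\<leftarrow>xs. [:- a, 1:]) \<noteq> (0 :: real poly)"
    by (auto simp: prod_list_zero_iff)
  then have "proots ([:- a, 1:] * (\<Prod>a\<leftarrow>xs. [:- a, 1:])) = proots [:- a, 1:] + proots (\<Prod>a\<leftarrow>xs. [:- a, 1:])"
    by (intro proots_mult) auto
  then show ?case using Cons.IH by (simp del: mult_pCons_left)
qed simp

text \<open>Links the definition of \<open>sing_val\<close>, a sorted list of roots of a
  characteristic polynomial, with an eigenbasis. Both lists of eigenvalues have the same multiset,
  so a permutation \<open>f\<close> puts the eigenbasis in the sorted order.\<close>

lemma singular_system_exists:
  fixes M :: "real mat"
  assumes M: "M \<in> carrier_mat p q"
  shows "\<exists>Q d. right_singular p q (ent M) Q d \<and> (\<forall>i j. i \<le> j \<longrightarrow> j < q \<longrightarrow> d j \<le> d i) \<and>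
    (\<forall>i<q. 0 \<le> d i) \<and> (\<forall>i. 1 \<le> i \<longrightarrow> i \<le> min p q \<longrightarrow> sing_val i M = sqrt (d (i - 1)))"
proof -
  let ?G = "transpose_mat M * M"
  have G: "?G \<in> carrier_mat q q" using M by simp
  have "transpose_mat ?G = ?G" using M by (simp add: transpose_mult[of _ q p _ q])
  from real_spectral_theorem[OF G this] obtain Q0 d0 where
    Q0: "Q0 \<in> carrier_mat q q" "transpose_mat Q0 * Q0 = 1\<^sub>m q" "?G = Q0 * mat_diag q d0 * transpose_mat Q0"
    by blast
  have Q0': "Q0 * transpose_mat Q0 = 1\<^sub>m q"
    using mat_mult_left_right_inverse[of "transpose_mat Q0" q Q0] Q0 by simp
  define xs where "xs = map d0 [0..<q]"
  have "similar_mat_wit ?G (mat_diag q d0) Q0 (transpose_mat Q0)"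
    unfolding similar_mat_wit_def using G Q0 Q0' by (auto simp: Let_def)
  then have "char_poly ?G = char_poly (mat_diag q d0)"
    by (intro char_poly_similar) (auto simp: similar_mat_def)
  also have "\<dots> = (\<Prod>a\<leftarrow>diag_mat (mat_diag q d0). [:- a, 1:])"
    by (rule char_poly_upper_triangular[of _ q]) (auto simp: mat_diag_def)
  also have "diag_mat (mat_diag q d0) = xs" unfolding diag_mat_def xs_def mat_diag_def by simp
  finally have "proots (char_poly ?G) = mset xs" by (simp add: proots_prod_list)
  define ys where "ys = rev (sorted_list_of_multiset (mset xs))"
  have sv: "singular_values M = take (min p q) (map sqrt ys)"
    unfolding singular_values_def ys_def \<open>proots _ = _\<close> using M by simp
  have "mset ys = mset xs" unfolding ys_def by simp
  then obtain f where f: "f permutes {..<q}" "permute_list f xs = ys"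
    using mset_eq_permutation[of ys xs] unfolding xs_def by (auto simp: length_map)
  have len: "length ys = q" using \<open>mset ys = mset xs\<close> by (metis length_map length_upt mset_eq_length xs_def diff_zero)
  define d where "d = (\<lambda>i. d0 (f i))"
  define Q where "Q = (\<lambda>i j. Q0 $$ (i, f j))"
  have ys: "ys ! i = d i" if "i < q" for i
    unfolding f(2)[symmetric] d_def xs_def using that permutes_in_image[OF f(1), of i] f(1)
    by (subst permute_list_nth) auto
  have fin: "f i < q" if "i < q" for i using that permutes_in_image[OF f(1), of i] by simp
  have finj: "f i = f j \<longleftrightarrow> i = j" for i j using permutes_inj[OF f(1)] by (auto dest: injD)
  have reidx: "(\<Sum>l<q. g (f l)) = (\<Sum>l<q. g l)" for g :: "nat \<Rightarrow> real"
    using sum.permute[OF f(1), of g] by (simp add: o_def)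
  have Qe: "Q0 $$ (i, j) = Q0 $$ (i, j)" for i j ..
  have "right_singular p q (ent M) Q d"
    unfolding right_singular_def
  proof (intro conjI allI impI)
    fix i j assume ij: "i < q" "j < q"
    have "(\<Sum>l<q. Q l i * Q l j) = (transpose_mat Q0 * Q0) $$ (f i, f j)"
      using Q0(1) fin ij unfolding Q_def by (simp add: scalar_prod_def lessThan_atLeast0)
    then show "(\<Sum>l<q. Q l i * Q l j) = (if i = j then 1 else 0)"
      unfolding Q0(2) using fin ij finj by simp
    have "(\<Sum>l<q. Q i l * Q j l) = (Q0 * transpose_mat Q0) $$ (i, j)"
      using Q0(1) ij unfolding Q_def reidx[of "\<lambda>l. Q0 $$ (i,l) * Q0 $$ (j,l)"]
      by (simp add: scalar_prod_def lessThan_atLeast0)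
    then show "(\<Sum>l<q. Q i l * Q j l) = (if i = j then 1 else 0)"
      unfolding Q0' using ij by simp
    have "(\<Sum>l<p. ent M l i * ent M l j) = ?G $$ (i,j)"
      using M ij by (simp add: ent_def scalar_prod_def lessThan_atLeast0)
    also have "\<dots> = (\<Sum>l<q. Q0 $$ (i,l) * d0 l * Q0 $$ (j,l))"
      unfolding Q0(3) using Q0(1) ij
      by (simp add: mat_diag_mult_right[of _ q] scalar_prod_def lessThan_atLeast0)
    also have "\<dots> = (\<Sum>l<q. Q i l * d l * Q j l)"
      unfolding Q_def d_def reidx[of "\<lambda>l. Q0 $$ (i,l) * d0 l * Q0 $$ (j,l)"] ..
    finally show "(\<Sum>l<p. ent M l i * ent M l j) = (\<Sum>l<q. Q i l * d l * Q j l)" .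
  qed
  moreover have "d j \<le> d i" if "i \<le> j" "j < q" for i j
  proof -
    have "sorted (rev ys)" unfolding ys_def by simp
    then show ?thesis using that ys len sorted_rev_nth_mono[of ys i j] by simp
  qed
  moreover have "0 \<le> d i" if "i < q" for i
  proof -
    have rs: "right_singular p q (ent M) Q d" by fact
    \<comment> \<open>Testing with the i-th eigenvector shows that \<open>d i\<close> is the squared
      norm of its image.\<close>
    define x where "x j = Q j i" for j
    have "app q (tr Q) x l = (if l = i then 1 else 0)" if "l < q" for l
      using rs that \<open>i < q\<close> unfolding right_singular_def app_def tr_def x_def by auto
    then have "ip p (app q (ent M) x) (app q (ent M) x) = (\<Sum>l<q. if l = i then d l else 0)"
      unfolding right_singular_norm(2)[OF rs] by (intro sum.cong) auto
    then show ?thesis using ip_ge0[of p "app q (ent M) x"] that by simp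
  qed
  moreover have "sing_val i M = sqrt (d (i - 1))" if "1 \<le> i \<and> i \<le> min p q" for i
  proof -
    have "i - 1 < min p q" using that by arith
    then show ?thesis using that M sv ys[of "i - 1"] len unfolding sing_val_def by simp
  qed
  ultimately show ?thesis by (intro exI[of _ Q] exI[of _ d]) auto
qed

text \<open>\<open>V\<close> consists of the k leading right singular vectors. The third estimate
  says that \<open>M^T\<close> stretches the vectors in the range of \<open>M V\<close> by at least
  the k-th singular value; it later carries lower bounds from a matrix over to its
  transpose.\<close>

lemma sing_val_subspace:
  assumes M: "M \<in> carrier_mat p q" and k: "1 \<le> k" "k \<le> min p q"
  shows "\<exists>V. (\<forall>c. nrm q (app k V c) = nrm k c) \<and>
    (\<forall>c. sing_val k M * nrm k c \<le> nrm p (app q (ent M) (app k V c))) \<and>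
    (\<forall>c. sing_val k M * nrm p (app q (ent M) (app k V c))
       \<le> nrm q (app p (tr (ent M)) (app q (ent M) (app k V c))))"
proof -
  obtain Q d where Qd: "right_singular p q (ent M) Q d \<and> (\<forall>i j. i \<le> j \<longrightarrow> j < q \<longrightarrow> d j \<le> d i) \<and>
    (\<forall>i<q. 0 \<le> d i) \<and> (\<forall>i. 1 \<le> i \<longrightarrow> i \<le> min p q \<longrightarrow> sing_val i M = sqrt (d (i - 1)))"
    using singular_system_exists[OF M] by (elim exE) (rule that)
  have rs: "right_singular p q (ent M) Q d" using Qd by (rule conjunct1)
  have mono: "d j \<le> d i" if "i \<le> j" "j < q" for i j
    using Qd[THEN conjunct2, THEN conjunct1] that by simp
  have d0: "0 \<le> d i" if "i < q" for i
    using Qd[THEN conjunct2, THEN conjunct2, THEN conjunct1] that by simp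
  have sv: "sing_val i M = sqrt (d (i - 1))" if "1 \<le> i" "i \<le> min p q" for i
    using Qd[THEN conjunct2, THEN conjunct2, THEN conjunct2] that by simp
  let ?M = "ent M" and ?s = "sing_val k M"
  have kq: "k \<le> q" using k by simp
  have orth: "(\<Sum>l<q. Q l i * Q l j) = (if i = j then 1 else 0)" if "i < q" "j < q" for i j
    using rs that unfolding right_singular_def by simp
  have s: "?s = sqrt (d (k - 1))" "d (k - 1) \<ge> 0" using sv k d0[of "k - 1"] by auto
  then have s2: "?s\<^sup>2 = d (k - 1)" by simp
  have dge: "d (k - 1) \<le> d j" if "j < k" for j using mono[of j "k - 1"] that kq by simp
  have QV: "app q (tr Q) (app k Q c) l = (if l < k then c l else 0)" if "l < q" for l c
  proof -
    have "app q (tr Q) (app k Q c) l = (\<Sum>j<k. if l = j then c j else 0)"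
      unfolding app_app unfolding app_def tr_def using orth that kq by (intro sum.cong) auto
    then show ?thesis by simp
  qed
  have MV: "ip p (app q ?M (app k Q c)) (app q ?M y) = (\<Sum>l<k. d l * c l * app q (tr Q) y l)" for c y
  proof -
    have "ip p (app q ?M (app k Q c)) (app q ?M y) = (\<Sum>l<q. d l * (if l < k then c l else 0) * app q (tr Q) y l)"
      unfolding right_singular_norm(2)[OF rs] by (intro sum.cong) (auto simp: QV)
    also have "\<dots> = (\<Sum>l<k. d l * c l * app q (tr Q) y l)"
      using kq by (intro sum.mono_neutral_cong_right) auto
    finally show ?thesis .
  qed
  have 1: "nrm q (app k Q c) = nrm k c" for c
    unfolding nrm_def using orth kq by (subst app_orthonormal) auto
  have 2: "?s * nrm k c \<le> nrm p (app q ?M (app k Q c))" for c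
  proof (rule power2_le_imp_le)
    have "(?s * nrm k c)\<^sup>2 = (\<Sum>l<k. d (k - 1) * c l * c l)"
      by (simp add: power_mult_distrib s2 nrm_sq ip_def sum_distrib_left mult.assoc)
    also have "\<dots> \<le> (\<Sum>l<k. d l * c l * c l)"
      using dge by (intro sum_mono) (simp add: mult.assoc mult_right_mono)
    also have "\<dots> = (nrm p (app q ?M (app k Q c)))\<^sup>2"
      unfolding nrm_sq MV using kq by (intro sum.cong) (auto simp: QV)
    finally show "(?s * nrm k c)\<^sup>2 \<le> (nrm p (app q ?M (app k Q c)))\<^sup>2" .
  qed simp
  have 3: "?s * nrm p (app q ?M (app k Q c)) \<le> nrm q (app p (tr ?M) (app q ?M (app k Q c)))" for c
  proof (rule power2_le_imp_le)
    let ?w = "app p (tr ?M) (app q ?M (app k Q c))"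
    have tw: "app q (tr Q) ?w l = (if l < k then d l * c l else 0)" if "l < q" for l
    proof -
      \<comment> \<open>Pairing with the l-th right singular vector extracts the l-th coordinate of
        \<open>M^T M V c\<close>.\<close>
      define y where "y = (\<lambda>j. Q j l)"
      have "app q (tr Q) y j = (if j = l then 1 else 0)" if "j < q" for j
        using orth \<open>l < q\<close> that unfolding y_def app_def tr_def by auto
      moreover have "app q (tr Q) ?w l = ip q y ?w" unfolding y_def app_def tr_def ip_def ..
      moreover have "\<dots> = ip p (app q ?M (app k Q c)) (app q ?M y)"
        using ip_app[of p q ?M y "app q ?M (app k Q c)"] ip_commute by metis
      ultimately have "app q (tr Q) ?w l = (\<Sum>j<k. d j * c j * (if j = l then 1 else 0))"
        unfolding MV using kq by simp
      also have "\<dots> = (\<Sum>j<k. if j = l then d j * c j else 0)" by (intro sum.cong) auto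
      finally show ?thesis by simp
    qed
    have "(?s * nrm p (app q ?M (app k Q c)))\<^sup>2 = (\<Sum>l<k. d (k - 1) * (d l * c l * c l))"
      unfolding power_mult_distrib s2 nrm_sq MV sum_distrib_left using kq
      by (intro sum.cong) (auto simp: QV)
    also have "\<dots> \<le> (\<Sum>l<k. (d l * c l) * (d l * c l))"
    proof (intro sum_mono)
      fix l assume "l \<in> {..<k}"
      then have "d (k - 1) * (d l * (c l * c l)) \<le> d l * (d l * (c l * c l))"
        using dge[of l] d0[of l] kq by (intro mult_right_mono) auto
      then show "d (k - 1) * (d l * c l * c l) \<le> (d l * c l) * (d l * c l)" by (simp add: mult_ac)
    qed
    also have "\<dots> = (\<Sum>l<q. app q (tr Q) ?w l * app q (tr Q) ?w l)"
      using kq by (intro sum.mono_neutral_cong_left) (auto simp: tw)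
    also have "\<dots> = (nrm q ?w)\<^sup>2"
      using right_singular_norm(1)[OF rs, of ?w] unfolding nrm_sq ip_def by simp
    finally show "(?s * nrm p (app q ?M (app k Q c)))\<^sup>2 \<le> (nrm q ?w)\<^sup>2" .
  qed simp
  show ?thesis using 1 2 3 by blast
qed

text \<open>One half of the Courant-Fischer principle: the k-dimensional range of \<open>N\<close>
  contains a nonzero vector orthogonal to the first k - 1 right singular vectors, and there
  \<open>M\<close> stretches by at most the k-th singular value. The second claim gives strict
  positivity when no quantitative lower bound is at hand.\<close>

lemma sing_val_ge:
  assumes M: "M \<in> carrier_mat p q" and k: "1 \<le> k" "k \<le> min p q"
    and inj: "\<And>c. nrm q (app k N c) = 0 \<Longrightarrow> nrm k c = 0"
    and ge: "\<And>c. s * nrm q (app k N c) \<le> nrm p (app q (ent M) (app k N c))"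
  shows "s \<le> sing_val k M"
    and "(\<And>c. nrm p (app q (ent M) (app k N c)) = 0 \<Longrightarrow> nrm k c = 0) \<Longrightarrow> 0 < sing_val k M"
proof -
  obtain Q d where Qd: "right_singular p q (ent M) Q d \<and> (\<forall>i j. i \<le> j \<longrightarrow> j < q \<longrightarrow> d j \<le> d i) \<and>
    (\<forall>i<q. 0 \<le> d i) \<and> (\<forall>i. 1 \<le> i \<longrightarrow> i \<le> min p q \<longrightarrow> sing_val i M = sqrt (d (i - 1)))"
    using singular_system_exists[OF M] by (elim exE) (rule that)
  have rs: "right_singular p q (ent M) Q d" using Qd by (rule conjunct1)
  have mono: "d j \<le> d i" if "i \<le> j" "j < q" for i j
    using Qd[THEN conjunct2, THEN conjunct1] that by simp
  have d0: "0 \<le> d i" if "i < q" for i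
    using Qd[THEN conjunct2, THEN conjunct2, THEN conjunct1] that by simp
  have sv: "sing_val i M = sqrt (d (i - 1))" if "1 \<le> i" "i \<le> min p q" for i
    using Qd[THEN conjunct2, THEN conjunct2, THEN conjunct2] that by simp
  let ?M = "ent M"
  have s: "sing_val k M = sqrt (d (k - 1))" "d (k - 1) \<ge> 0" using sv k d0[of "k - 1"] by auto
  obtain c where c: "\<exists>j<k. c j \<noteq> 0" "\<forall>i<k-1. app k (\<lambda>i j. \<Sum>l<q. tr Q i l * N l j) c i = 0"
    using underdetermined_kernel[of "k - 1" k "\<lambda>i j. \<Sum>l<q. tr Q i l * N l j"] k by auto
  let ?x = "app k N c"
  have cz: "nrm k c \<noteq> 0" using c(1) by (auto simp: nrm_eq0)
  have z: "app q (tr Q) ?x i = 0" if "i < k - 1" for i using c(2) that unfolding app_app by simp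
  have "(nrm p (app q ?M ?x))\<^sup>2 = (\<Sum>l<q. d l * (app q (tr Q) ?x l * app q (tr Q) ?x l))"
    unfolding nrm_sq right_singular_norm(2)[OF rs] by (simp add: mult.assoc)
  also have "\<dots> \<le> (\<Sum>l<q. d (k - 1) * (app q (tr Q) ?x l * app q (tr Q) ?x l))"
  proof (intro sum_mono)
    fix l assume "l \<in> {..<q}"
    then show "d l * (app q (tr Q) ?x l * app q (tr Q) ?x l) \<le> d (k - 1) * (app q (tr Q) ?x l * app q (tr Q) ?x l)"
      using z[of l] mono[of "k - 1" l] by (cases "l < k - 1") (auto intro!: mult_right_mono)
  qed
  also have "\<dots> = (sing_val k M * nrm q ?x)\<^sup>2"
    using s right_singular_norm(1)[OF rs, of ?x]
    by (simp add: power_mult_distrib nrm_sq sum_distrib_left[symmetric] ip_def)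
  finally have sq: "(nrm p (app q ?M ?x))\<^sup>2 \<le> (sing_val k M * nrm q ?x)\<^sup>2" .
  have "0 \<le> sing_val k M" using s by simp
  then have le: "nrm p (app q ?M ?x) \<le> sing_val k M * nrm q ?x"
    by (intro power2_le_imp_le[OF sq] mult_nonneg_nonneg nrm_ge0)
  have "nrm q ?x \<noteq> 0" using inj[of c] cz by argo
  then have pos: "nrm q ?x > 0" using nrm_ge0[of q ?x] by linarith
  have "s * nrm q ?x \<le> sing_val k M * nrm q ?x" using ge[of c] le by linarith
  then show "s \<le> sing_val k M" using pos by simp
  assume "\<And>c. nrm p (app q (ent M) (app k N c)) = 0 \<Longrightarrow> nrm k c = 0"
  from this[of c] have "nrm p (app q ?M ?x) \<noteq> 0" using cz by argo
  then have "0 < sing_val k M * nrm q ?x" using le nrm_ge0[of p "app q ?M ?x"] by linarith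
  then show "0 < sing_val k M" using pos by (rule zero_less_mult_pos2)
qed

lemma norm_le_sing_val_1:
  assumes M: "M \<in> carrier_mat p q"
  shows "nrm p (app q (ent M) x) \<le> sing_val 1 M * nrm q x"
\<comment> \<open>Without rows or columns \<open>sing_val 1 M\<close> has its default value 0, and
  both sides vanish.\<close>
proof (cases "p = 0 \<or> q = 0")
  case True
  then show ?thesis using M by (auto simp: sing_val_def nrm_def ip_def app_def)
next
  case False
  obtain Q d where Qd: "right_singular p q (ent M) Q d \<and> (\<forall>i j. i \<le> j \<longrightarrow> j < q \<longrightarrow> d j \<le> d i) \<and>
    (\<forall>i<q. 0 \<le> d i) \<and> (\<forall>i. 1 \<le> i \<longrightarrow> i \<le> min p q \<longrightarrow> sing_val i M = sqrt (d (i - 1)))"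
    using singular_system_exists[OF M] by (elim exE) (rule that)
  have rs: "right_singular p q (ent M) Q d" using Qd by (rule conjunct1)
  have mono: "d j \<le> d i" if "i \<le> j" "j < q" for i j
    using Qd[THEN conjunct2, THEN conjunct1] that by simp
  have d0: "0 \<le> d i" if "i < q" for i
    using Qd[THEN conjunct2, THEN conjunct2, THEN conjunct1] that by simp
  have sv: "sing_val i M = sqrt (d (i - 1))" if "1 \<le> i" "i \<le> min p q" for i
    using Qd[THEN conjunct2, THEN conjunct2, THEN conjunct2] that by simp
  have s: "sing_val 1 M = sqrt (d 0)" "d 0 \<ge> 0" using sv[of 1] False d0[of 0] by auto
  have "(nrm p (app q (ent M) x))\<^sup>2 = (\<Sum>l<q. d l * (app q (tr Q) x l * app q (tr Q) x l))"
    unfolding nrm_sq right_singular_norm(2)[OF rs] by (simp add: mult.assoc)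
  also have "\<dots> \<le> (\<Sum>l<q. d 0 * (app q (tr Q) x l * app q (tr Q) x l))"
    using mono by (intro sum_mono mult_right_mono) auto
  also have "\<dots> = (sing_val 1 M * nrm q x)\<^sup>2"
    using s right_singular_norm(1)[OF rs, of x]
    by (simp add: power_mult_distrib nrm_sq sum_distrib_left[symmetric] ip_def)
  finally have sq: "(nrm p (app q (ent M) x))\<^sup>2 \<le> (sing_val 1 M * nrm q x)\<^sup>2" .
  have "0 \<le> sing_val 1 M" using s by simp
  then show ?thesis by (intro power2_le_imp_le[OF sq] mult_nonneg_nonneg nrm_ge0)
qed

section \<open>A trace inequality for powers\<close>

definition mtrace :: "real mat \<Rightarrow> real" where
  "mtrace A = (\<Sum>i<dim_row A. A $$ (i,i))"

lemma mtrace_mult: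
  assumes "A \<in> carrier_mat n m" "B \<in> carrier_mat m n"
  shows "mtrace (A * B) = (\<Sum>i<n. \<Sum>j<m. A $$ (i,j) * B $$ (j,i))"
  using assms unfolding mtrace_def by (simp add: scalar_prod_def lessThan_atLeast0)

lemma mtrace_comm:
  assumes "A \<in> carrier_mat n m" "B \<in> carrier_mat m n"
  shows "mtrace (A * B) = mtrace (B * A)"
  unfolding mtrace_mult[OF assms] mtrace_mult[OF assms(2,1)]
  by (subst sum.swap) (simp add: mult.commute)

lemma mtrace_cauchy:
  assumes "A \<in> carrier_mat n n" "B \<in> carrier_mat n n"
  shows "mtrace (A * B) \<le> sqrt (mtrace (A * transpose_mat A)) * sqrt (mtrace (transpose_mat B * B))"
proof -
  let ?I = "{..<n} \<times> {..<n}"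
  let ?f = "\<lambda>(i,j). A $$ (i,j)" and ?g = "\<lambda>(i,j). B $$ (j,i)"
  have "mtrace (A * B) = (\<Sum>p\<in>?I. ?f p * ?g p)"
    unfolding mtrace_mult[OF assms] by (simp add: sum.cartesian_product case_prod_unfold)
  also have "\<dots> \<le> (\<Sum>p\<in>?I. \<bar>?f p\<bar> * \<bar>?g p\<bar>)"
    by (intro sum_mono) (metis abs_ge_self abs_mult)
  also have "\<dots> \<le> L2_set ?f ?I * L2_set ?g ?I" by (rule L2_set_mult_ineq)
  also have "L2_set ?f ?I = sqrt (mtrace (A * transpose_mat A))"
    unfolding L2_set_def using assms(1)
    by (subst mtrace_mult[of _ n n]) (auto simp: sum.cartesian_product case_prod_unfold power2_eq_square)
  also have "L2_set ?g ?I = sqrt (mtrace (transpose_mat B * B))"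
    unfolding L2_set_def using assms(2)
    by (subst mtrace_mult[of _ n n]) (auto simp: sum.cartesian_product case_prod_unfold power2_eq_square)
  finally show ?thesis .
qed

text \<open>This is the power with exponent 2^j. Squaring the base instead of the result lets the
  inductions below pass from \<open>A\<close> to \<open>A * A\<close>.\<close>

primrec sqpow :: "real mat \<Rightarrow> nat \<Rightarrow> real mat" where
  "sqpow A 0 = A"
| "sqpow A (Suc j) = sqpow (A * A) j"

lemma sqpow_carrier [simp]: "A \<in> carrier_mat n n \<Longrightarrow> sqpow A j \<in> carrier_mat n n"
  by (induction j arbitrary: A) auto

lemma sqpow_mult_self: "A \<in> carrier_mat n n \<Longrightarrow> sqpow A j * sqpow A j = sqpow A (Suc j)"
proof (induction j arbitrary: A)
  case (Suc j)
  then show ?case using Suc.IH[of "A * A"] by simp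
qed simp

lemma transpose_sqpow:
  "A \<in> carrier_mat n n \<Longrightarrow> transpose_mat (sqpow A j) = sqpow (transpose_mat A) j"
proof (induction j arbitrary: A)
  case (Suc j)
  then show ?case using Suc.IH[of "A * A"] by (simp add: transpose_mult[of _ n n _ n])
qed simp

text \<open>Cyclicity of the trace, pushed through the powers: U V U V = U (V U V) and V U V U = (V
  U V) U, so the induction hypothesis applies to \<open>U\<close> and
  \<open>V * U * V\<close>.\<close>

lemma mtrace_sqpow_comm:
  assumes "U \<in> carrier_mat n n" "V \<in> carrier_mat n n"
  shows "mtrace (sqpow (U * V) j) = mtrace (sqpow (V * U) j)"
  using assms
proof (induction j arbitrary: U V)
  case (Suc j)
  have "U * V * (U * V) = U * (V * U * V)" "V * U * (V * U) = V * U * V * U"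
    using Suc.prems by (simp_all add: assoc_mult_mat[of _ n n _ n _ n] mult_carrier_mat[of _ n n _ n])
  then show ?case using Suc.IH[of U "V * U * V"] Suc.prems by simp
qed (use mtrace_comm in auto)

text \<open>
  The inequality \<open>tr ((A B)\<^sup>p) \<le> tr (A\<^sup>p B\<^sup>p)\<close> for \<open>p = 2\<^sup>j\<close> takes the place of the Golden-Thompson
  inequality; the second conjunct makes the induction on \<open>j\<close> go through.
\<close>

lemma mtrace_sqpow_mult_le_aux:
  "(\<forall>A B. A \<in> carrier_mat n n \<longrightarrow> B \<in> carrier_mat n n \<longrightarrow> transpose_mat A = A \<longrightarrow> transpose_mat B = B \<longrightarrow>
      mtrace (sqpow (A * B) j) \<le> mtrace (sqpow A j * sqpow B j)) \<and>
   (\<forall>W. W \<in> carrier_mat n n \<longrightarrow> mtrace (sqpow W (Suc j)) \<le> mtrace (sqpow (W * transpose_mat W) j))"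
proof (induction j)
  case 0
  have "mtrace (W * W) \<le> mtrace (W * transpose_mat W)" if W: "W \<in> carrier_mat n n" for W
  proof -
    have "mtrace (W * transpose_mat W) = (\<Sum>i<n. \<Sum>j<n. (W $$ (i,j))\<^sup>2)"
      using W by (subst mtrace_mult[of _ n n]) (auto simp: power2_eq_square intro!: sum.cong)
    then have "0 \<le> mtrace (W * transpose_mat W)" by (simp add: sum_nonneg)
    then show ?thesis
      using mtrace_cauchy[OF W W] mtrace_comm[of W n n "transpose_mat W"] W by simp
  qed
  then show ?case by simp
next
  case (Suc j)
  have P: "mtrace (sqpow (A * B) j) \<le> mtrace (sqpow A j * sqpow B j)"
    if "A \<in> carrier_mat n n" "B \<in> carrier_mat n n" "transpose_mat A = A" "transpose_mat B = B" for A B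
    using Suc that by blast
  have Q: "mtrace (sqpow W (Suc j)) \<le> mtrace (sqpow (W * transpose_mat W) j)" if "W \<in> carrier_mat n n" for W
    using Suc that by blast
  note as = assoc_mult_mat[of _ n n _ n _ n] mult_carrier_mat[of _ n n _ n] transpose_mult[of _ n n _ n]
  have "mtrace (sqpow (A * B) (Suc j)) \<le> mtrace (sqpow A (Suc j) * sqpow B (Suc j))"
    if A: "A \<in> carrier_mat n n" "transpose_mat A = A" and B: "B \<in> carrier_mat n n" "transpose_mat B = B" for A B
  proof -
    \<comment> \<open>The second conjunct symmetrizes (A B)^2 to A B B A, and cyclicity turns this
      into (A A) (B B), a product of symmetric matrices with one squaring less to go.\<close>
    have "mtrace (sqpow (A * B) (Suc j)) \<le> mtrace (sqpow (A * B * transpose_mat (A * B)) j)"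
      using A B by (intro Q) auto
    also have "A * B * transpose_mat (A * B) = A * (B * B * A)" using A B by (simp add: as)
    also have "mtrace (sqpow \<dots> j) = mtrace (sqpow (B * B * A * A) j)"
      using A B by (intro mtrace_sqpow_comm[of _ n]) (auto simp: as)
    also have "B * B * A * A = (B * B) * (A * A)" using A B by (simp add: as)
    also have "mtrace (sqpow \<dots> j) = mtrace (sqpow ((A * A) * (B * B)) j)"
      using A B by (intro mtrace_sqpow_comm[of _ n]) (auto simp: as)
    also have "\<dots> \<le> mtrace (sqpow (A * A) j * sqpow (B * B) j)"
      using A B by (intro P) (auto simp: as)
    finally show ?thesis by simp
  qed
  moreover have "mtrace (sqpow W (Suc (Suc j))) \<le> mtrace (sqpow (W * transpose_mat W) (Suc j))"
    if W: "W \<in> carrier_mat n n" for W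
  proof -
    let ?C = "transpose_mat W * W" and ?D = "W * transpose_mat W"
    have C: "?C \<in> carrier_mat n n" "transpose_mat ?C = ?C" and D: "?D \<in> carrier_mat n n" "transpose_mat ?D = ?D"
      using W by (auto simp: as)
    have "mtrace (sqpow W (Suc (Suc j))) \<le> mtrace (sqpow (W * W * transpose_mat (W * W)) j)"
      using Q[of "W * W"] W by simp
    also have "W * W * transpose_mat (W * W) = W * (W * transpose_mat W) * transpose_mat W"
      using W by (simp add: as)
    also have "mtrace (sqpow (W * (W * transpose_mat W) * transpose_mat W) j)
        = mtrace (sqpow (transpose_mat W * (W * (W * transpose_mat W))) j)"
      using W by (intro mtrace_sqpow_comm[of _ n]) (auto simp: as)
    also have "transpose_mat W * (W * (W * transpose_mat W)) = ?C * ?D" using W by (simp add: as)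
    also have "mtrace (sqpow (?C * ?D) j) \<le> mtrace (sqpow ?C j * sqpow ?D j)"
      using C D by (intro P)
    \<comment> \<open>Cauchy-Schwarz splits the product. As \<open>W^T W\<close> and
      \<open>W W^T\<close> have equal power traces, the two square roots multiply to a single
      trace.\<close>
    also have "\<dots> \<le> sqrt (mtrace (sqpow ?C (Suc j))) * sqrt (mtrace (sqpow ?D (Suc j)))"
      using mtrace_cauchy[of "sqpow ?C j" n "sqpow ?D j"] C D
      by (simp add: transpose_sqpow[of _ n] sqpow_mult_self[of _ n])
    also have "mtrace (sqpow ?C (Suc j)) = mtrace (sqpow ?D (Suc j))"
      using W by (intro mtrace_sqpow_comm[of _ n]) auto
    also have "sqrt (mtrace (sqpow ?D (Suc j))) * sqrt (mtrace (sqpow ?D (Suc j))) = mtrace (sqpow ?D (Suc j))"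
    proof -
      have "mtrace (sqpow ?D (Suc j)) = mtrace (sqpow ?D j * transpose_mat (sqpow ?D j))"
        using D by (simp add: transpose_sqpow[of _ n] sqpow_mult_self[of _ n])
      also have "\<dots> = (\<Sum>i<n. \<Sum>k<n. (sqpow ?D j $$ (i,k))\<^sup>2)"
        using sqpow_carrier[OF D(1), of j]
        by (subst mtrace_mult[of _ n n]) (auto simp: power2_eq_square intro!: sum.cong)
      finally have "0 \<le> mtrace (sqpow ?D (Suc j))" by (simp add: sum_nonneg)
      then show ?thesis by simp
    qed
    finally show ?thesis .
  qed
  ultimately show ?case by blast
qed

lemmas mtrace_sqpow_mult_le = mtrace_sqpow_mult_le_aux[THEN conjunct1, rule_format]

lemma sqpow_mat_diag: "sqpow (mat_diag r f) j = mat_diag r (\<lambda>l. f l ^ (2 ^ j))"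
  by (induction j arbitrary: f) (simp_all add: power_mult power2_eq_square[symmetric] flip: power_mult)

section \<open>Powers of rank-one perturbations of the identity\<close>

definition rank_one_perturb :: "nat \<Rightarrow> (nat \<Rightarrow> real) \<Rightarrow> real \<Rightarrow> real mat" where
  "rank_one_perturb r w c = Matrix.mat r r (\<lambda>(i,j). (if i = j then 1 else 0) - c * w i * w j)"

lemma rank_one_perturb_carrier [simp]: "rank_one_perturb r w c \<in> carrier_mat r r"
  unfolding rank_one_perturb_def by simp

lemma rank_one_perturb_square:
  "rank_one_perturb r w c * rank_one_perturb r w c = rank_one_perturb r w (2 * c - c * c * (\<Sum>l<r. w l * w l))"
  (is "?M * ?M = ?N")
proof (rule eq_matI)
  fix i j assume "i < dim_row ?N" "j < dim_col ?N"
  then have ij: "i < r" "j < r" by (auto simp: rank_one_perturb_def)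
  then have "(?M * ?M) $$ (i,j) = (\<Sum>l<r. ((if i = l then 1 else 0) - c * w i * w l) * ((if l = j then 1 else 0) - c * w l * w j))"
    by (simp add: rank_one_perturb_def scalar_prod_def lessThan_atLeast0)
  also have "\<dots> = (\<Sum>l<r. (if l = i then (if i = j then 1 else 0) else 0)
        - (if l = i then c * w i * w j else 0) - (if l = j then c * w i * w j else 0)
        + c * c * w i * w j * (w l * w l))"
    by (intro sum.cong) (auto simp: algebra_simps)
  also have "\<dots> = (if i = j then 1 else 0) - 2 * c * w i * w j + c * c * (\<Sum>l<r. w l * w l) * w i * w j"
    using ij by (simp add: sum.distrib sum_subtractf sum_distrib_left[symmetric])
  finally show "(?M * ?M) $$ (i,j) = ?N $$ (i,j)"
    using ij by (simp add: rank_one_perturb_def algebra_simps)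
qed (auto simp: rank_one_perturb_def)

text \<open>Squaring acts on the coefficient of a rank-one perturbation by x -> 2 x - x^2 s, which
  increases as long as x s \<le> 1.\<close>

lemma double_minus_square_mono:
  fixes x :: real
  assumes "x \<le> c" "c * s \<le> 1" "x * s \<le> 1"
  shows "2 * x - x * x * s \<le> 2 * c - c * c * s"
proof -
  have "0 \<le> (c - x) * ((1 - c * s) + (1 - x * s))"
    using assms by (intro mult_nonneg_nonneg) auto
  then show ?thesis by (simp add: algebra_simps)
qed

text \<open>The inverse of I + P w w^T is the rank-one perturbation with coefficient P / (1 + P s),
  where s = |w|^2. The claim compares the square of this inverse with the inverse of I + 2 P w w^T
  and amounts to (1 + P s)^2 \<ge> 1 + 2 P s.\<close>

lemma double_fraction_le:
  fixes P :: real
  assumes "0 < P" "0 \<le> s"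
  shows "2 * P / (1 + 2 * P * s) \<le> 2 * (P / (1 + P * s)) - P / (1 + P * s) * (P / (1 + P * s)) * s"
proof -
  define t where "t = P * s"
  have t: "0 \<le> t" using assms unfolding t_def by simp
  then have d: "0 < 1 + t" "0 < 1 + 2 * t" by auto
  have "2 * P * ((1 + t) * (1 + t)) \<le> P * (2 + t) * (1 + 2 * t)"
  proof -
    have "P * (2 + t) * (1 + 2 * t) - 2 * P * ((1 + t) * (1 + t)) = P * t" by (simp add: algebra_simps)
    moreover have "0 \<le> P * t" using assms t by simp
    ultimately show ?thesis by linarith
  qed
  then have "2 * P / (1 + 2 * t) \<le> P * (2 + t) / ((1 + t) * (1 + t))"
    using d by (simp add: pos_divide_le_eq pos_le_divide_eq)
  also have "P * (2 + t) / ((1 + t) * (1 + t)) = 2 * (P / (1 + t)) - P / (1 + t) * (P / (1 + t)) * s"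
  proof -
    have "P / (1 + t) * (P / (1 + t)) * s = P * t / ((1 + t) * (1 + t))" unfolding t_def by (simp add: mult_ac)
    moreover have "2 * (P / (1 + t)) = 2 * P * (1 + t) / ((1 + t) * (1 + t))" using d by simp
    ultimately show ?thesis by (simp add: diff_divide_distrib[symmetric] algebra_simps)
  qed
  finally show ?thesis unfolding t_def by (simp add: mult.assoc)
qed

lemma mat_diag_cong: "(\<And>l. l < r \<Longrightarrow> f l = g l) \<Longrightarrow> mat_diag r f = mat_diag r g"
  unfolding mat_diag_def by (intro eq_matI) auto

text \<open>Each squaring doubles \<open>P\<close> in the lower bound P / (1 + P s), and c s \<le> 1
  survives because 1 - c s gets squared.\<close>

lemma sqpow_rank_one_perturb:
  assumes "P / (1 + P * s) \<le> c" "0 < P" "c * s \<le> 1" "s = (\<Sum>l<r. w l * w l)"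
  shows "\<exists>c'\<ge>2 ^ j * P / (1 + 2 ^ j * P * s). sqpow (rank_one_perturb r w c) j = rank_one_perturb r w c'"
  using assms(1-3)
proof (induction j arbitrary: P c)
  case 0
  then show ?case by (intro exI[of _ c]) simp
next
  case (Suc j)
  have s: "0 \<le> s" unfolding assms(4) by (intro sum_nonneg) simp
  let ?c = "2 * c - c * c * s" and ?x = "P / (1 + P * s)"
  have d: "0 < 1 + P * s" "0 < 1 + 2 * P * s" using s Suc.prems(2) by (simp_all add: add_pos_nonneg)
  have xs: "?x * s \<le> 1" using d by (simp add: field_simps)
  have "2 * P / (1 + 2 * P * s) \<le> 2 * ?x - ?x * ?x * s"
    using double_fraction_le[of P s] Suc.prems(2) s by simp
  also have "\<dots> \<le> ?c" by (rule double_minus_square_mono[OF Suc.prems(1,3) xs])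
  finally have 1: "2 * P / (1 + 2 * P * s) \<le> ?c" .
  have 2: "?c * s \<le> 1" using zero_le_square[of "1 - c * s"] by (simp add: algebra_simps)
  from Suc.IH[OF 1 _ 2] Suc.prems(2)
  show ?case using rank_one_perturb_square[of r w c] unfolding assms(4)[symmetric] by (simp add: mult.assoc mult.left_commute)
qed

text \<open>By Sherman-Morrison, the inverse of diag h + y y^T is K (I - c w w^T) K with
  \<open>K\<close> the inverse square root of diag h. Cyclicity and the trace inequality separate
  its p-th power into those of diag h and of I - c w w^T. The latter is again a rank-one
  perturbation of the identity, and the trace is linear in its coefficient, which gives the
  gain.\<close>

lemma rank_one_power_trace:
  assumes h: "\<And>l. l < r \<Longrightarrow> 0 < h l" and h': "\<And>l. l < r \<Longrightarrow> 0 < h' l"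
    and Q: "Q \<in> carrier_mat r r" "transpose_mat Q * Q = 1\<^sub>m r"
    and eq: "Matrix.mat r r (\<lambda>(i,j). (if i = j then h i else 0) + y i * y j) = Q * mat_diag r h' * transpose_mat Q"
    and small: "(\<Sum>l<r. (y l)\<^sup>2 / h l) \<le> 1 / p" and p: "p = 2 ^ j"
  shows "(\<Sum>l<r. (1 / h' l) ^ p) \<le> (\<Sum>l<r. (1 / h l) ^ p) - p / 2 * (\<Sum>l<r. (1 / h l) ^ (p + 1) * (y l)\<^sup>2)"
proof -
  let ?H = "Matrix.mat r r (\<lambda>(i,j). (if i = j then h i else 0) + y i * y j)"
  define w where "w l = y l / sqrt (h l)" for l
  define s where "s = (\<Sum>l<r. w l * w l)"
  define c where "c = 1 / (1 + s)"
  define K where "K = mat_diag r (\<lambda>l. 1 / sqrt (h l))"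
  let ?M = "rank_one_perturb r w c"
  define N where "N = Matrix.mat r r (\<lambda>(i,j). (if i = j then 1 / h i else 0) - c * (y i / h i) * (y j / h j))"
  define R where "R = Q * mat_diag r (\<lambda>l. 1 / h' l) * transpose_mat Q"
  have s0: "0 \<le> s" unfolding s_def by (intro sum_nonneg) simp
  have ww: "w l * w l = (y l)\<^sup>2 / h l" if "l < r" for l
    using h[OF that] unfolding w_def by (simp add: power2_eq_square)
  have s: "s = (\<Sum>l<r. (y l)\<^sup>2 / h l)" unfolding s_def using ww by simp
  have cs: "c * (1 + s) = 1" unfolding c_def using s0 by simp
  have K: "K \<in> carrier_mat r r" "transpose_mat K = K"
    unfolding K_def by (auto simp: mat_diag_def intro!: eq_matI)
  have KK: "K * K = mat_diag r (\<lambda>l. 1 / h l)"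
    unfolding K_def mat_diag_diag using h by (intro mat_diag_cong) (simp add: abs_of_pos)
  have N: "N \<in> carrier_mat r r" and R: "R \<in> carrier_mat r r" unfolding N_def R_def using Q by auto
  have NK: "N = K * ?M * K"
  proof (rule eq_matI)
    fix i j assume "i < dim_row (K * ?M * K)" "j < dim_col (K * ?M * K)"
    then have ij: "i < r" "j < r" using K by auto
    have "(K * ?M * K) $$ (i,j) = 1 / sqrt (h i) * ?M $$ (i,j) * (1 / sqrt (h j))"
      unfolding K_def using ij
      by (simp add: mat_diag_mult_left[of _ r r] mat_diag_mult_right[of _ r r])
    then show "N $$ (i,j) = (K * ?M * K) $$ (i,j)"
      using ij h[OF ij(1)] h[OF ij(2)] unfolding N_def rank_one_perturb_def w_def
      by (auto simp: algebra_simps)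
  qed (use N K in auto)
  have QQ: "Q * transpose_mat Q = 1\<^sub>m r"
    using mat_mult_left_right_inverse[of "transpose_mat Q" r Q] Q by simp
  note as = assoc_mult_mat[of _ r r _ r _ r] mult_carrier_mat[of _ r r _ r]
  have "?H * R = Q * (mat_diag r h' * (transpose_mat Q * Q) * mat_diag r (\<lambda>l. 1 / h' l)) * transpose_mat Q"
    unfolding eq R_def using Q(1) by (simp add: as)
  also have "mat_diag r h' * (transpose_mat Q * Q) * mat_diag r (\<lambda>l. 1 / h' l) = 1\<^sub>m r"
    unfolding Q(2) mat_diag_one[symmetric] mat_diag_diag using h' by (intro mat_diag_cong) (simp add: less_imp_neq[symmetric])
  finally have HR: "?H * R = 1\<^sub>m r" using Q(1) QQ by simp
  have NH: "N * ?H = 1\<^sub>m r"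
  proof (rule eq_matI)
    fix i j assume "i < dim_row (1\<^sub>m r)" "j < dim_col (1\<^sub>m r)"
    then have ij: "i < r" "j < r" by auto
    then have "(N * ?H) $$ (i,j) = (\<Sum>l<r. ((if i = l then 1 / h i else 0) - c * (y i / h i) * (y l / h l))
        * ((if l = j then h l else 0) + y l * y j))"
      unfolding N_def by (simp add: scalar_prod_def lessThan_atLeast0)
    also have "\<dots> = (\<Sum>l<r. (if l = i then (if i = j then 1 else 0) else 0) + (if l = i then y i * y j / h i else 0)
        - (if l = j then c * (y i / h i) * y j else 0) - c * (y i / h i) * y j * ((y l)\<^sup>2 / h l))"
      using h ij by (intro sum.cong) (auto simp: divide_simps power2_eq_square algebra_simps dest!: h)
    also have "\<dots> = (if i = j then 1 else 0) + y i * y j / h i - c * (1 + s) * (y i * y j / h i)"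
    proof -
      have "(\<Sum>l<r. c * (y i / h i) * y j * ((y l)\<^sup>2 / h l)) = c * (y i / h i) * y j * s"
        unfolding s by (rule sum_distrib_left[symmetric])
      then show ?thesis using ij by (simp add: sum.distrib sum_subtractf algebra_simps add_divide_distrib)
    qed
    finally show "(N * ?H) $$ (i,j) = 1\<^sub>m r $$ (i,j)" using ij cs by simp
  qed (use N in auto)
  have "N = N * (?H * R)" unfolding HR using N by simp
  also have "\<dots> = R" using NH N R assoc_mult_mat[of N r r ?H r R r] by simp
  finally have NR: "N = R" .
  have "(\<Sum>l<r. (1 / h' l) ^ p) = mtrace (sqpow (mat_diag r (\<lambda>l. 1 / h' l)) j)"
    unfolding sqpow_mat_diag p by (simp add: mtrace_def mat_diag_def)
  also have "mat_diag r (\<lambda>l. 1 / h' l) = transpose_mat Q * (Q * mat_diag r (\<lambda>l. 1 / h' l))"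
    using assoc_mult_mat[of "transpose_mat Q" r r Q r "mat_diag r (\<lambda>l. 1 / h' l)" r] Q
    by (simp add: left_mult_one_mat[of _ r r])
  also have "mtrace (sqpow \<dots> j) = mtrace (sqpow R j)"
    unfolding R_def using Q by (intro mtrace_sqpow_comm[of _ r]) auto
  also have "\<dots> = mtrace (sqpow (K * (K * ?M)) j)"
    unfolding NR[symmetric] NK using K by (intro mtrace_sqpow_comm[of _ r]) auto
  also have "K * (K * ?M) = mat_diag r (\<lambda>l. 1 / h l) * ?M"
    unfolding KK[symmetric] using K by (simp add: as)
  also have "mtrace (sqpow \<dots> j) \<le> mtrace (sqpow (mat_diag r (\<lambda>l. 1 / h l)) j * sqpow ?M j)"
    by (intro mtrace_sqpow_mult_le[of _ r]) (auto simp: mat_diag_def rank_one_perturb_def intro!: eq_matI)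
  finally have le: "(\<Sum>l<r. (1 / h' l) ^ p) \<le> mtrace (mat_diag r (\<lambda>l. (1 / h l) ^ p) * sqpow ?M j)"
    unfolding sqpow_mat_diag p .
  have "c * s \<le> 1" unfolding c_def using s0 by (simp add: field_simps)
  then obtain c' where c': "c' \<ge> 2 ^ j / (1 + 2 ^ j * s)" "sqpow ?M j = rank_one_perturb r w c'"
    using sqpow_rank_one_perturb[where P = 1 and s = s and c = c and w = w and r = r and j = j] s_def
    unfolding c_def by auto
  \<comment> \<open>Smallness of the update keeps the coefficient of the p-th power above p / (1 + p
    s) \<ge> p / 2; for a larger update this bound would saturate.\<close>
  have "p * s \<le> 1" using small s p by (simp add: field_simps)
  moreover have "0 \<le> p * s" using s0 by simp
  ultimately have "real p / 2 \<le> p / (1 + p * s)" by (intro divide_left_mono) auto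
  also have "\<dots> \<le> c'" using c'(1) p by simp
  finally have c'p: "p / 2 \<le> c'" .
  have "mtrace (mat_diag r (\<lambda>l. (1 / h l) ^ p) * sqpow ?M j) = (\<Sum>l<r. (1 / h l) ^ p - c' * ((1 / h l) ^ p * (w l * w l)))"
    unfolding c'(2) mtrace_def
    by (simp add: mat_diag_mult_left[of _ r r]) (simp add: rank_one_perturb_def algebra_simps)
  also have "\<dots> = (\<Sum>l<r. (1 / h l) ^ p) - c' * (\<Sum>l<r. (1 / h l) ^ (p + 1) * (y l)\<^sup>2)"
    by (simp add: sum_subtractf sum_distrib_left ww mult_ac)
  also have "\<dots> \<le> (\<Sum>l<r. (1 / h l) ^ p) - p / 2 * (\<Sum>l<r. (1 / h l) ^ (p + 1) * (y l)\<^sup>2)"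
    using c'p h by (intro diff_left_mono mult_right_mono sum_nonneg) (auto simp: less_imp_le)
  finally show ?thesis using le by linarith
qed

section \<open>Smallest eigenvalue of a randomly sampled Gram matrix\<close>

definition gram :: "nat \<Rightarrow> (nat \<Rightarrow> nat \<Rightarrow> real) \<Rightarrow> nat set \<Rightarrow> real mat" where
  "gram r u I = Matrix.mat r r (\<lambda>(a,b). \<Sum>i\<in>I. u i a * u i b)"

text \<open>The eigenvalues come in an arbitrary order; later only sums over all of them and bounds
  for all or for some of them are formed.\<close>

definition eigvals :: "nat \<Rightarrow> real mat \<Rightarrow> nat \<Rightarrow> real" where
  "eigvals r S = (SOME d. \<exists>Q. Q \<in> carrier_mat r r \<and> transpose_mat Q * Q = 1\<^sub>m r \<and>
    S = Q * mat_diag r d * transpose_mat Q)"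

lemma eigvals_decomposition:
  assumes "S \<in> carrier_mat r r" "transpose_mat S = S"
  shows "\<exists>Q. Q \<in> carrier_mat r r \<and> transpose_mat Q * Q = 1\<^sub>m r \<and>
    S = Q * mat_diag r (eigvals r S) * transpose_mat Q"
proof -
  have "\<exists>d Q. Q \<in> carrier_mat r r \<and> transpose_mat Q * Q = 1\<^sub>m r \<and> S = Q * mat_diag r d * transpose_mat Q"
    using real_spectral_theorem[OF assms] by blast
  then show ?thesis unfolding eigvals_def by (rule someI_ex)
qed

lemma gram_carrier [simp]: "gram r u I \<in> carrier_mat r r" unfolding gram_def by simp
lemma gram_symmetric: "transpose_mat (gram r u I) = gram r u I"
  unfolding gram_def by (intro eq_matI) (auto simp: mult.commute)

definition coords :: "nat \<Rightarrow> real mat \<Rightarrow> (nat \<Rightarrow> nat \<Rightarrow> real) \<Rightarrow> nat \<Rightarrow> nat \<Rightarrow> real" where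
  "coords r Q u i l = (\<Sum>t<r. Q $$ (t,l) * u i t)"

lemma gram_conjugate:
  assumes Q: "Q \<in> carrier_mat r r"
  shows "transpose_mat Q * gram r u I * Q = Matrix.mat r r (\<lambda>(l,m). \<Sum>i\<in>I. coords r Q u i l * coords r Q u i m)"
    (is "_ = ?R")
proof (rule eq_matI)
  fix l m assume "l < dim_row ?R" "m < dim_col ?R"
  then have lm: "l < r" "m < r" by auto
  have "(transpose_mat Q * gram r u I * Q) $$ (l,m)
      = (\<Sum>b<r. (\<Sum>a<r. Q $$ (a,l) * (\<Sum>i\<in>I. u i a * u i b)) * Q $$ (b,m))"
    using Q lm unfolding gram_def by (simp add: scalar_prod_def lessThan_atLeast0)
  also have "\<dots> = (\<Sum>b<r. (\<Sum>i\<in>I. coords r Q u i l * u i b) * Q $$ (b,m))"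
  proof (intro sum.cong refl)
    fix b
    have "(\<Sum>a<r. Q $$ (a,l) * (\<Sum>i\<in>I. u i a * u i b)) = (\<Sum>a<r. \<Sum>i\<in>I. Q $$ (a,l) * u i a * u i b)"
      by (simp add: sum_distrib_left mult.assoc)
    also have "\<dots> = (\<Sum>i\<in>I. \<Sum>a<r. Q $$ (a,l) * u i a * u i b)" by (rule sum.swap)
    finally have "(\<Sum>a<r. Q $$ (a,l) * (\<Sum>i\<in>I. u i a * u i b)) = (\<Sum>i\<in>I. coords r Q u i l * u i b)"
      unfolding coords_def by (simp add: sum_distrib_right)
    then show "(\<Sum>a<r. Q $$ (a,l) * (\<Sum>i\<in>I. u i a * u i b)) * Q $$ (b,m)
      = (\<Sum>i\<in>I. coords r Q u i l * u i b) * Q $$ (b,m)" by (rule arg_cong)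
  qed
  also have "\<dots> = (\<Sum>b<r. \<Sum>i\<in>I. coords r Q u i l * (Q $$ (b,m) * u i b))"
    by (simp add: sum_distrib_right sum_distrib_left mult_ac)
  also have "\<dots> = (\<Sum>i\<in>I. \<Sum>b<r. coords r Q u i l * (Q $$ (b,m) * u i b))" by (rule sum.swap)
  also have "\<dots> = ?R $$ (l,m)" using lm unfolding coords_def by (simp add: sum_distrib_left)
  finally show "(transpose_mat Q * gram r u I * Q) $$ (l,m) = ?R $$ (l,m)" .
qed (use Q in auto)

lemma conjugate_diag:
  fixes Q :: "real mat"
  assumes Q: "Q \<in> carrier_mat r r" "transpose_mat Q * Q = 1\<^sub>m r" and S: "S = Q * mat_diag r d * transpose_mat Q"
  shows "transpose_mat Q * S * Q = mat_diag r d"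
proof -
  note as = assoc_mult_mat[of _ r r _ r _ r] mult_carrier_mat[of _ r r _ r]
  have "transpose_mat Q * S * Q = (transpose_mat Q * Q) * mat_diag r d * (transpose_mat Q * Q)"
    unfolding S using Q(1) by (simp add: as)
  also have "\<dots> = mat_diag r d"
    unfolding Q(2) left_mult_one_mat[OF mat_diag_dim] right_mult_one_mat[OF mat_diag_dim] ..
  finally show ?thesis .
qed

lemma index_conjugate_diag:
  fixes R :: "real mat"
  assumes "R \<in> carrier_mat r r" "l < r" "m < r"
  shows "(R * mat_diag r f * transpose_mat R) $$ (l,m) = (\<Sum>t<r. R $$ (l,t) * f t * R $$ (m,t))"
  using assms by (simp add: mat_diag_mult_right[of _ r] scalar_prod_def lessThan_atLeast0)

lemma index_mult_transpose:
  fixes R :: "real mat"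
  assumes "R \<in> carrier_mat r r" "l < r" "m < r"
  shows "(R * transpose_mat R) $$ (l,m) = (\<Sum>t<r. R $$ (l,t) * R $$ (m,t))"
  using assms by (simp add: scalar_prod_def lessThan_atLeast0)

text \<open>In an eigenbasis of their own Gram matrix, the coordinate sequences of the sampled rows
  are orthogonal, with the eigenvalues as squared norms. In particular the eigenvalues are
  nonnegative, which is used repeatedly.\<close>

lemma coords_square_sum:
  assumes Q: "Q \<in> carrier_mat r r" "transpose_mat Q * Q = 1\<^sub>m r"
    and S: "gram r u I = Q * mat_diag r d * transpose_mat Q" and "l < r" "m < r"
  shows "(\<Sum>i\<in>I. coords r Q u i l * coords r Q u i m) = (if l = m then d l else 0)"
proof -
  have "Matrix.mat r r (\<lambda>(l,m). \<Sum>i\<in>I. coords r Q u i l * coords r Q u i m) = mat_diag r d"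
    by (rule trans[OF gram_conjugate[OF Q(1), symmetric] conjugate_diag[OF Q S]])
  from arg_cong[OF this, of "\<lambda>M. M $$ (l,m)"]
  show ?thesis using assms(4,5) by (simp add: mat_diag_def)
qed

lemma coords_norm:
  assumes Q: "Q \<in> carrier_mat r r" "transpose_mat Q * Q = 1\<^sub>m r"
  shows "(\<Sum>l<r. (coords r Q u i l)\<^sup>2) = (\<Sum>t<r. (u i t)\<^sup>2)"
proof -
  have QQ: "Q * transpose_mat Q = 1\<^sub>m r"
    using mat_mult_left_right_inverse[of "transpose_mat Q" r Q] Q by simp
  have "(\<Sum>l<r. Q $$ (a,l) * Q $$ (b,l)) = (if a = b then 1 else 0)" if "a < r" "b < r" for a b
    using arg_cong[OF QQ, of "\<lambda>M. M $$ (a,b)"] that Q by (simp add: scalar_prod_def lessThan_atLeast0)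
  then have "ip r (app r (tr (ent Q)) (u i)) (app r (tr (ent Q)) (u i)) = ip r (u i) (u i)"
    by (intro app_orthonormal) (simp add: tr_def ent_def)
  then show ?thesis unfolding ip_def app_def tr_def ent_def coords_def by (simp add: power2_eq_square)
qed

definition potential :: "nat \<Rightarrow> nat \<Rightarrow> real \<Rightarrow> real \<Rightarrow> real mat \<Rightarrow> real" where
  "potential r p a b S = (\<Sum>l<r. (1 / (a * eigvals r S l + b)) ^ p)"

text \<open>The function h -> h^-p is convex and so lies above its tangent; this is derived from
  Bernoulli's inequality.\<close>

lemma inverse_power_tangent:
  fixes h d :: real
  assumes "0 < h" "0 \<le> d"
  shows "(1 / h) ^ p - p * d * (1 / h) ^ (p + 1) \<le> (1 / (h + d)) ^ p"
proof -
  have "-1 \<le> - (d / (h + d))" using assms by simp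
  then have "1 + p * (- (d / (h + d))) \<le> (1 + - (d / (h + d))) ^ p" by (rule Bernoulli_inequality)
  also have "1 + - (d / (h + d)) = h / (h + d)" using assms by (simp add: field_simps)
  finally have 1: "1 - p * (d / (h + d)) \<le> (h / (h + d)) ^ p" by simp
  have "d / (h + d) \<le> d / h" using assms by (intro divide_left_mono) auto
  then have "p * (d / (h + d)) \<le> p * (d / h)" by (intro mult_left_mono) auto
  with 1 have "1 - p * (d / h) \<le> (h / (h + d)) ^ p" by linarith
  then have "(1 / h) ^ p * (1 - p * (d / h)) \<le> (1 / h) ^ p * (h / (h + d)) ^ p"
    using assms by (intro mult_left_mono) auto
  also have "\<dots> = (1 / (h + d)) ^ p" using assms by (simp add: power_mult_distrib[symmetric])
  finally show ?thesis by (simp add: algebra_simps)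
qed

text \<open>
  The condition on \<open>a p L\<close> makes every single rank-one update small enough for
  \<open>rank_one_power_trace\<close>. Its gain is linear in the update, and the rows outside \<open>I\<close> have the
  Gram matrix \<open>1 - S\<close>; this is why averaging over them moves weight from \<open>a S\<close> to the identity.
\<close>

lemma potential_step:
  assumes orth: "\<And>t t'. t < r \<Longrightarrow> t' < r \<Longrightarrow> (\<Sum>i<n. u i t * u i t') = (if t = t' then 1 else 0)"
    and L: "\<And>i. i < n \<Longrightarrow> (\<Sum>t<r. (u i t)\<^sup>2) \<le> L" and I: "I \<subseteq> {..<n}"
    and p: "p = 2 ^ j" and ab: "0 \<le> a" "0 < b" "a * p * L \<le> b"
  shows "(\<Sum>i\<in>{..<n} - I. potential r p a b (gram r u (insert i I)))
    \<le> (n - card I) * potential r p (a * (1 - 1 / (2 * n))) (b + a * (1 / (2 * n))) (gram r u I)"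
proof -
  let ?S = "gram r u I" and ?w = "1 / (2 * real n)"
  define \<sigma> where "\<sigma> = eigvals r ?S"
  obtain Q where Q: "Q \<in> carrier_mat r r" "transpose_mat Q * Q = 1\<^sub>m r"
    and S: "?S = Q * mat_diag r \<sigma> * transpose_mat Q"
    using eigvals_decomposition[of ?S r] gram_symmetric unfolding \<sigma>_def by auto
  have QQ: "Q * transpose_mat Q = 1\<^sub>m r"
    using mat_mult_left_right_inverse[of "transpose_mat Q" r Q] Q by simp
  let ?z = "coords r Q u"
  have finI: "finite I" using I finite_subset by blast
  have zI: "(\<Sum>i\<in>I. ?z i l * ?z i m) = (if l = m then \<sigma> l else 0)" if "l < r" "m < r" for l m
    by (rule coords_square_sum[OF Q S that])
  have "gram r u {..<n} = 1\<^sub>m r" unfolding gram_def using orth by (intro eq_matI) auto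
  also have "\<dots> = Q * mat_diag r (\<lambda>_. 1) * transpose_mat Q"
    using Q QQ by (simp add: right_mult_one_mat[of _ r r])
  finally have zn: "(\<Sum>i<n. ?z i l * ?z i l) = 1" if "l < r" for l
    using coords_square_sum[OF Q, of u "{..<n}" "\<lambda>_. 1" l l] that by simp
  have zc: "(\<Sum>i\<in>{..<n} - I. (?z i l)\<^sup>2) = 1 - \<sigma> l" if "l < r" for l
    using sum_diff[of "{..<n}" I "\<lambda>i. ?z i l * ?z i l"] I zn[OF that] zI[OF that that]
    by (simp add: power2_eq_square)
  have \<sigma>0: "0 \<le> \<sigma> l" if "l < r" for l
    using zI[OF that that] sum_nonneg[of I "\<lambda>i. ?z i l * ?z i l"] by simp
  have \<sigma>1: "\<sigma> l \<le> 1" if "l < r" for l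
    using zc[OF that] sum_nonneg[of "{..<n} - I" "\<lambda>i. (?z i l)\<^sup>2"] by simp
  define h where "h l = a * \<sigma> l + b" for l
  have hb: "b \<le> h l" "0 < h l" if "l < r" for l
    using \<sigma>0[OF that] ab unfolding h_def by (simp_all add: add_nonneg_pos)
  have p0: "0 < p" using p by simp
  \<comment> \<open>In the eigenbasis of \<open>?S\<close>, a new row turns a S + b into a diagonal
    matrix plus the rank-one term of \<open>?y\<close>, whose eigenvectors are the columns of
    \<open>?R\<close>. This is the situation of \<open>rank_one_power_trace\<close>.\<close>
  have one: "potential r p a b (gram r u (insert i I))
      \<le> (\<Sum>l<r. (1 / h l) ^ p) - p / 2 * (\<Sum>l<r. (1 / h l) ^ (p + 1) * (a * (?z i l)\<^sup>2))"
    if i: "i \<in> {..<n} - I" for i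
  proof -
    let ?S' = "gram r u (insert i I)"
    define \<sigma>' where "\<sigma>' = eigvals r ?S'"
    obtain Q' where Q': "Q' \<in> carrier_mat r r" "transpose_mat Q' * Q' = 1\<^sub>m r"
      and S': "?S' = Q' * mat_diag r \<sigma>' * transpose_mat Q'"
      using eigvals_decomposition[of ?S' r] gram_symmetric unfolding \<sigma>'_def by auto
    have QQ': "Q' * transpose_mat Q' = 1\<^sub>m r"
      using mat_mult_left_right_inverse[of "transpose_mat Q'" r Q'] Q' by simp
    have \<sigma>'0: "0 \<le> \<sigma>' l" if "l < r" for l
      using coords_square_sum[OF Q' S' that that] sum_nonneg[of "insert i I" "\<lambda>i. coords r Q' u i l * coords r Q' u i l"] by simp
    let ?h' = "\<lambda>l. a * \<sigma>' l + b" and ?R = "transpose_mat Q * Q'" and ?y = "\<lambda>l. sqrt a * ?z i l"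
    have R: "?R \<in> carrier_mat r r" using Q Q' by simp
    note as = assoc_mult_mat[of _ r r _ r _ r] mult_carrier_mat[of _ r r _ r] transpose_mult[of _ r r _ r]
    have RR: "transpose_mat ?R * ?R = 1\<^sub>m r"
    proof -
      have "transpose_mat ?R * ?R = transpose_mat Q' * (Q * transpose_mat Q) * Q'"
        using Q(1) Q'(1) by (simp add: as)
      then show ?thesis unfolding QQ using Q' by simp
    qed
    have RR': "?R * transpose_mat ?R = 1\<^sub>m r"
      using mat_mult_left_right_inverse[of "transpose_mat ?R" r ?R] RR R by simp
    have "transpose_mat Q * ?S' * Q = ?R * mat_diag r \<sigma>' * transpose_mat ?R"
      unfolding S' using Q(1) Q'(1) by (simp add: as)
    then have e: "?R * mat_diag r \<sigma>' * transpose_mat ?R = Matrix.mat r r (\<lambda>(l,m). \<Sum>i\<in>insert i I. ?z i l * ?z i m)"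
      using gram_conjugate[OF Q(1), of u "insert i I"] by simp
    have eq: "Matrix.mat r r (\<lambda>(l,m). (if l = m then h l else 0) + ?y l * ?y m) = ?R * mat_diag r ?h' * transpose_mat ?R"
      (is "?A = ?B")
    proof (rule eq_matI)
      fix l m assume "l < dim_row ?B" "m < dim_col ?B"
      then have lm: "l < r" "m < r" using Q Q' by auto
      have "?B $$ (l,m) = (\<Sum>t<r. ?R $$ (l,t) * ?h' t * ?R $$ (m,t))"
        by (rule index_conjugate_diag[OF R lm])
      also have "\<dots> = a * (\<Sum>t<r. ?R $$ (l,t) * \<sigma>' t * ?R $$ (m,t)) + b * (\<Sum>t<r. ?R $$ (l,t) * ?R $$ (m,t))"
        unfolding sum_distrib_left sum.distrib[symmetric]
        by (intro sum.cong refl) (simp only: distrib_left distrib_right mult_ac)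
      also have "(\<Sum>t<r. ?R $$ (l,t) * \<sigma>' t * ?R $$ (m,t)) = (?R * mat_diag r \<sigma>' * transpose_mat ?R) $$ (l,m)"
        by (rule index_conjugate_diag[OF R lm, symmetric])
      also have "\<dots> = (\<Sum>i\<in>insert i I. ?z i l * ?z i m)" unfolding e using lm by simp
      also have "\<dots> = ?z i l * ?z i m + (if l = m then \<sigma> l else 0)" using i finI zI[OF lm] by simp
      also have "(\<Sum>t<r. ?R $$ (l,t) * ?R $$ (m,t)) = (?R * transpose_mat ?R) $$ (l,m)"
        by (rule index_mult_transpose[OF R lm, symmetric])
      also have "\<dots> = (if l = m then 1 else 0)" unfolding RR' using lm by simp
      finally show "?A $$ (l,m) = ?B $$ (l,m)" using lm ab(1) unfolding h_def
        by (simp add: algebra_simps del: index_mult_mat)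
    qed (use Q Q' in auto)
    have "(\<Sum>l<r. (?y l)\<^sup>2 / h l) \<le> (\<Sum>l<r. (a / b) * (?z i l)\<^sup>2)"
    proof (intro sum_mono)
      fix l assume "l \<in> {..<r}"
      then have "a * (?z i l)\<^sup>2 / h l \<le> a * (?z i l)\<^sup>2 / b"
        using hb[of l] ab by (intro divide_left_mono) auto
      then show "(?y l)\<^sup>2 / h l \<le> (a / b) * (?z i l)\<^sup>2" using ab(1) by (simp add: power_mult_distrib)
    qed
    also have "\<dots> = (a / b) * (\<Sum>t<r. (u i t)\<^sup>2)" 
      using coords_norm[OF Q, of u i] by (simp only: sum_distrib_left[symmetric])
    also have "\<dots> \<le> (a / b) * L" using ab L[of i] i by (intro mult_left_mono) auto
    also have "\<dots> \<le> 1 / p" using ab p0 by (simp add: field_simps)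
    finally have small: "(\<Sum>l<r. (?y l)\<^sup>2 / h l) \<le> 1 / p" .
    have h'pos: "0 < ?h' l" if "l < r" for l
      using \<sigma>'0[OF that] ab by (simp add: add_nonneg_pos)
    from rank_one_power_trace[of r h ?h' ?R ?y p j, OF hb(2) h'pos R RR eq small p]
    have "(\<Sum>l<r. (1 / ?h' l) ^ p) \<le> (\<Sum>l<r. (1 / h l) ^ p) - p / 2 * (\<Sum>l<r. (1 / h l) ^ (p + 1) * (?y l)\<^sup>2)" .
    then show ?thesis unfolding potential_def \<sigma>'_def using ab(1) by (simp add: power_mult_distrib)
  qed
  let ?N = "real (card ({..<n} - I))"
  have N: "?N = n - card I" "?N \<le> n"
    using card_Diff_subset[OF finI I] card_mono[OF _ I] by (auto simp: of_nat_diff)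
  have "(\<Sum>i\<in>{..<n} - I. potential r p a b (gram r u (insert i I)))
      \<le> (\<Sum>i\<in>{..<n} - I. (\<Sum>l<r. (1 / h l) ^ p) - p / 2 * (\<Sum>l<r. (1 / h l) ^ (p + 1) * (a * (?z i l)\<^sup>2)))"
    by (intro sum_mono one)
  also have "\<dots> = ?N * (\<Sum>l<r. (1 / h l) ^ p) - p / 2 * (\<Sum>i\<in>{..<n} - I. \<Sum>l<r. (1 / h l) ^ (p + 1) * (a * (?z i l)\<^sup>2))"
    by (simp add: sum_subtractf sum_distrib_left)
  also have "(\<Sum>i\<in>{..<n} - I. \<Sum>l<r. (1 / h l) ^ (p + 1) * (a * (?z i l)\<^sup>2))
      = (\<Sum>l<r. \<Sum>i\<in>{..<n} - I. (1 / h l) ^ (p + 1) * (a * (?z i l)\<^sup>2))" by (rule sum.swap)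
  also have "\<dots> = (\<Sum>l<r. (1 / h l) ^ (p + 1) * (a * (1 - \<sigma> l)))"
  proof (intro sum.cong refl)
    fix l assume "l \<in> {..<r}"
    then show "(\<Sum>i\<in>{..<n} - I. (1 / h l) ^ (p + 1) * (a * (?z i l)\<^sup>2)) = (1 / h l) ^ (p + 1) * (a * (1 - \<sigma> l))"
      by (simp only: sum_distrib_left[symmetric] zc lessThan_iff)
  qed
  also have "?N * (\<Sum>l<r. (1 / h l) ^ p) - p / 2 * (\<Sum>l<r. (1 / h l) ^ (p + 1) * (a * (1 - \<sigma> l)))
      = (\<Sum>l<r. ?N * (1 / h l) ^ p - p / 2 * ((1 / h l) ^ (p + 1) * (a * (1 - \<sigma> l))))"
    by (simp add: sum_subtractf sum_distrib_left)
  \<comment> \<open>The shift a (1 - \<sigma>) / (2 n) is chosen so that the gain pays for it: its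
    1/2 is that of the gain p / 2, and the 1 / n, in place of the reciprocal of the number of
    remaining rows, makes the shift the same in every step.\<close>
  also have "\<dots> \<le> (\<Sum>l<r. ?N * (1 / (h l + a * ?w * (1 - \<sigma> l))) ^ p)"
  proof (intro sum_mono)
    fix l assume "l \<in> {..<r}"
    then have l: "l < r" by simp
    let ?d = "a * ?w * (1 - \<sigma> l)" and ?P = "(1 / h l) ^ (p + 1)"
    have d: "0 \<le> ?d" using ab(1) \<sigma>1[OF l] by simp
    have gen: "N * (q * (a * (1 / (2 * m)) * t) * P) = (N / m) * (q / 2 * (P * (a * t)))" for N q m t P :: real
      by (simp add: mult_ac)
    have "?N * (p * ?d * ?P) = (?N / n) * (p / 2 * (?P * (a * (1 - \<sigma> l))))" by (rule gen)
    also have "\<dots> \<le> 1 * (p / 2 * (?P * (a * (1 - \<sigma> l))))"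
      using N(2) hb(2)[OF l] ab(1) \<sigma>1[OF l] by (intro mult_right_mono) (auto simp: divide_le_eq)
    finally have "?N * (1 / h l) ^ p - p / 2 * (?P * (a * (1 - \<sigma> l))) \<le> ?N * ((1 / h l) ^ p - p * ?d * ?P)"
      by (simp add: right_diff_distrib)
    also have "\<dots> \<le> ?N * (1 / (h l + ?d)) ^ p"
      by (intro mult_left_mono inverse_power_tangent hb(2) l d) simp
    finally show "?N * (1 / h l) ^ p - p / 2 * (?P * (a * (1 - \<sigma> l))) \<le> ?N * (1 / (h l + ?d)) ^ p" .
  qed
  also have "\<dots> = ?N * potential r p (a * (1 - ?w)) (b + a * ?w) ?S"
    unfolding potential_def h_def \<sigma>_def sum_distrib_left
    by (intro sum.cong refl) (simp add: algebra_simps)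
  finally show ?thesis unfolding N(1) .
qed

text \<open>Double counting of the pairs of an (l + 1)-set and one of its elements. It lets a sample
  without replacement grow by one uniformly chosen new row.\<close>

lemma sum_subsets_Suc:
  fixes g :: "nat set \<Rightarrow> real"
  shows "Suc l * (\<Sum>I\<in>{I. I \<subseteq> {..<n} \<and> card I = Suc l}. g I)
    = (\<Sum>I\<in>{I. I \<subseteq> {..<n} \<and> card I = l}. \<Sum>i\<in>{..<n} - I. g (insert i I))"
proof -
  let ?F = "\<lambda>l. {I. I \<subseteq> {..<n} \<and> card I = l}"
  have fin: "finite (?F l)" for l by simp
  have finI: "finite I" if "I \<subseteq> {..<n}" for I using that finite_subset by blast
  have "Suc l * (\<Sum>I\<in>?F (Suc l). g I) = (\<Sum>I\<in>?F (Suc l). \<Sum>i\<in>I. g I)"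
    by (simp add: sum_distrib_left)
  also have "\<dots> = (\<Sum>(I,i)\<in>Sigma (?F (Suc l)) (\<lambda>I. I). g I)"
    using fin finI by (subst sum.Sigma) auto
  also have "\<dots> = (\<Sum>(I,i)\<in>Sigma (?F l) (\<lambda>I. {..<n} - I). g (insert i I))"
    by (rule sum.reindex_bij_witness[where i = "\<lambda>(I,i). (insert i I, i)" and j = "\<lambda>(I,i). (I - {i}, i)"])
      (auto simp: insert_absorb card_insert_if finI)
  also have "\<dots> = (\<Sum>I\<in>?F l. \<Sum>i\<in>{..<n} - I. g (insert i I))"
    using fin by (subst sum.Sigma) auto
  finally show ?thesis .
qed

lemma eigvals_gram_empty:
  assumes "l < r"
  shows "eigvals r (gram r u {}) l = 0"
proof -
  obtain Q where Q: "Q \<in> carrier_mat r r" "transpose_mat Q * Q = 1\<^sub>m r"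
    and S: "gram r u {} = Q * mat_diag r (eigvals r (gram r u {})) * transpose_mat Q"
    using eigvals_decomposition[of "gram r u {}" r] gram_symmetric by auto
  show ?thesis using coords_square_sum[OF Q S assms assms] by simp
qed

text \<open>Removing one row keeps a + b and multiplies a by 1 - 1 / (2 n), which also preserves a p
  L \<le> b. After l steps the sample is empty, all its eigenvalues are 0, and only the accumulated
  multiple of the identity is left.\<close>

lemma potential_average:
  assumes orth: "\<And>t t'. t < r \<Longrightarrow> t' < r \<Longrightarrow> (\<Sum>i<n. u i t * u i t') = (if t = t' then 1 else 0)"
    and L: "\<And>i. i < n \<Longrightarrow> (\<Sum>t<r. (u i t)\<^sup>2) \<le> L" "0 \<le> L"
    and p: "p = 2 ^ j" and ab: "0 \<le> a" "0 < b" "a * p * L \<le> b" and "l \<le> n"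
  shows "(\<Sum>I\<in>{I. I \<subseteq> {..<n} \<and> card I = l}. potential r p a b (gram r u I))
    \<le> (n choose l) * (r * (1 / (b + a * (1 - (1 - 1 / (2 * n)) ^ l))) ^ p)"
  using ab \<open>l \<le> n\<close>
proof (induction l arbitrary: a b)
  case 0
  have "{I. I \<subseteq> {..<n} \<and> card I = 0} = {{}}"
    by (auto simp: card_eq_0_iff dest: finite_subset[OF _ finite_lessThan])
  then show ?case by (simp add: potential_def eigvals_gram_empty)
next
  case (Suc l)
  define w where "w = 1 / (2 * real n)"
  let ?F = "\<lambda>l. {I. I \<subseteq> {..<n} \<and> card I = l}" and ?a = "a * (1 - w)" and ?b = "b + a * w"
  have w: "0 \<le> w" "w \<le> 1" using Suc.prems(4) unfolding w_def by (auto simp: field_simps)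
  have a: "0 \<le> ?a" "?a \<le> a" using w Suc.prems(1) by (auto simp: mult_left_le)
  have "?a * p * L \<le> a * p * L" using a L(2) by (intro mult_right_mono) auto
  then have ab': "?a * p * L \<le> ?b" using Suc.prems w by (smt (verit) mult_nonneg_nonneg)
  have b': "0 < ?b" using Suc.prems w by (simp add: add_pos_nonneg)
  have "Suc l * (\<Sum>I\<in>?F (Suc l). potential r p a b (gram r u I))
      = (\<Sum>I\<in>?F l. \<Sum>i\<in>{..<n} - I. potential r p a b (gram r u (insert i I)))"
    by (rule sum_subsets_Suc)
  also have "\<dots> \<le> (\<Sum>I\<in>?F l. (n - l) * potential r p ?a ?b (gram r u I))"
  proof (intro sum_mono)
    fix I assume I: "I \<in> ?F l"
    then have "(\<Sum>i\<in>{..<n} - I. potential r p a b (gram r u (insert i I))) \<le> (n - card I) * potential r p ?a ?b (gram r u I)"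
      unfolding w_def using Suc.prems by (intro potential_step[OF orth L(1) _ p]) auto
    then show "(\<Sum>i\<in>{..<n} - I. potential r p a b (gram r u (insert i I))) \<le> (n - l) * potential r p ?a ?b (gram r u I)"
      using I by simp
  qed
  also have "\<dots> = (n - l) * (\<Sum>I\<in>?F l. potential r p ?a ?b (gram r u I))" by (simp add: sum_distrib_left)
  also have "\<dots> \<le> (n - l) * ((n choose l) * (r * (1 / (?b + ?a * (1 - (1 - w) ^ l))) ^ p))"
    using Suc.IH[OF a(1) b' ab'] Suc.prems(4) unfolding w_def by (intro mult_left_mono) auto
  also have "?b + ?a * (1 - (1 - w) ^ l) = b + a * (1 - (1 - w) ^ Suc l)" by (simp add: algebra_simps)
  also have "real (n - l) * (real (n choose l) * (r * (1 / (b + a * (1 - (1 - w) ^ Suc l))) ^ p))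
      = real ((n - l) * (n choose l)) * (r * (1 / (b + a * (1 - (1 - w) ^ Suc l))) ^ p)" by simp
  also have "(n - l) * (n choose l) = Suc l * (n choose Suc l)"
    using binomial_absorb_comp[of n l] binomial_absorption[of l n] by simp
  finally have "Suc l * (\<Sum>I\<in>?F (Suc l). potential r p a b (gram r u I))
      \<le> Suc l * ((n choose Suc l) * (r * (1 / (b + a * (1 - (1 - w) ^ Suc l))) ^ p))"
    by (simp only: of_nat_mult mult.assoc)
  then have "(\<Sum>I\<in>?F (Suc l). potential r p a b (gram r u I))
      \<le> (n choose Suc l) * (r * (1 / (b + a * (1 - (1 - w) ^ Suc l))) ^ p)"
    by (simp only: mult_le_cancel_left_pos of_nat_0_less_iff zero_less_Suc)
  then show ?case unfolding w_def .
qed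

lemma gram_quadratic_ge:
  assumes "\<And>l. l < r \<Longrightarrow> c \<le> eigvals r (gram r u I) l"
  shows "c * ip r x x \<le> (\<Sum>i\<in>I. (app r u x i)\<^sup>2)"
proof -
  define \<sigma> where "\<sigma> = eigvals r (gram r u I)"
  obtain Q where Q: "Q \<in> carrier_mat r r" "transpose_mat Q * Q = 1\<^sub>m r"
    and S: "gram r u I = Q * mat_diag r \<sigma> * transpose_mat Q"
    using eigvals_decomposition[of "gram r u I" r] gram_symmetric unfolding \<sigma>_def by auto
  have QQ: "Q * transpose_mat Q = 1\<^sub>m r"
    using mat_mult_left_right_inverse[of "transpose_mat Q" r Q] Q by simp
  let ?z = "coords r Q u"
  define y where "y = app r (tr (ent Q)) x"
  have "(\<Sum>l<r. Q $$ (a,l) * Q $$ (b,l)) = (if a = b then 1 else 0)" if "a < r" "b < r" for a b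
    using arg_cong[OF QQ, of "\<lambda>M. M $$ (a,b)"] that Q by (simp add: scalar_prod_def lessThan_atLeast0)
  then have iso: "ip r (app r (tr (ent Q)) v) (app r (tr (ent Q)) v') = ip r v v'" for v v'
    by (intro app_orthonormal) (simp add: tr_def ent_def)
  have app: "app r u x i = (\<Sum>l<r. ?z i l * y l)" for i
    using iso[of "u i" x] unfolding y_def ip_def app_def tr_def ent_def coords_def by simp
  have "ip r x x = ip r y y" using iso[of x x] unfolding y_def by simp
  then have "c * ip r x x = (\<Sum>l<r. c * (y l)\<^sup>2)"
    unfolding ip_def[of r y] by (simp add: sum_distrib_left power2_eq_square)
  also have "\<dots> \<le> (\<Sum>l<r. \<sigma> l * (y l)\<^sup>2)"
    using assms unfolding \<sigma>_def by (intro sum_mono mult_right_mono) auto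
  also have "\<dots> = (\<Sum>l<r. \<Sum>m<r. (if l = m then \<sigma> l else 0) * (y l * y m))"
    by (intro sum.cong refl) (simp add: power2_eq_square if_distrib[of "\<lambda>c. c * _"] cong: if_cong)
  also have "\<dots> = (\<Sum>l<r. \<Sum>m<r. (\<Sum>i\<in>I. ?z i l * ?z i m) * (y l * y m))"
    by (intro sum.cong refl) (simp add: coords_square_sum[OF Q S])
  also have "\<dots> = (\<Sum>l<r. \<Sum>m<r. \<Sum>i\<in>I. (?z i l * y l) * (?z i m * y m))"
    by (simp add: sum_distrib_right sum_distrib_left mult_ac)
  also have "\<dots> = (\<Sum>l<r. \<Sum>i\<in>I. \<Sum>m<r. (?z i l * y l) * (?z i m * y m))"
    by (rule sum.cong[OF refl]) (rule sum.swap)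
  also have "\<dots> = (\<Sum>i\<in>I. \<Sum>l<r. \<Sum>m<r. (?z i l * y l) * (?z i m * y m))" by (rule sum.swap)
  also have "\<dots> = (\<Sum>i\<in>I. (app r u x i)\<^sup>2)"
    unfolding app power2_eq_square by (simp add: sum_product)
  finally show ?thesis .
qed

text \<open>Put t = l w. From (1 - w)^l (1 + w)^l \<le> 1 and Bernoulli's inequality, (1 - w)^l
  \<le> 1 / (1 + t), and this is at most 1 - t / 2 for t in [0, 1].\<close>

lemma one_minus_power_bound:
  fixes w :: real
  assumes "0 \<le> w" "w \<le> 1" "l * w \<le> 1"
  shows "l * w / 2 \<le> 1 - (1 - w) ^ l"
proof -
  have "(1 - w) ^ l * (1 + l * w) \<le> (1 - w) ^ l * (1 + w) ^ l"
    using assms by (intro mult_left_mono Bernoulli_inequality) auto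
  also have "\<dots> = ((1 - w) * (1 + w)) ^ l" by (simp add: power_mult_distrib)
  also have "\<dots> \<le> 1" using assms by (intro power_le_one) (auto simp: algebra_simps mult_le_one)
  finally have "(1 - w) ^ l \<le> 1 / (1 + l * w)"
    using assms by (subst pos_le_divide_eq) (auto intro: add_pos_nonneg)
  also have "\<dots> \<le> 1 - l * w / 2"
  proof -
    have "0 \<le> (l * w) * (1 - l * w)" using assms by (intro mult_nonneg_nonneg) auto
    then have "1 \<le> (1 - l * w / 2) * (1 + l * w)" by (simp add: algebra_simps)
    then show ?thesis using assms by (subst pos_divide_le_eq) (auto intro: add_pos_nonneg)
  qed
  finally show ?thesis by simp
qed

text \<open>Markov's inequality for the potential with a = 1: a bad sample has an eigenvalue below l
  / (8 n) and contributes at least (s + l / (8 n))^-p, whereas the average is at most r (s + l / (4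
  n))^-p. The mean of the Gram matrix is l / n times the identity, so the threshold is an eighth of
  the mean.\<close>

theorem sampled_rows_lower_tail:
  assumes orth: "\<And>t t'. t < r \<Longrightarrow> t' < r \<Longrightarrow> (\<Sum>i<n. u i t * u i t') = (if t = t' then 1 else 0)"
    and L: "\<And>i. i < n \<Longrightarrow> (\<Sum>t<r. (u i t)\<^sup>2) \<le> L" "0 \<le> L"
    and l: "l \<le> n" "real l = \<alpha> * L * n" and \<alpha>: "1 \<le> \<alpha>"
  shows "card {I. I \<subseteq> {..<n} \<and> card I = l \<and> (\<exists>x. (\<Sum>i\<in>I. (app r u x i)\<^sup>2) < l / (8 * n) * ip r x x)}
    \<le> (n choose l) * (r * exp (- \<alpha> / 20))" (is "real (card ?B) \<le> _")
proof (cases "l = 0")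
  case True
  \<comment> \<open>For l = 0 the threshold is 0, and a sum of squares never falls below it.\<close>
  have "?B = {}" using True by (auto simp: not_less sum_nonneg)
  then have "real (card ?B) = 0" by (simp only: card.empty of_nat_0)
  moreover have "0 \<le> (n choose l) * (r * exp (- \<alpha> / 20))" by simp
  ultimately show ?thesis by linarith
next
  case False
  then have n: "0 < real n" using l(1) by simp
  have "L \<noteq> 0" using False l(2) by (cases "L = 0") simp_all
  then have Lpos: "0 < L" using L(2) by simp
  have ln: "l / n = \<alpha> * L" using l n by simp
  \<comment> \<open>The exponent is the largest power of two that is at most \<alpha>, so that p
    \<le> \<alpha> \<le> 2 p.\<close>
  obtain j where j: "2 ^ j \<le> nat \<lfloor>\<alpha>\<rfloor>" "nat \<lfloor>\<alpha>\<rfloor> < 2 ^ (j + 1)"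
  proof -
    have "1 \<le> nat \<lfloor>\<alpha>\<rfloor>" using \<alpha> by (simp add: le_nat_floor)
    from ex_power_ivl1[OF _ this, of 2] show ?thesis using that by auto
  qed
  define p :: nat where "p = 2 ^ j"
  have "real p \<le> real (nat \<lfloor>\<alpha>\<rfloor>)" using j(1) unfolding p_def by (simp only: of_nat_le_iff)
  also have "\<dots> \<le> \<alpha>" using \<alpha> by simp
  finally have p\<alpha>: "p \<le> \<alpha>" .
  have "nat \<lfloor>\<alpha>\<rfloor> + 1 \<le> 2 * p" using j(2) unfolding p_def by simp
  then have "real (nat \<lfloor>\<alpha>\<rfloor>) + 1 \<le> 2 * p" by linarith
  then have \<alpha>p: "\<alpha> \<le> 2 * p" using \<alpha> by linarith
  have p1: "1 \<le> real p" unfolding p_def by simp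
  \<comment> \<open>For a = 1 this is the smallest b that \<open>potential_average\<close>
    admits.\<close>
  define s where "s = p * L"
  have s: "0 < s" unfolding s_def using p1 Lpos by simp
  let ?c = "real l / (8 * real n)" and ?F = "{I. I \<subseteq> {..<n} \<and> card I = l}" and ?w = "1 / (2 * real n)"
  have fin: "finite ?F" by simp
  have bad: "(1 / (s + ?c)) ^ p \<le> potential r p 1 s (gram r u I)" if "I \<in> ?B" for I
  proof -
    obtain x where x: "(\<Sum>i\<in>I. (app r u x i)\<^sup>2) < ?c * ip r x x" using \<open>I \<in> ?B\<close> by blast
    have "\<exists>t<r. eigvals r (gram r u I) t < ?c"
    proof (rule ccontr)
      assume "\<not> (\<exists>t<r. eigvals r (gram r u I) t < ?c)"
      then have "?c \<le> eigvals r (gram r u I) t" if "t < r" for t using that not_less by blast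
      from gram_quadratic_ge[OF this, of x] x show False by linarith
    qed
    then obtain t where t: "t < r" "eigvals r (gram r u I) t < ?c" by blast
    obtain Q where Q: "Q \<in> carrier_mat r r" "transpose_mat Q * Q = 1\<^sub>m r"
      and S: "gram r u I = Q * mat_diag r (eigvals r (gram r u I)) * transpose_mat Q"
      using eigvals_decomposition[of "gram r u I" r] gram_symmetric by auto
    have ev0: "0 \<le> eigvals r (gram r u I) t" if "t < r" for t
      using coords_square_sum[OF Q S that that] sum_nonneg[of I "\<lambda>i. coords r Q u i t * coords r Q u i t"] by simp
    have "(1 / (s + ?c)) ^ p \<le> (1 / (1 * eigvals r (gram r u I) t + s)) ^ p"
      using t ev0[OF t(1)] s by (intro power_mono divide_left_mono) (auto intro: mult_pos_pos add_pos_nonneg)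
    also have "\<dots> \<le> potential r p 1 s (gram r u I)"
      unfolding potential_def using t ev0 s
      by (intro member_le_sum) (auto intro!: zero_le_power divide_nonneg_nonneg add_nonneg_nonneg)
    finally show ?thesis .
  qed
  have "card ?B * (1 / (s + ?c)) ^ p = (\<Sum>I\<in>?B. (1 / (s + ?c)) ^ p)" by simp
  also have "\<dots> \<le> (\<Sum>I\<in>?B. potential r p 1 s (gram r u I))" by (intro sum_mono bad)
  also have "\<dots> \<le> (\<Sum>I\<in>?F. potential r p 1 s (gram r u I))"
  proof (rule sum_mono2[OF fin])
    fix I assume "I \<in> ?F - ?B"
    obtain Q where Q: "Q \<in> carrier_mat r r" "transpose_mat Q * Q = 1\<^sub>m r"
      and S: "gram r u I = Q * mat_diag r (eigvals r (gram r u I)) * transpose_mat Q"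
      using eigvals_decomposition[of "gram r u I" r] gram_symmetric by auto
    have "0 \<le> eigvals r (gram r u I) t" if "t < r" for t
      using coords_square_sum[OF Q S that that] sum_nonneg[of I "\<lambda>i. coords r Q u i t * coords r Q u i t"] by simp
    then show "0 \<le> potential r p 1 s (gram r u I)" unfolding potential_def using s
      by (intro sum_nonneg zero_le_power divide_nonneg_nonneg add_nonneg_nonneg) auto
  qed auto
  also have "\<dots> \<le> (n choose l) * (r * (1 / (s + 1 * (1 - (1 - ?w) ^ l))) ^ p)"
    using s l by (intro potential_average[OF orth L p_def]) (auto simp: s_def)
  also have "\<dots> \<le> (n choose l) * (r * (1 / (s + real l / (4 * real n))) ^ p)"
  proof -
    have "l * ?w / 2 \<le> 1 - (1 - ?w) ^ l" using n l(1) by (intro one_minus_power_bound) (auto simp: field_simps)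
    then have "s + real l / (4 * real n) \<le> s + 1 * (1 - (1 - ?w) ^ l)" by simp
    moreover have pos: "0 < s + real l / (4 * real n)" using s by (intro add_pos_nonneg) auto
    ultimately have "1 / (s + 1 * (1 - (1 - ?w) ^ l)) \<le> 1 / (s + real l / (4 * real n))"
      by (intro divide_left_mono mult_pos_pos) linarith+
    moreover have "0 \<le> 1 / (s + 1 * (1 - (1 - ?w) ^ l))" using pos \<open>_ \<le> s + 1 * (1 - (1 - ?w) ^ l)\<close> by simp
    ultimately show ?thesis by (intro mult_left_mono power_mono) auto
  qed
  finally have "card ?B * (1 / (s + ?c)) ^ p \<le> (n choose l) * (r * (1 / (s + real l / (4 * real n))) ^ p)" .
  from mult_right_mono[OF this, of "(s + ?c) ^ p"]
  have "card ?B * ((1 / (s + ?c)) ^ p * (s + ?c) ^ p) \<le> (n choose l) * (r * ((1 / (s + real l / (4 * real n))) ^ p * (s + ?c) ^ p))"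
    using s by (simp only: mult.assoc) simp
  moreover have "(1 / (s + ?c)) ^ p * (s + ?c) ^ p = 1"
  proof -
    have "0 < s + ?c" using s by (intro add_pos_nonneg) auto
    then show ?thesis by (simp add: power_mult_distrib[symmetric])
  qed
  ultimately have "card ?B \<le> (n choose l) * (r * ((1 / (s + real l / (4 * real n))) ^ p * (s + ?c) ^ p))" by simp
  also have "(1 / (s + real l / (4 * real n))) ^ p * (s + ?c) ^ p = ((s + ?c) / (s + real l / (4 * real n))) ^ p"
    by (simp add: power_mult_distrib[symmetric])
  also have "(s + ?c) / (s + real l / (4 * real n)) = (p + \<alpha> / 8) / (p + \<alpha> / 4)"
  proof -
    have "real l / (8 * real n) = L * (\<alpha> / 8)" "real l / (4 * real n) = L * (\<alpha> / 4)" using ln by (simp_all add: field_simps)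
    then have "s + ?c = L * (p + \<alpha> / 8)" "s + real l / (4 * real n) = L * (p + \<alpha> / 4)"
      unfolding s_def by (simp_all add: algebra_simps)
    then show ?thesis using Lpos by simp
  qed
  also have "((p + \<alpha> / 8) / (p + \<alpha> / 4)) ^ p \<le> exp (- \<alpha> / 20)"
  proof -
    \<comment> \<open>The quotient is at most 9 / 10 exactly when p \<le> \<alpha>; then p \<ge>
      \<alpha> / 2 turns exp (- p / 10) into exp (- \<alpha> / 20).\<close>
    have "(p + \<alpha> / 8) / (p + \<alpha> / 4) \<le> 9 / 10" using p\<alpha> p1 \<alpha> by (simp add: field_simps)
    also have "\<dots> \<le> exp (- (1 / 10))" using exp_ge_add_one_self[of "- (1 / 10) :: real"] by simp
    finally have "((p + \<alpha> / 8) / (p + \<alpha> / 4)) ^ p \<le> exp (- (1 / 10)) ^ p"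
      using p1 \<alpha> by (intro power_mono) auto
    also have "\<dots> = exp (- (p / 10))" by (simp add: exp_of_nat_mult[symmetric])
    also have "\<dots> \<le> exp (- \<alpha> / 20)" using \<alpha>p by simp
    finally show ?thesis .
  qed
  finally show ?thesis by (simp add: mult_left_mono)
qed

section \<open>Pseudoinverse and spectral norm\<close>

text \<open>Because the products are symmetric, M G = M H M G is the transpose of M G M H = M H and
  therefore equals M H; likewise G M = H M. Then G = G M G = H M H = H.\<close>

lemma is_pinv_unique:
  assumes G: "is_pinv M G" and H: "is_pinv M H"
  shows "G = H"
proof -
  define p q where "p = dim_row M" and "q = dim_col M"
  have M: "M \<in> carrier_mat p q" unfolding p_def q_def by simp
  have G1: "G \<in> carrier_mat q p" "M * G * M = M" "G * M * G = G" "transpose_mat (M * G) = M * G"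
    "transpose_mat (G * M) = G * M" using G unfolding is_pinv_def p_def q_def by auto
  have H1: "H \<in> carrier_mat q p" "M * H * M = M" "H * M * H = H" "transpose_mat (M * H) = M * H"
    "transpose_mat (H * M) = H * M" using H unfolding is_pinv_def p_def q_def by auto
  have MG: "M * G \<in> carrier_mat p p" and MH: "M * H \<in> carrier_mat p p"
    and GM: "G * M \<in> carrier_mat q q" and HM: "H * M \<in> carrier_mat q q" using M G1(1) H1(1) by auto
  have "M * G = M * H * M * G" using H1(2) by simp
  also have "\<dots> = (M * H) * (M * G)" by (rule assoc_mult_mat[OF MH M G1(1)])
  also have "\<dots> = transpose_mat ((M * G) * (M * H))"
    using G1(4) H1(4) transpose_mult[OF MG MH] by simp
  also have "(M * G) * (M * H) = M * G * M * H" by (rule assoc_mult_mat[OF MG M H1(1), symmetric])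
  also have "\<dots> = M * H" using G1(2) by simp
  finally have e1: "M * G = M * H" using H1(4) by simp
  have "G * M = G * (M * H * M)" using H1(2) by simp
  also have "\<dots> = (G * M) * (H * M)" using M G1(1) H1(1) HM
    by (simp add: assoc_mult_mat[of _ p q _ p _ q] assoc_mult_mat[of _ q p _ q _ q])
  also have "\<dots> = transpose_mat ((H * M) * (G * M))"
    using G1(5) H1(5) transpose_mult[OF HM GM] by simp
  also have "(H * M) * (G * M) = H * (M * G * M)" using M G1(1) H1(1) GM
    by (simp add: assoc_mult_mat[of _ p q _ p _ q] assoc_mult_mat[of _ q p _ q _ q])
  also have "\<dots> = H * M" using G1(2) by simp
  finally have e2: "G * M = H * M" using H1(5) by simp
  have "G = H * M * G" using G1(3) e2 by simp
  also have "\<dots> = H * (M * H)" using e1 M G1(1) H1(1) by (simp add: assoc_mult_mat[of _ q p _ q _ p])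
  also have "\<dots> = H" using H1(3) M H1(1) by (simp add: assoc_mult_mat[of _ q p _ q _ p])
  finally show ?thesis .
qed

text \<open>With \<open>Q\<close> an eigenbasis of M^T M and \<open>d\<close> its eigenvalues, the
  pseudoinverse is Q D' Q^T M^T, where \<open>D'\<close> inverts the nonzero entries of
  \<open>d\<close>.\<close>

lemma is_pinv_exists:
  fixes M :: "real mat"
  assumes M: "M \<in> carrier_mat p q"
  shows "\<exists>G. is_pinv M G"
proof -
  have sym: "transpose_mat (transpose_mat M * M) = transpose_mat M * M"
    using M by (simp add: transpose_mult[of _ q p _ q])
  obtain Q d where Q: "Q \<in> carrier_mat q q" "transpose_mat Q * Q = 1\<^sub>m q"
    and e: "transpose_mat M * M = Q * mat_diag q d * transpose_mat Q"
    using real_spectral_theorem[OF _ sym, of q] M by auto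
  have QQ: "Q * transpose_mat Q = 1\<^sub>m q"
    using mat_mult_left_right_inverse[of "transpose_mat Q" q Q] Q by simp
  define D where "D = mat_diag q d"
  \<comment> \<open>Because 1 / 0 = 0, this is the pseudoinverse of \<open>D\<close>.\<close>
  define D' where "D' = mat_diag q (\<lambda>i. 1 / d i)"
  define B where "B = M * Q"
  have DD: "D \<in> carrier_mat q q" "D' \<in> carrier_mat q q" unfolding D_def D'_def by auto
  have B: "B \<in> carrier_mat p q" unfolding B_def using M Q by simp
  have DT: "transpose_mat D' = D'" "transpose_mat D = D" unfolding D'_def D_def by (auto simp: mat_diag_def intro!: eq_matI)
  note as = assoc_mult_mat[of _ q q _ q _ q] assoc_mult_mat[of _ p q _ q _ q] assoc_mult_mat[of _ q q _ q _ p]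
    assoc_mult_mat[of _ q q _ p _ q] assoc_mult_mat[of _ p q _ p _ q] assoc_mult_mat[of _ p q _ q _ p]
    assoc_mult_mat[of _ q p _ q _ q] assoc_mult_mat[of _ q p _ q _ p]
    mult_carrier_mat[of _ q q _ q] mult_carrier_mat[of _ p q _ q] mult_carrier_mat[of _ q q _ p]
    mult_carrier_mat[of _ p q _ p] mult_carrier_mat[of _ q p _ q]
  have BB: "transpose_mat B * B = D"
  proof -
    have "transpose_mat B * B = transpose_mat Q * (transpose_mat M * M) * Q"
      unfolding B_def using M Q(1) by (simp add: as transpose_mult[of _ p q _ q])
    then show ?thesis unfolding D_def using conjugate_diag[OF Q e] by simp
  qed
  have MB: "M = B * transpose_mat Q"
    unfolding B_def using M Q(1) QQ by (simp add: as)
  \<comment> \<open>The factor \<open>D' * D\<close> erases the columns of \<open>B\<close> with d j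
    = 0. They are 0 already, since d j is the squared norm of column j.\<close>
  have BD: "B * (D' * D) = B"
  proof (rule eq_matI)
    fix i j assume "i < dim_row B" "j < dim_col B"
    then have ij: "i < p" "j < q" using B by auto
    have "(\<Sum>l<p. B $$ (l,j) * B $$ (l,j)) = d j"
      using arg_cong[OF BB, of "\<lambda>X. X $$ (j,j)"] ij B
      by (simp add: D_def mat_diag_def scalar_prod_def lessThan_atLeast0)
    then have "\<forall>l\<in>{..<p}. B $$ (l,j) * B $$ (l,j) = 0" if "d j = 0"
      using that by (subst sum_nonneg_eq_0_iff[symmetric]) auto
    then have z: "B $$ (i,j) = 0" if "d j = 0" using that ij(1) by simp
    have "(B * (D' * D)) $$ (i,j) = B $$ (i,j) * (1 / d j * d j)"
      unfolding D_def D'_def mat_diag_diag using ij B by (simp add: mat_diag_mult_right[of _ p q])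
    then show "(B * (D' * D)) $$ (i,j) = B $$ (i,j)" using z by (cases "d j = 0") auto
  qed (use B DD in auto)
  have D'DD': "D' * D * D' = D'"
    unfolding D_def D'_def mat_diag_diag by (intro mat_diag_cong) simp
  define G where "G = Q * D' * transpose_mat B"
  have G: "G \<in> carrier_mat q p" unfolding G_def using Q DD B by simp
  have GM: "G * M = Q * (D' * D) * transpose_mat Q"
  proof -
    have "G * M = Q * (D' * (transpose_mat B * B)) * transpose_mat Q"
      unfolding G_def MB using Q(1) DD B by (simp add: as)
    then show ?thesis unfolding BB .
  qed
  have MG: "M * G = B * D' * transpose_mat B"
  proof -
    have "M * G = B * (transpose_mat Q * Q) * D' * transpose_mat B"
      unfolding G_def MB using Q(1) DD B by (simp add: as)
    then show ?thesis unfolding Q(2) using B by simp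
  qed
  have "M * G * M = M"
  proof -
    have "M * G * M = M * (G * M)" using M G by (simp add: as)
    also have "\<dots> = B * (transpose_mat Q * Q) * (D' * D) * transpose_mat Q"
      unfolding GM unfolding MB using Q(1) DD B by (simp add: as)
    also have "\<dots> = B * (D' * D) * transpose_mat Q" unfolding Q(2) using B by simp
    finally show ?thesis unfolding BD MB[symmetric] .
  qed
  moreover have "G * M * G = G"
  proof -
    have "G * M * G = Q * (D' * D) * (transpose_mat Q * Q) * D' * transpose_mat B"
      unfolding GM unfolding G_def using Q(1) DD B by (simp add: as)
    also have "\<dots> = Q * (D' * D * D') * transpose_mat B" unfolding Q(2) using Q(1) DD B by (simp add: as)
    finally show ?thesis unfolding D'DD' G_def .
  qed
  moreover have "transpose_mat (M * G) = M * G"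
    unfolding MG using B DD DT by (simp add: as transpose_mult[of _ p q _ p] transpose_mult[of _ p q _ q] transpose_mult[of _ q q _ q] transpose_mult[of _ q q _ p])
  moreover have "transpose_mat (G * M) = G * M"
  proof -
    have "transpose_mat (D' * D) = D' * D" unfolding D_def D'_def mat_diag_diag
      by (auto simp: mat_diag_def intro!: eq_matI)
    then show ?thesis unfolding GM using Q(1) DD by (simp add: as transpose_mult[of _ q q _ q])
  qed
  ultimately show ?thesis unfolding is_pinv_def using G M by auto
qed

lemma is_pinv_pinv: "is_pinv M (pinv M)"
proof -
  obtain G where G: "is_pinv M G" using is_pinv_exists[of M "dim_row M" "dim_col M"] by auto
  show ?thesis unfolding pinv_def by (rule theI[of "is_pinv M", OF G]) (rule is_pinv_unique[OF _ G])
qed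

section \<open>Matrix operations and the spectral norm\<close>

lemma app_mult_mat:
  assumes "M \<in> carrier_mat p r" "N \<in> carrier_mat r q" "i < p"
  shows "app q (ent (M * N)) x i = app r (ent M) (app q (ent N) x) i"
  unfolding app_app unfolding app_def ent_def
  using assms by (intro sum.cong refl) (simp add: scalar_prod_def lessThan_atLeast0)

lemma app_minus_mat:
  assumes "M \<in> carrier_mat p q" "N \<in> carrier_mat p q" "i < p"
  shows "app q (ent (M - N)) x i = app q (ent M) x i - app q (ent N) x i"
  unfolding app_def ent_def using assms by (simp add: sum_subtractf algebra_simps)

lemma app_add_mat:
  assumes "M \<in> carrier_mat p q" "N \<in> carrier_mat p q" "i < p"
  shows "app q (ent (M + N)) x i = app q (ent M) x i + app q (ent N) x i"
  unfolding app_def ent_def using assms by (simp add: sum.distrib algebra_simps)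

lemma app_transpose_mat:
  assumes "M \<in> carrier_mat p q" "i < q"
  shows "app p (ent (transpose_mat M)) y i = app p (tr (ent M)) y i"
  unfolding app_def ent_def tr_def using assms by simp

lemma vec_l2norm_mult:
  assumes "M \<in> carrier_mat p q" "v \<in> carrier_vec q"
  shows "vec_l2norm (M *\<^sub>v v) = nrm p (app q (ent M) (($) v))"
  unfolding vec_l2norm_def nrm_def ip_def app_def ent_def
  using assms by (simp add: scalar_prod_def lessThan_atLeast0)

lemma vec_l2norm_nrm: "v \<in> carrier_vec q \<Longrightarrow> vec_l2norm v = nrm q (($) v)"
  unfolding vec_l2norm_def nrm_def ip_def by (simp add: scalar_prod_def lessThan_atLeast0)

lemma spectral_norm_leI:
  assumes M: "M \<in> carrier_mat p q" and le: "\<And>x. nrm p (app q (ent M) x) \<le> b * nrm q x" and "0 \<le> b"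
  shows "spectral_norm M \<le> b"
  unfolding spectral_norm_def
proof (rule cSup_least)
  have "vec_l2norm (0\<^sub>v q) \<le> 1" unfolding vec_l2norm_def by simp
  then show "{vec_l2norm (M *\<^sub>v v) |v. v \<in> carrier_vec (dim_col M) \<and> vec_l2norm v \<le> 1} \<noteq> {}"
    using M by (auto intro: exI[of _ "0\<^sub>v q"])
next
  fix t assume "t \<in> {vec_l2norm (M *\<^sub>v v) |v. v \<in> carrier_vec (dim_col M) \<and> vec_l2norm v \<le> 1}"
  then obtain v where v: "t = vec_l2norm (M *\<^sub>v v)" "v \<in> carrier_vec q" "vec_l2norm v \<le> 1" using M by auto
  have "t \<le> b * vec_l2norm v" unfolding v(1) vec_l2norm_mult[OF M v(2)] vec_l2norm_nrm[OF v(2)] by (rule le)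
  also have "\<dots> \<le> b * 1" using v(3) \<open>0 \<le> b\<close> by (rule mult_left_mono)
  finally show "t \<le> b" by simp
qed

text \<open>A supremum of reals is an upper bound only for a bounded set; here the largest singular
  value is a bound.\<close>

lemma spectral_norm_bdd_above:
  "bdd_above {vec_l2norm (M *\<^sub>v v) |v. v \<in> carrier_vec (dim_col M) \<and> vec_l2norm v \<le> 1}" (is "bdd_above ?S")
proof (rule bdd_aboveI[of _ "\<bar>sing_val 1 M\<bar>"])
  define p q where "p = dim_row M" and "q = dim_col M"
  have M: "M \<in> carrier_mat p q" unfolding p_def q_def by simp
  fix t assume "t \<in> ?S"
  then obtain v where v: "t = vec_l2norm (M *\<^sub>v v)" "v \<in> carrier_vec q" "vec_l2norm v \<le> 1" unfolding q_def by auto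
  have "t \<le> sing_val 1 M * vec_l2norm v"
    unfolding v(1) vec_l2norm_mult[OF M v(2)] vec_l2norm_nrm[OF v(2)] by (rule norm_le_sing_val_1[OF M])
  also have "\<dots> \<le> \<bar>sing_val 1 M\<bar> * vec_l2norm v"
    unfolding vec_l2norm_nrm[OF v(2)] by (intro mult_right_mono) auto
  also have "\<dots> \<le> \<bar>sing_val 1 M\<bar> * 1" using v(3) by (intro mult_left_mono) auto
  finally show "t \<le> \<bar>sing_val 1 M\<bar>" by simp
qed

lemma norm_le_spectral_norm:
  assumes M: "M \<in> carrier_mat p q"
  shows "nrm p (app q (ent M) x) \<le> spectral_norm M * nrm q x"
proof -
  let ?S = "{vec_l2norm (M *\<^sub>v v) |v. v \<in> carrier_vec (dim_col M) \<and> vec_l2norm v \<le> 1}"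
  show ?thesis
  proof (cases "nrm q x = 0")
    case True
    then have "nrm p (app q (ent M) x) = 0" using norm_le_sing_val_1[OF M, of x] nrm_ge0[of p "app q (ent M) x"] by simp
    then show ?thesis using True by simp
  next
    case False
    define v where "v = Matrix.vec q (\<lambda>i. (1 / nrm q x) * x i)"
    have v: "v \<in> carrier_vec q" unfolding v_def by simp
    have "vec_l2norm v = nrm q (\<lambda>i. (1 / nrm q x) * x i)"
      unfolding vec_l2norm_nrm[OF v] by (intro nrm_cong) (simp add: v_def)
    then have "vec_l2norm v = 1" unfolding nrm_scale using False by simp
    then have "vec_l2norm (M *\<^sub>v v) \<in> ?S" using v M by auto
    then have "vec_l2norm (M *\<^sub>v v) \<le> spectral_norm M" unfolding spectral_norm_def by (rule cSup_upper[OF _ spectral_norm_bdd_above])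
    moreover have "vec_l2norm (M *\<^sub>v v) = nrm p (\<lambda>i. (1 / nrm q x) * app q (ent M) x i)"
      unfolding vec_l2norm_mult[OF M v] app_scale[symmetric]
      by (intro nrm_cong app_cong) (simp add: v_def)
    ultimately have "nrm p (app q (ent M) x) / nrm q x \<le> spectral_norm M" unfolding nrm_scale by simp
    moreover have "0 < nrm q x" using False nrm_ge0[of q x] by linarith
    ultimately show ?thesis by (simp add: pos_divide_le_eq)
  qed
qed

lemma spectral_norm_ge0: "0 \<le> spectral_norm M"
proof -
  let ?z = "0\<^sub>v (dim_col M)"
  have "vec_l2norm ?z \<le> 1" unfolding vec_l2norm_def by simp
  then have "vec_l2norm (M *\<^sub>v ?z) \<in> {vec_l2norm (M *\<^sub>v v) |v. v \<in> carrier_vec (dim_col M) \<and> vec_l2norm v \<le> 1}"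
    by (intro CollectI exI[of _ ?z] conjI) simp_all
  then have "vec_l2norm (M *\<^sub>v ?z) \<le> spectral_norm M"
    unfolding spectral_norm_def by (rule cSup_upper[OF _ spectral_norm_bdd_above])
  moreover have "0 \<le> vec_l2norm (M *\<^sub>v ?z)"
    using vec_l2norm_mult[of M "dim_row M" "dim_col M" ?z] by simp
  ultimately show ?thesis by linarith
qed

section \<open>Orthogonal projections and two-sided approximation\<close>

locale orthogonal_projection =
  fixes n :: nat and P :: "real mat"
  assumes P: "P \<in> carrier_mat n n" and sym: "transpose_mat P = P" and idem: "P * P = P"
begin

lemma app_idem: "i < n \<Longrightarrow> app n (ent P) (app n (ent P) z) i = app n (ent P) z i"
  using app_mult_mat[OF P P, of i z] idem by simp

lemma ip_sym: "ip n (app n (ent P) z) y = ip n z (app n (ent P) y)"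
proof -
  have "app n (tr (ent P)) y i = app n (ent P) y i" if "i < n" for i
    using app_transpose_mat[OF P that, of y] sym by simp
  then show ?thesis unfolding ip_app by (intro ip_cong) auto
qed

lemma ip_proj: "ip n (app n (ent P) z) (app n (ent P) z) = ip n z (app n (ent P) z)"
  unfolding ip_sym by (intro ip_cong) (auto simp: app_idem)

lemma norm_proj_le: "nrm n (app n (ent P) z) \<le> nrm n z"
proof (cases "nrm n (app n (ent P) z) = 0")
  case False
  have "nrm n (app n (ent P) z) * nrm n (app n (ent P) z) \<le> nrm n z * nrm n (app n (ent P) z)"
    using ip_cauchy[of n z "app n (ent P) z"] ip_proj[of z] nrm_sq[of n "app n (ent P) z"]
    by (simp add: power2_eq_square)
  then show ?thesis using False nrm_ge0[of n "app n (ent P) z"] by (simp add: mult_le_cancel_right)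
qed simp

lemma norm_residual_le: "nrm n (\<lambda>i. z i - app n (ent P) z i) \<le> nrm n z"
proof -
  let ?p = "app n (ent P) z"
  let ?r = "\<lambda>i. z i - ?p i"
  have "ip n ?r ?r = ip n z ?r - ip n ?p ?r" by (rule ip_diff)
  also have "ip n z ?r = ip n z z - ip n ?p z" by (subst ip_commute) (rule ip_diff)
  also have "ip n ?p ?r = ip n z ?p - ip n ?p ?p" by (subst ip_commute) (rule ip_diff)
  also have "ip n ?p z = ip n z ?p" by (rule ip_commute)
  also have "ip n z ?p = ip n ?p ?p" by (rule ip_proj[symmetric])
  also have "ip n z z - ip n ?p ?p - (ip n ?p ?p - ip n ?p ?p) \<le> ip n z z" by simp
  finally show ?thesis unfolding nrm_le_iff .
qed

text \<open>The projection fixes w, so z and z - w have the same residual, which is no longer than z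
  - w. Hence any element of the range may serve as a competitor.\<close>

lemma norm_residual_le_dist:
  assumes "\<And>i. i < n \<Longrightarrow> app n (ent P) w i = w i"
  shows "nrm n (\<lambda>i. z i - app n (ent P) z i) \<le> nrm n (\<lambda>i. z i - w i)"
proof -
  have "nrm n (\<lambda>i. z i - app n (ent P) z i)
      = nrm n (\<lambda>i. (z i - w i) - app n (ent P) (\<lambda>i. z i - w i) i)"
    by (intro nrm_cong) (simp add: app_diff assms)
  then show ?thesis using norm_residual_le[of "\<lambda>i. z i - w i"] by simp
qed

end

lemma column_projection:
  assumes C: "C \<in> carrier_mat n c"
  shows "orthogonal_projection n (C * pinv C)" "i < n \<Longrightarrow> app n (ent (C * pinv C)) (app c (ent C) g) i = app c (ent C) g i"
proof -
  have G: "pinv C \<in> carrier_mat c n" "C * pinv C * C = C" "transpose_mat (C * pinv C) = C * pinv C"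
    using is_pinv_pinv[of C] C unfolding is_pinv_def by auto
  have P: "C * pinv C \<in> carrier_mat n n" using C G by simp
  have "C * pinv C * (C * pinv C) = C * pinv C * C * pinv C"
    using assoc_mult_mat[OF P C G(1)] by simp
  then show "orthogonal_projection n (C * pinv C)" using P G by unfold_locales auto
  assume "i < n"
  from app_mult_mat[OF P C this, of g]
  show "app n (ent (C * pinv C)) (app c (ent C) g) i = app c (ent C) g i" unfolding G(2) by simp
qed

lemma row_projection:
  assumes R: "R \<in> carrier_mat b m"
  shows "orthogonal_projection m (pinv R * R)" "i < m \<Longrightarrow> app m (ent (pinv R * R)) (app b (tr (ent R)) g) i = app b (tr (ent R)) g i"
proof -
  have G: "pinv R \<in> carrier_mat m b" "R * pinv R * R = R" "transpose_mat (pinv R * R) = pinv R * R"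
    "pinv R * R * pinv R = pinv R"
    using is_pinv_pinv[of R] R unfolding is_pinv_def by auto
  have P: "pinv R * R \<in> carrier_mat m m" using R G by simp
  have RT: "transpose_mat R \<in> carrier_mat m b" using R by simp
  have "pinv R * R * (pinv R * R) = pinv R * R * pinv R * R"
    using assoc_mult_mat[OF P G(1) R] by simp
  then show "orthogonal_projection m (pinv R * R)" using P G by unfold_locales auto
  have "R * (pinv R * R) = R" using assoc_mult_mat[OF R G(1) R] G(2) by simp
  then have "transpose_mat (pinv R * R) * transpose_mat R = transpose_mat R"
    using transpose_mult[OF R P] by simp
  then have e: "pinv R * R * transpose_mat R = transpose_mat R" using G(3) by simp
  assume i: "i < m"
  have "app m (ent (pinv R * R)) (app b (tr (ent R)) g) i = app m (ent (pinv R * R)) (app b (ent (transpose_mat R)) g) i"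
    using app_transpose_mat[OF R] by (intro app_cong) simp
  also have "\<dots> = app b (tr (ent R)) g i"
    using app_mult_mat[OF P RT i, of g] app_transpose_mat[OF R i, of g] unfolding e by simp
  finally show "app m (ent (pinv R * R)) (app b (tr (ent R)) g) i = app b (tr (ent R)) g i" .
qed

text \<open>With P and Q the projections onto the column space of \<open>C\<close> and the row space
  of \<open>R\<close>, A - P A Q = (A - P A) + P (A - A Q). The first term is at most the distance
  of A x from any combination of the columns of \<open>C\<close>; the second is estimated through
  the transpose.\<close>

lemma cur_error:
  assumes A: "A \<in> carrier_mat n m" and C: "C \<in> carrier_mat n c" and R: "R \<in> carrier_mat b m"
    and col: "\<And>x. \<exists>g. nrm n (\<lambda>i. app m (ent A) x i - app c (ent C) g i) \<le> e1 * nrm m x"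
    and row: "\<And>y. \<exists>g. nrm m (\<lambda>i. app n (tr (ent A)) y i - app b (tr (ent R)) g i) \<le> e2 * nrm n y"
    and e: "0 \<le> e1" "0 \<le> e2"
  shows "spectral_norm (A - C * pinv C * A * pinv R * R) \<le> e1 + e2"
proof -
  let ?P = "C * pinv C" and ?Q = "pinv R * R"
  interpret P: orthogonal_projection n ?P by (rule column_projection[OF C])
  interpret Q: orthogonal_projection m ?Q by (rule row_projection[OF R])
  have G: "pinv R \<in> carrier_mat m b" using is_pinv_pinv[of R] R unfolding is_pinv_def by auto
  have PA: "?P * A \<in> carrier_mat n m" by (rule mult_carrier_mat[OF P.P A])
  have eq: "?P * A * pinv R * R = ?P * A * ?Q" by (rule assoc_mult_mat[OF PA G R])
  have PAQ: "?P * A * ?Q \<in> carrier_mat n m" by (rule mult_carrier_mat[OF PA Q.P])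
  show ?thesis unfolding eq
  proof (rule spectral_norm_leI[of _ n m])
    show "A - ?P * A * ?Q \<in> carrier_mat n m" using PAQ by (simp only: minus_carrier_mat)
    show "0 \<le> e1 + e2" using e by simp
    fix x
    let ?p = "app n (ent ?P)" and ?q = "app m (ent ?Q)" and ?a = "app m (ent A)" and ?t = "app n (tr (ent A))"
    define v where "v i = ?a x i - ?a (?q x) i" for i
    have "nrm n (app m (ent (A - ?P * A * ?Q)) x) = nrm n (\<lambda>i. (?a x i - ?p (?a x) i) + ?p v i)"
    proof (rule nrm_cong)
      fix i assume i: "i < n"
      have "?p v i = ?p (?a x) i - ?p (?a (?q x)) i" unfolding v_def by (rule app_diff)
      then show "app m (ent (A - ?P * A * ?Q)) x i = (?a x i - ?p (?a x) i) + ?p v i"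
        unfolding app_minus_mat[OF A PAQ i] app_mult_mat[OF PA Q.P i] app_mult_mat[OF P.P A i] by simp
    qed
    also have "\<dots> \<le> nrm n (\<lambda>i. ?a x i - ?p (?a x) i) + nrm n (?p v)" by (rule nrm_triangle)
    also have "nrm n (\<lambda>i. ?a x i - ?p (?a x) i) \<le> e1 * nrm m x"
    proof -
      obtain g where g: "nrm n (\<lambda>i. ?a x i - app c (ent C) g i) \<le> e1 * nrm m x" using col by blast
      have "nrm n (\<lambda>i. ?a x i - ?p (?a x) i) \<le> nrm n (\<lambda>i. ?a x i - app c (ent C) g i)"
        by (rule P.norm_residual_le_dist) (rule column_projection(2)[OF C])
      then show ?thesis using g by simp
    qed
    also have "nrm n (?p v) \<le> nrm n v" by (rule P.norm_proj_le)
    also have "nrm n v \<le> e2 * nrm m x"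
    proof (cases "nrm n v = 0")
      case True
      then show ?thesis using e by simp
    next
      case False
      obtain g where g: "nrm m (\<lambda>i. ?t v i - app b (tr (ent R)) g i) \<le> e2 * nrm n v" using row by blast
      \<comment> \<open>As Q is symmetric, |v|^2 is the product of x with the residual of A^T v
        under Q; the row hypothesis is used for y = v.\<close>
      have "ip n v v = ip n (?a (\<lambda>i. x i - ?q x i)) v" unfolding v_def by (intro ip_cong) (simp_all add: app_diff)
      also have "\<dots> = ip m (\<lambda>i. x i - ?q x i) (?t v)" by (rule ip_app)
      also have "\<dots> = ip m x (?t v) - ip m x (?q (?t v))" unfolding ip_diff Q.ip_sym ..
      also have "\<dots> = ip m x (\<lambda>i. ?t v i - ?q (?t v) i)"
        using ip_diff[of m "?t v" "?q (?t v)" x] by (simp add: ip_commute)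
      also have "\<dots> \<le> nrm m x * nrm m (\<lambda>i. ?t v i - ?q (?t v) i)"
        using ip_cauchy[of m x "\<lambda>i. ?t v i - ?q (?t v) i"] by simp
      also have "\<dots> \<le> nrm m x * nrm m (\<lambda>i. ?t v i - app b (tr (ent R)) g i)"
        by (intro mult_left_mono Q.norm_residual_le_dist row_projection(2)[OF R]) auto
      also have "\<dots> \<le> nrm m x * (e2 * nrm n v)" by (intro mult_left_mono g) simp
      finally have "nrm n v * nrm n v \<le> (e2 * nrm m x) * nrm n v"
        unfolding nrm_sq[symmetric] by (simp add: power2_eq_square mult_ac)
      then show ?thesis using False nrm_ge0[of n v] by (simp add: mult_le_cancel_right)
    qed
    finally show "nrm n (app m (ent (A - ?P * A * ?Q)) x) \<le> (e1 + e2) * nrm m x"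
      by (simp add: distrib_right)
  qed
qed

section \<open>Submatrices and strong rank-revealing factorizations\<close>

lemma bij_betw_pick:
  assumes "finite J"
  shows "bij_betw (pick J) {..<card J} J"
proof -
  have inj: "inj_on (pick J) {..<card J}"
  proof (rule inj_onI)
    fix a b assume "a \<in> {..<card J}" "b \<in> {..<card J}" "pick J a = pick J b"
    then show "a = b" using pick_mono_le[of a J b] pick_mono_le[of b J a] by (cases a b rule: linorder_cases) auto
  qed
  have "pick J ` {..<card J} \<subseteq> J" using pick_in_set_le by auto
  then have "pick J ` {..<card J} = J" using assms inj by (intro card_subset_eq) (auto simp: card_image)
  with inj show ?thesis unfolding bij_betw_def by simp
qed

lemma nrm_pick:
  assumes "finite J"
  shows "nrm (card J) (\<lambda>t. f (pick J t)) = L2_set f J"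
  unfolding nrm_L2 L2_set_def using sum.reindex_bij_betw[OF bij_betw_pick[OF assms], of "\<lambda>j. (f j)\<^sup>2"] by simp

lemma sum_pick:
  assumes "finite J"
  shows "(\<Sum>t<card J. f (pick J t)) = (\<Sum>j\<in>J. f j)"
  using sum.reindex_bij_betw[OF bij_betw_pick[OF assms], of f] .

lemma sub_cols_carrier:
  assumes "A \<in> carrier_mat n m" "J \<subseteq> {..<m}"
  shows "sub_cols A J \<in> carrier_mat n (card J)"
proof -
  have "{j. j < m \<and> j \<in> J} = J" using assms(2) by auto
  then show ?thesis using assms(1) dim_submatrix[of A UNIV J] by (intro carrier_matI) auto
qed

lemma sub_rows_carrier:
  assumes "A \<in> carrier_mat n m" "I \<subseteq> {..<n}"
  shows "sub_rows A I \<in> carrier_mat (card I) m"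
proof -
  have "{j. j < n \<and> j \<in> I} = I" using assms(2) by auto
  then show ?thesis using assms(1) dim_submatrix[of A I UNIV] by (intro carrier_matI) auto
qed

lemma ent_sub_cols:
  assumes "A \<in> carrier_mat n m" "J \<subseteq> {..<m}" "i < n" "t < card J"
  shows "ent (sub_cols A J) i t = ent A i (pick J t)"
proof -
  have "{j. j < m \<and> j \<in> J} = J" using assms(2) by auto
  then show ?thesis unfolding ent_def using assms by (subst submatrix_index) (auto simp: pick_UNIV)
qed

lemma ent_sub_rows:
  assumes "A \<in> carrier_mat n m" "I \<subseteq> {..<n}" "t < card I" "j < m"
  shows "ent (sub_rows A I) t j = ent A (pick I t) j"
proof -
  have "{j. j < n \<and> j \<in> I} = I" using assms(2) by auto
  then show ?thesis unfolding ent_def using assms by (subst submatrix_index) (auto simp: pick_UNIV)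
qed

lemma app_sub_cols:
  assumes "A \<in> carrier_mat n m" "J \<subseteq> {..<m}" "i < n" and supp: "\<And>j. j < m \<Longrightarrow> j \<notin> J \<Longrightarrow> g j = 0"
  shows "app (card J) (ent (sub_cols A J)) (\<lambda>t. g (pick J t)) i = app m (ent A) g i"
proof -
  have fin: "finite J" using assms(2) finite_subset by blast
  have "app (card J) (ent (sub_cols A J)) (\<lambda>t. g (pick J t)) i = (\<Sum>t<card J. ent A i (pick J t) * g (pick J t))"
    unfolding app_def by (intro sum.cong) (simp_all add: ent_sub_cols[OF assms(1-3)])
  also have "\<dots> = (\<Sum>j\<in>J. ent A i j * g j)" by (rule sum_pick[OF fin])
  also have "\<dots> = app m (ent A) g i"
    unfolding app_def using assms(2) supp by (intro sum.mono_neutral_left) auto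
  finally show ?thesis .
qed

lemma app_sub_rows:
  assumes "A \<in> carrier_mat n m" "I \<subseteq> {..<n}" "t < card I"
  shows "app m (ent (sub_rows A I)) x t = app m (ent A) x (pick I t)"
  unfolding app_def by (intro sum.cong) (simp_all add: ent_sub_rows[OF assms])

lemma nrm_app_sub_rows:
  assumes "A \<in> carrier_mat n m" "I \<subseteq> {..<n}"
  shows "nrm (card I) (app m (ent (sub_rows A I)) x) = L2_set (app m (ent A) x) I"
proof -
  have fin: "finite I" using assms(2) finite_subset by blast
  have "nrm (card I) (app m (ent (sub_rows A I)) x) = nrm (card I) (\<lambda>t. app m (ent A) x (pick I t))"
    by (intro nrm_cong app_sub_rows[OF assms])
  then show ?thesis by (simp only: nrm_pick[OF fin])
qed

lemma app_tr_sub_rows: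
  assumes "A \<in> carrier_mat n m" "I \<subseteq> {..<n}" "j < m" and supp: "\<And>i. i < n \<Longrightarrow> i \<notin> I \<Longrightarrow> g i = 0"
  shows "app (card I) (tr (ent (sub_rows A I))) (\<lambda>t. g (pick I t)) j = app n (tr (ent A)) g j"
proof -
  have fin: "finite I" using assms(2) finite_subset by blast
  have "app (card I) (tr (ent (sub_rows A I))) (\<lambda>t. g (pick I t)) j = (\<Sum>t<card I. ent A (pick I t) j * g (pick I t))"
    unfolding app_def tr_def using assms(3) by (intro sum.cong) (simp_all add: ent_sub_rows[OF assms(1,2)])
  also have "\<dots> = (\<Sum>i\<in>I. ent A i j * g i)" by (rule sum_pick[OF fin])
  also have "\<dots> = app n (tr (ent A)) g j"
    unfolding app_def tr_def using assms(2) supp by (intro sum.mono_neutral_left) auto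
  finally show ?thesis .
qed

lemma nrm_app_tr_sub_cols:
  assumes "A \<in> carrier_mat n m" "J \<subseteq> {..<m}"
  shows "nrm (card J) (app n (tr (ent (sub_cols A J))) y) = L2_set (app n (tr (ent A)) y) J"
proof -
  have fin: "finite J" using assms(2) finite_subset by blast
  have "nrm (card J) (app n (tr (ent (sub_cols A J))) y) = nrm (card J) (\<lambda>t. app n (tr (ent A)) y (pick J t))"
    unfolding app_def tr_def by (intro nrm_cong sum.cong) (simp_all add: ent_sub_cols[OF assms])
  then show ?thesis by (simp only: nrm_pick[OF fin])
qed

lemma L2_set_mono_set:
  assumes "finite B" "A \<subseteq> B"
  shows "L2_set f A \<le> L2_set f B"
  unfolding L2_set_def using assms by (intro real_sqrt_le_mono sum_mono2) auto

lemma nrm_supported: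
  assumes "J \<subseteq> {..<m}" "\<And>j. j < m \<Longrightarrow> j \<notin> J \<Longrightarrow> g j = 0"
  shows "nrm m g = L2_set g J"
  unfolding nrm_L2 L2_set_def using assms
  by (intro arg_cong[of _ _ sqrt] sum.mono_neutral_right) auto

text \<open>Cauchy-Schwarz in every row: only card J rows and card S columns matter and their
  entries are at most t, so this is a Frobenius bound. That both supports count lets the sparsity of
  Y2 enter later.\<close>

lemma nrm_app_le_entries:
  assumes T0: "\<And>i j. i < n \<Longrightarrow> i \<notin> J \<Longrightarrow> T i j = 0" and T1: "\<And>i j. i < n \<Longrightarrow> j < m \<Longrightarrow> \<bar>T i j\<bar> \<le> t"
    and J: "J \<subseteq> {..<n}" and S: "S \<subseteq> {..<m}" and x: "\<And>j. j < m \<Longrightarrow> j \<notin> S \<Longrightarrow> x j = 0" and "0 \<le> t"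
  shows "nrm n (app m T x) \<le> t * sqrt (card J * card S) * nrm m x"
proof -
  have finJ: "finite J" and finS: "finite S" using J S finite_subset by blast+
  have row: "\<bar>app m T x i\<bar> \<le> t * sqrt (card S) * nrm m x" if "i < n" for i
  proof -
    have "app m T x i = (\<Sum>j\<in>S. T i j * x j)"
      unfolding app_def using S x by (intro sum.mono_neutral_right) auto
    then have "\<bar>app m T x i\<bar> \<le> (\<Sum>j\<in>S. \<bar>T i j\<bar> * \<bar>x j\<bar>)"
      using sum_abs[of "\<lambda>j. T i j * x j" S] by (simp add: abs_mult)
    also have "\<dots> \<le> (\<Sum>j\<in>S. \<bar>t\<bar> * \<bar>x j\<bar>)"
      using T1[OF that] S \<open>0 \<le> t\<close> by (intro sum_mono mult_right_mono) auto
    also have "\<dots> \<le> L2_set (\<lambda>j. t) S * L2_set x S" by (rule L2_set_mult_ineq)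
    also have "L2_set (\<lambda>j. t) S = t * sqrt (card S)"
      unfolding L2_set_def using \<open>0 \<le> t\<close> by (simp add: real_sqrt_mult mult.commute)
    also have "L2_set x S = nrm m x" using nrm_supported[OF S x] by simp
    finally show ?thesis .
  qed
  have "nrm n (app m T x) = L2_set (app m T x) J"
    by (rule nrm_supported[OF J]) (simp add: app_def T0)
  also have "\<dots> \<le> sqrt (\<Sum>i\<in>J. (t * sqrt (card S) * nrm m x)\<^sup>2)"
    unfolding L2_set_def using row J
    by (intro real_sqrt_le_mono sum_mono) (metis abs_ge_zero lessThan_iff power2_abs power_mono subset_iff)
  also have "\<dots> = t * sqrt (card J * card S) * nrm m x"
    using \<open>0 \<le> t\<close> by (simp add: real_sqrt_mult)
  finally show ?thesis .
qed

section \<open>Consequences of a strong rank-revealing factorization\<close>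

lemma permutes_lt: "\<pi> permutes {0..<q} \<Longrightarrow> \<pi> i < q \<longleftrightarrow> i < (q::nat)"
  using permutes_in_image[of \<pi> "{0..<q}" i] by simp

lemma srrqr_factorizationD:
  assumes M: "M \<in> carrier_mat p q" and fac: "srrqr_factorization r M \<pi> Q Ar Br Cr"
  shows "r \<le> min p q" "\<pi> permutes {0..<q}" "Q \<in> carrier_mat p p" "transpose_mat Q * Q = 1\<^sub>m p"
    "Ar \<in> carrier_mat r r" "Br \<in> carrier_mat r (q - r)" "Cr \<in> carrier_mat (p - r) (q - r)"
    "M * perm_mat q \<pi> = Q * four_block_mat Ar Br (0\<^sub>m (p - r) r) Cr"
    "\<forall>i. 1 \<le> i \<and> i \<le> r \<longrightarrow> sing_val i M / sqrt (1 + real r * (real q - real r)) \<le> sing_val i Ar"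
    "\<forall>j. 1 \<le> j \<and> j \<le> min p q - r \<longrightarrow>
      sing_val j Cr \<le> sing_val (r + j) M * sqrt (1 + real r * (real q - real r))"
    "\<forall>G\<in>carrier_mat r r. inverts_mat Ar G \<and> inverts_mat G Ar \<longrightarrow> max_norm (G * Br) \<le> 1"
  using fac unfolding srrqr_factorization_def Let_def carrier_matD[OF M] by - (elim conjE, assumption)+

text \<open>\<open>Q\<close> preserves the norm and the permutation only relabels coordinates, so
  what acts is the block triangular factor.\<close>

lemma srrqr_norm:
  assumes M: "M \<in> carrier_mat p q" and fac: "srrqr_factorization r M \<pi> Q Ar Br Cr"
  shows "nrm p (app q (ent M) x) = nrm p (\<lambda>i. if i < r
      then app r (ent Ar) (\<lambda>b. x (\<pi> b)) i + app (q - r) (ent Br) (\<lambda>b. x (\<pi> (b + r))) i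
      else app (q - r) (ent Cr) (\<lambda>b. x (\<pi> (b + r))) (i - r))"
proof -
  have r: "r \<le> p" "r \<le> q" and \<pi>: "\<pi> permutes {0..<q}" and Q: "Q \<in> carrier_mat p p" "transpose_mat Q * Q = 1\<^sub>m p"
    and Ar: "Ar \<in> carrier_mat r r" and Br: "Br \<in> carrier_mat r (q - r)" and Cr: "Cr \<in> carrier_mat (p - r) (q - r)"
    and eq: "M * perm_mat q \<pi> = Q * four_block_mat Ar Br (0\<^sub>m (p - r) r) Cr"
    using srrqr_factorizationD[OF M fac] by simp_all
  let ?B = "four_block_mat Ar Br (0\<^sub>m (p - r) r) Cr"
  have B: "?B \<in> carrier_mat p q" using Ar Br Cr r by (intro carrier_matI) auto
  have P: "perm_mat q \<pi> \<in> carrier_mat q q" unfolding perm_mat_def by simp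
  define y where "y b = x (\<pi> b)" for b
  have "app q (ent M) x i = app p (ent Q) (app q (ent ?B) y) i" if "i < p" for i
  proof -
    have Mp: "ent (M * perm_mat q \<pi>) i b = ent M i (\<pi> b)" if "b < q" for b
    proof -
      have "ent (M * perm_mat q \<pi>) i b = (\<Sum>l<q. ent M i l * (if l = \<pi> b then 1 else 0))"
        using \<open>i < p\<close> that M unfolding ent_def perm_mat_def by (simp add: scalar_prod_def lessThan_atLeast0)
      also have "\<dots> = (\<Sum>l<q. if l = \<pi> b then ent M i l else 0)" by (intro sum.cong) auto
      also have "\<dots> = ent M i (\<pi> b)" using permutes_lt[OF \<pi>] that by simp
      finally show ?thesis .
    qed
    have "app q (ent M) x i = (\<Sum>b<q. ent M i (\<pi> b) * x (\<pi> b))"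
      unfolding app_def using sum.permute[OF \<pi>, of "\<lambda>j. ent M i j * x j"] by (simp add: lessThan_atLeast0 o_def)
    also have "\<dots> = app q (ent (M * perm_mat q \<pi>)) y i"
      unfolding app_def y_def using Mp by (intro sum.cong) auto
    also have "\<dots> = app p (ent Q) (app q (ent ?B) y) i" unfolding eq by (rule app_mult_mat[OF Q(1) B that])
    finally show ?thesis .
  qed
  then have "nrm p (app q (ent M) x) = nrm p (app p (ent Q) (app q (ent ?B) y))" by (intro nrm_cong) auto
  also have "\<dots> = nrm p (app q (ent ?B) y)"
  proof -
    have "(\<Sum>l<p. ent Q l i * ent Q l j) = (if i = j then 1 else 0)" if "i < p" "j < p" for i j
      using arg_cong[OF Q(2), of "\<lambda>X. X $$ (i,j)"] that Q(1) by (simp add: ent_def scalar_prod_def lessThan_atLeast0)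
    then show ?thesis unfolding nrm_def by (subst app_orthonormal) auto
  qed
  also have "\<dots> = nrm p (\<lambda>i. if i < r
      then app r (ent Ar) y i + app (q - r) (ent Br) (\<lambda>b. y (b + r)) i
      else app (q - r) (ent Cr) (\<lambda>b. y (b + r)) (i - r))"
  proof (rule nrm_cong)
    fix i assume i: "i < p"
    have split: "(\<Sum>b<q. h b) = (\<Sum>b<r. h b) + (\<Sum>b<q-r. h (b + r))" for h :: "nat \<Rightarrow> real"
      using sum.atLeastLessThan_concat[of 0 r q h] sum.shift_bounds_nat_ivl[of h 0 r "q - r"] r(2)
      by (simp add: lessThan_atLeast0)
    show "app q (ent ?B) y i = (if i < r
      then app r (ent Ar) y i + app (q - r) (ent Br) (\<lambda>b. y (b + r)) i
      else app (q - r) (ent Cr) (\<lambda>b. y (b + r)) (i - r))"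
    proof -
      have s: "app q (ent ?B) y i = (\<Sum>b<r. ent ?B i b * y b) + (\<Sum>b<q-r. ent ?B i (b + r) * y (b + r))"
        unfolding app_def by (rule split)
      show ?thesis
      proof (cases "i < r")
        case True
        have "(\<Sum>b<r. ent ?B i b * y b) = app r (ent Ar) y i"
          unfolding app_def using True Ar Br Cr r by (intro sum.cong) (auto simp: ent_def)
        moreover have "(\<Sum>b<q-r. ent ?B i (b + r) * y (b + r)) = app (q - r) (ent Br) (\<lambda>b. y (b + r)) i"
          unfolding app_def using True Ar Br Cr r by (intro sum.cong) (auto simp: ent_def)
        ultimately show ?thesis using s True by simp
      next
        case False
        have "(\<Sum>b<r. ent ?B i b * y b) = 0"
          using False i Ar Br Cr r by (intro sum.neutral) (auto simp: ent_def)
        moreover have "(\<Sum>b<q-r. ent ?B i (b + r) * y (b + r)) = app (q - r) (ent Cr) (\<lambda>b. y (b + r)) (i - r)"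
          unfolding app_def using False i Ar Br Cr r by (intro sum.cong) (auto simp: ent_def)
        ultimately show ?thesis using s False by simp
      qed
    qed
  qed
  finally show ?thesis unfolding y_def .
qed

lemma srrqr_image:
  assumes M: "M \<in> carrier_mat p q" and fac: "srrqr_factorization r M \<pi> Q Ar Br Cr"
  shows "\<pi> ` {0..<r} \<subseteq> {..<q}" "card (\<pi> ` {0..<r}) = r"
proof -
  have r: "r \<le> q" and \<pi>: "\<pi> permutes {0..<q}"
    using srrqr_factorizationD(1,2)[OF M fac] by simp_all
  show "\<pi> ` {0..<r} \<subseteq> {..<q}"
  proof (rule image_subsetI)
    fix a assume "a \<in> {0..<r}"
    then have "a < q" using r by simp
    then show "\<pi> a \<in> {..<q}" using permutes_lt[OF \<pi>, of a] by simp
  qed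
  have "inj_on \<pi> {0..<r}" by (rule permutes_inj_on[OF \<pi>])
  then show "card (\<pi> ` {0..<r}) = r" by (simp add: card_image)
qed

text \<open>The k leading right singular vectors of \<open>Ar\<close>, put in the positions of the
  selected columns, never meet \<open>Br\<close> and \<open>Cr\<close>. Part (a) of the
  factorization compares their stretching with the k-th singular value of \<open>M\<close>.\<close>

lemma srrqr_subspace:
  assumes M: "M \<in> carrier_mat p q" and fac: "srrqr_factorization r M \<pi> Q Ar Br Cr" and k: "1 \<le> k" "k \<le> r"
  shows "\<exists>V. (\<forall>c i. i \<notin> \<pi> ` {0..<r} \<longrightarrow> app k V c i = 0) \<and> (\<forall>c. nrm q (app k V c) = nrm k c) \<and>
    (\<forall>c. sing_val k M / sqrt (1 + real r * (real q - real r)) * nrm k c \<le> nrm p (app q (ent M) (app k V c)))"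
proof -
  have r: "r \<le> p" "r \<le> q" and \<pi>: "\<pi> permutes {0..<q}" and Ar: "Ar \<in> carrier_mat r r"
    and sv: "sing_val k M / sqrt (1 + real r * (real q - real r)) \<le> sing_val k Ar"
    using srrqr_factorizationD(1,2,5,9)[OF M fac] k by simp_all
  let ?J = "\<pi> ` {0..<r}" and ?\<rho> = "inv_into UNIV \<pi>"
  have inv: "?\<rho> (\<pi> i) = i" for i using permutes_inj[OF \<pi>] by simp
  have "k \<le> min r r" using k by simp
  from sing_val_subspace[OF Ar k(1) this] obtain V0 where V0': "(\<forall>c. nrm r (app k V0 c) = nrm k c) \<and>
    (\<forall>c. sing_val k Ar * nrm k c \<le> nrm r (app r (ent Ar) (app k V0 c))) \<and>
    (\<forall>c. sing_val k Ar * nrm r (app r (ent Ar) (app k V0 c))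
       \<le> nrm r (app r (tr (ent Ar)) (app r (ent Ar) (app k V0 c))))"
    by (elim exE) (rule that)
  note V0 = V0'[THEN conjunct1, rule_format] V0'[THEN conjunct2, THEN conjunct1, rule_format]
  define V where "V i t = (if i \<in> ?J then V0 (?\<rho> i) t else 0)" for i t
  have Vp: "app k V c (\<pi> b) = (if b < r then app k V0 c b else 0)" for c b
  proof -
    have "\<pi> b \<in> ?J \<longleftrightarrow> b < r" by (simp add: inj_image_mem_iff[OF permutes_inj[OF \<pi>]])
    then show ?thesis unfolding app_def V_def by (simp add: inv)
  qed
  have supp: "app k V c i = 0" if "i \<notin> ?J" for c i using that unfolding app_def V_def by simp
  have iso: "nrm q (app k V c) = nrm k c" for c
  proof -
    have "nrm q (app k V c) = L2_set (app k V c) ?J"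
      using srrqr_image(1)[OF M fac] supp by (intro nrm_supported) auto
    also have "\<dots> = nrm r (\<lambda>b. app k V c (\<pi> b))"
      unfolding L2_set_def nrm_L2 using permutes_inj_on[OF \<pi>, of "{0..<r}"]
      by (subst sum.reindex) (auto simp: lessThan_atLeast0)
    also have "\<dots> = nrm r (app k V0 c)" by (intro nrm_cong) (simp add: Vp)
    finally show ?thesis using V0(1) by simp
  qed
  have "sing_val k M / sqrt (1 + real r * (real q - real r)) * nrm k c \<le> nrm p (app q (ent M) (app k V c))" for c
  proof -
    have "sing_val k M / sqrt (1 + real r * (real q - real r)) * nrm k c \<le> sing_val k Ar * nrm k c"
      using sv by (intro mult_right_mono) auto
    also have "\<dots> \<le> nrm r (app r (ent Ar) (app k V0 c))" by (rule V0(2))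
    also have "\<dots> = nrm r (app r (ent Ar) (\<lambda>b. app k V c (\<pi> b)))"
      by (intro nrm_cong app_cong) (simp add: Vp)
    also have "\<dots> = nrm p (app q (ent M) (app k V c))"
    proof -
      have z: "app l X (\<lambda>b. app k V c (\<pi> (b + r))) i = 0" for l X i
        unfolding app_def[of l] by (simp add: Vp)
      have "nrm p (app q (ent M) (app k V c))
          = L2_set (\<lambda>i. if i < r then app r (ent Ar) (\<lambda>b. app k V c (\<pi> b)) i else 0) {..<p}"
        unfolding srrqr_norm[OF M fac] z add_0_right unfolding nrm_L2 ..
      also have "\<dots> = nrm r (app r (ent Ar) (\<lambda>b. app k V c (\<pi> b)))"
        unfolding nrm_L2 L2_set_def using r
        by (intro arg_cong[of _ _ sqrt] sum.mono_neutral_cong_right) auto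
      finally show ?thesis by simp
    qed
    finally show ?thesis .
  qed
  then show ?thesis using supp iso by (intro exI[of _ V]) auto
qed

lemma max_norm_ge: "i < dim_row M \<Longrightarrow> j < dim_col M \<Longrightarrow> \<bar>M $$ (i,j)\<bar> \<le> max_norm M"
proof -
  assume ij: "i < dim_row M" "j < dim_col M"
  have "{\<bar>M $$ (i, j)\<bar> |i j. i < dim_row M \<and> j < dim_col M} = (\<lambda>(i,j). \<bar>M $$ (i,j)\<bar>) ` ({..<dim_row M} \<times> {..<dim_col M})"
    by auto
  then have "finite {\<bar>M $$ (i, j)\<bar> |i j. i < dim_row M \<and> j < dim_col M}" by simp
  then show ?thesis unfolding max_norm_def using ij by (intro Max_ge) auto
qed

text \<open>The matrix \<open>T\<close> is \<open>[I, A\<^sub>r\<^sup>-\<^sup>1 B\<^sub>r]\<close> in the original order of the columns.\<close>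

lemma srrqr_interpolation:
  assumes M: "M \<in> carrier_mat p q" and fac: "srrqr_factorization r M \<pi> Q Ar Br Cr" and r1: "1 \<le> r"
    and pos: "0 < sing_val r M" and e: "r + 1 \<le> min p q \<Longrightarrow> sing_val (r + 1) M \<le> e" "0 \<le> e"
  shows "\<exists>T. (\<forall>i j. i \<notin> \<pi> ` {0..<r} \<longrightarrow> T i j = 0) \<and> (\<forall>i j. j < q \<longrightarrow> \<bar>T i j\<bar> \<le> 1) \<and>
    (\<forall>x. nrm p (app q (ent M) (\<lambda>j. x j - app q T x j)) \<le> sqrt (1 + real r * (real q - real r)) * e * nrm q x)"
proof -
  define f where "f = sqrt (1 + real r * (real q - real r))"
  have r: "r \<le> p" "r \<le> q" and \<pi>: "\<pi> permutes {0..<q}" and Ar: "Ar \<in> carrier_mat r r"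
    and Br: "Br \<in> carrier_mat r (q - r)" and Cr: "Cr \<in> carrier_mat (p - r) (q - r)"
    and sv: "sing_val r M / f \<le> sing_val r Ar"
    and svC: "\<And>j. 1 \<le> j \<Longrightarrow> j \<le> min p q - r \<Longrightarrow> sing_val j Cr \<le> sing_val (r + j) M * f"
    and mx: "\<And>G. G \<in> carrier_mat r r \<Longrightarrow> inverts_mat Ar G \<Longrightarrow> inverts_mat G Ar \<Longrightarrow> max_norm (G * Br) \<le> 1"
    unfolding f_def using srrqr_factorizationD(1,2,5,6,7,9,10,11)[OF M fac] r1 by simp_all
  have f1: "1 \<le> f" unfolding f_def using r by simp
  let ?J = "\<pi> ` {0..<r}" and ?\<rho> = "inv_into UNIV \<pi>"
  have inv: "?\<rho> (\<pi> i) = i" for i using permutes_inj[OF \<pi>] by simp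
  have "0 < sing_val r M / f" using pos f1 by simp
  then have svr: "0 < sing_val r Ar" using sv by linarith
  \<comment> \<open>Part (c) of the factorization speaks only about an invertible \<open>Ar\<close>;
    part (a) for i = r supplies the invertibility.\<close>
  have "Determinant.det Ar \<noteq> 0"
  proof
    assume "Determinant.det Ar = 0"
    then obtain v where v: "v \<in> carrier_vec r" "v \<noteq> 0\<^sub>v r" "Ar *\<^sub>v v = 0\<^sub>v r"
      using det_0_iff_vec_prod_zero_field[OF Ar] by auto
    have "r \<le> min r r" by simp
    from sing_val_subspace[OF Ar r1 this] obtain V where V': "(\<forall>c. nrm r (app r V c) = nrm r c) \<and>
      (\<forall>c. sing_val r Ar * nrm r c \<le> nrm r (app r (ent Ar) (app r V c))) \<and>
      (\<forall>c. sing_val r Ar * nrm r (app r (ent Ar) (app r V c))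
         \<le> nrm r (app r (tr (ent Ar)) (app r (ent Ar) (app r V c))))"
      by (elim exE) (rule that)
    note V = V'[THEN conjunct1, rule_format] V'[THEN conjunct2, THEN conjunct1, rule_format]
    have "\<exists>s. \<forall>i<r. app r V s i = ($) v i"
    proof (rule injective_imp_surjective)
      fix c assume "\<forall>i<r. app r V c i = 0"
      then have "nrm r (app r V c) = 0" by (simp add: nrm_eq0)
      then show "\<forall>j<r. c j = 0" unfolding V(1) nrm_eq0 .
    qed
    then obtain c where c: "\<And>i. i < r \<Longrightarrow> app r V c i = v $ i" by auto
    have "nrm r (app r (ent Ar) (app r V c)) = nrm r (app r (ent Ar) (($) v))"
      using c by (intro nrm_cong app_cong) auto
    also have "\<dots> = vec_l2norm (Ar *\<^sub>v v)" by (rule vec_l2norm_mult[OF Ar v(1), symmetric])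
    also have "\<dots> = 0" unfolding v(3) vec_l2norm_def by simp
    finally have "sing_val r Ar * nrm r c \<le> 0" using V(2)[of c] by simp
    then have "nrm r c = 0" using svr nrm_ge0[of r c] by (simp add: mult_le_0_iff)
    then have "nrm r (app r V c) = 0" using V(1) by simp
    then have "\<forall>i<r. v $ i = 0" using c by (simp add: nrm_eq0)
    then show False using v(1,2) by (metis eq_vecI carrier_vecD index_zero_vec)
  qed
  then obtain G where G: "G \<in> carrier_mat r r" "Ar * G = 1\<^sub>m r" "G * Ar = 1\<^sub>m r"
    using det_non_zero_imp_unit[OF Ar] unfolding Units_def ring_mat_def by auto
  have GB: "G * Br \<in> carrier_mat r (q - r)" using G Br by simp
  have "max_norm (G * Br) \<le> 1" using G Ar by (intro mx) (auto simp: inverts_mat_def)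
  then have F1: "\<bar>ent (G * Br) a b\<bar> \<le> 1" if "a < r" "b < q - r" for a b
    using max_norm_ge[of a "G * Br" b] that GB G(1) Br unfolding ent_def by auto
  define T where "T i j = (if i \<in> ?J then if ?\<rho> j < r then (if i = j then 1 else 0) else ent (G * Br) (?\<rho> i) (?\<rho> j - r) else 0)"
    for i j
  have T0: "T i j = 0" if "i \<notin> ?J" for i j using that unfolding T_def by simp
  have \<rho>lt: "?\<rho> j < q" if "j < q" for j using permutes_lt[OF permutes_inv[OF \<pi>]] that by simp
  have T1: "\<bar>T i j\<bar> \<le> 1" if "j < q" for i j
    using F1[of "?\<rho> i" "?\<rho> j - r"] \<rho>lt[OF that] unfolding T_def by (auto simp: inv)
  have split: "(\<Sum>b<q. h b) = (\<Sum>b<r. h b) + (\<Sum>b<q-r. h (b + r))" for h :: "nat \<Rightarrow> real"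
    using sum.atLeastLessThan_concat[of 0 r q h] sum.shift_bounds_nat_ivl[of h 0 r "q - r"] r(2)
    by (simp add: lessThan_atLeast0)
  have pJ: "\<pi> b \<in> ?J \<longleftrightarrow> b < r" for b by (simp add: inj_image_mem_iff[OF permutes_inj[OF \<pi>]])
  have pp: "\<pi> a = \<pi> b \<longleftrightarrow> a = b" for a b by (rule inj_eq[OF permutes_inj[OF \<pi>]])
  have Tx: "app q T x (\<pi> b) = (if b < r then x (\<pi> b) + app (q - r) (ent (G * Br)) (\<lambda>t. x (\<pi> (t + r))) b else 0)" for x b
  proof -
    have "app q T x (\<pi> b) = (\<Sum>t<q. T (\<pi> b) (\<pi> t) * x (\<pi> t))"
      unfolding app_def using sum.permute[OF \<pi>, of "\<lambda>j. T (\<pi> b) j * x j"] by (simp add: lessThan_atLeast0 o_def)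
    also have "\<dots> = (\<Sum>t<r. T (\<pi> b) (\<pi> t) * x (\<pi> t)) + (\<Sum>t<q-r. T (\<pi> b) (\<pi> (t + r)) * x (\<pi> (t + r)))"
      by (rule split)
    also have "(\<Sum>t<r. T (\<pi> b) (\<pi> t) * x (\<pi> t)) = (\<Sum>t<r. if t = b then x (\<pi> b) else 0)"
      unfolding T_def by (intro sum.cong) (auto simp: inv pJ pp)
    also have "(\<Sum>t<q-r. T (\<pi> b) (\<pi> (t + r)) * x (\<pi> (t + r))) = (if b < r then app (q - r) (ent (G * Br)) (\<lambda>t. x (\<pi> (t + r))) b else 0)"
      unfolding T_def app_def by (auto simp: inv pJ)
    finally show ?thesis by simp
  qed
  have err: "nrm p (app q (ent M) (\<lambda>j. x j - app q T x j)) \<le> f * e * nrm q x" for x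
  proof -
    define x2 where "x2 t = x (\<pi> (t + r))" for t
    let ?y = "\<lambda>j. x j - app q T x j"
    have y1: "?y (\<pi> b) = - app (q - r) (ent (G * Br)) x2 b" if "b < r" for b
      using that unfolding Tx x2_def by simp
    have y2: "?y (\<pi> (b + r)) = x2 b" for b unfolding Tx x2_def by simp
    \<comment> \<open>On the interpolation residual the contributions of \<open>Ar\<close> and
      \<open>Br\<close> cancel, so only \<open>Cr\<close> is left, and part (b) bounds its largest
      singular value.\<close>
    have "app r (ent Ar) (\<lambda>b. ?y (\<pi> b)) i + app (q - r) (ent Br) x2 i = 0" if i: "i < r" for i
    proof -
      have "app r (ent Ar) (\<lambda>b. ?y (\<pi> b)) i = app r (ent Ar) (\<lambda>b. (-1) * app (q - r) (ent (G * Br)) x2 b) i"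
        using y1 by (intro app_cong) auto
      also have "\<dots> = - app r (ent Ar) (app (q - r) (ent (G * Br)) x2) i" unfolding app_scale by simp
      also have "app r (ent Ar) (app (q - r) (ent (G * Br)) x2) i = app (q - r) (ent (Ar * (G * Br))) x2 i"
        by (rule app_mult_mat[OF Ar GB i, symmetric])
      also have "Ar * (G * Br) = Br" using assoc_mult_mat[OF Ar G(1) Br] G(2) Br by simp
      finally show ?thesis by simp
    qed
    then have "nrm p (app q (ent M) ?y) = nrm p (\<lambda>i. if i < r then 0 else app (q - r) (ent Cr) x2 (i - r))"
      unfolding srrqr_norm[OF M fac] y2 by (intro nrm_cong) auto
    also have "\<dots> = nrm (p - r) (app (q - r) (ent Cr) x2)"
    proof -
      have "(\<Sum>b<p. h b) = (\<Sum>b<r. h b) + (\<Sum>b<p-r. h (b + r))" for h :: "nat \<Rightarrow> real"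
        using sum.atLeastLessThan_concat[of 0 r p h] sum.shift_bounds_nat_ivl[of h 0 r "p - r"] r(1)
        by (simp add: lessThan_atLeast0)
      then show ?thesis unfolding nrm_def ip_def by simp
    qed
    also have "\<dots> \<le> f * e * nrm (q - r) x2"
    proof (cases "r + 1 \<le> min p q")
      case True
      have "nrm (p - r) (app (q - r) (ent Cr) x2) \<le> sing_val 1 Cr * nrm (q - r) x2" by (rule norm_le_sing_val_1[OF Cr])
      also have "sing_val 1 Cr \<le> f * e"
      proof -
        have "sing_val 1 Cr \<le> sing_val (r + 1) M * f" using True by (intro svC) auto
        also have "\<dots> \<le> e * f" using e(1)[OF True] f1 by (intro mult_right_mono) auto
        finally show ?thesis by (simp add: mult.commute)
      qed
      finally show ?thesis by (simp add: mult_right_mono)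
    next
      case False
      then have "p - r = 0 \<or> q - r = 0" using r by auto
      then have "nrm (p - r) (app (q - r) (ent Cr) x2) = 0" by (auto simp: nrm_eq0 app_def)
      then show ?thesis using f1 e(2) by simp
    qed
    also have "\<dots> \<le> f * e * nrm q x"
    proof -
      have "nrm (q - r) x2 \<le> nrm q (\<lambda>b. x (\<pi> b))"
        unfolding nrm_def ip_def x2_def split[of "\<lambda>b. x (\<pi> b) * x (\<pi> b)"] by (simp add: sum_nonneg)
      also have "\<dots> = nrm q x" unfolding nrm_def ip_def
        using sum.permute[OF \<pi>, of "\<lambda>j. x j * x j"] by (simp add: lessThan_atLeast0 o_def)
      finally show ?thesis using f1 e(2) by (intro mult_left_mono) auto
    qed
    finally show ?thesis .
  qed
  show ?thesis using T0 T1 err unfolding f_def by (intro exI[of _ T]) auto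
qed

section \<open>Columns selected from sampled rows\<close>

text \<open>Solving for the unit vectors makes the solution linear in t. A matrix is wanted because
  \<open>sing_val_ge\<close> takes its test subspace as the range of one.\<close>

lemma injective_imp_right_inverse:
  assumes "\<And>c. (\<forall>i<k. app k W c i = 0) \<Longrightarrow> (\<forall>j<k. c j = 0)"
  shows "\<exists>N. \<forall>t. \<forall>i<k. app k W (app k N t) i = t i"
proof -
  have "\<exists>s. \<forall>i<k. app k W s i = (if i = j then 1 else 0)" for j
    by (rule injective_imp_surjective[OF assms])
  then have "\<exists>s. \<forall>j. \<forall>i<k. app k W (s j) i = (if i = j then 1 else 0)" by metis
  then obtain s where s: "\<And>j i. i < k \<Longrightarrow> app k W (s j) i = (if i = j then 1 else 0)" by blast
  define N where "N i j = s j i" for i j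
  have "app k W (app k N t) i = t i" if "i < k" for t i
  proof -
    have "app k W (app k N t) i = (\<Sum>j<k. (if i = j then t j else 0))"
      unfolding app_app unfolding app_def[of k "\<lambda>i j. \<Sum>l<k. W i l * N l j"]
      using s[OF that] unfolding N_def app_def[of k W] by (intro sum.cong refl) simp
    then show ?thesis using that by simp
  qed
  then show ?thesis by (intro exI[of _ N]) auto
qed

lemma L2_set_diff_ge: "L2_set f J - L2_set g J \<le> L2_set (\<lambda>i. f i - g i) J"
proof -
  have "L2_set f J \<le> L2_set (\<lambda>i. f i - g i) J + L2_set g J"
    using L2_set_triangle_ineq[of "\<lambda>i. f i - g i" g J] by simp
  then show ?thesis by simp
qed

lemma L2_set_minus: "L2_set (\<lambda>i. - f i) J = L2_set f J" unfolding L2_set_def by simp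

lemma L2_set_sum_ge: "L2_set f J - L2_set g J \<le> L2_set (\<lambda>i. f i + g i) J"
  using L2_set_diff_ge[of f J "\<lambda>i. - g i"] by (simp add: L2_set_minus)

lemma L2_set_le_nrm: "J \<subseteq> {..<n} \<Longrightarrow> L2_set f J \<le> nrm n f"
  unfolding nrm_L2 by (rule L2_set_mono_set) auto

text \<open>The problem reduced to estimates: \<open>B\<close> is the low-rank part, and r stands
  for k1 + k2. The constant 2 reflects that the columns of X and of Y fall into two orthonormal
  groups that need not be orthogonal to each other.\<close>

locale low_rank_block =
  fixes n m k r k1 :: nat and X Y Z :: "nat \<Rightarrow> nat \<Rightarrow> real" and A B E :: "real mat" and \<epsilon> :: real
  assumes A: "A \<in> carrier_mat n m" and B: "B \<in> carrier_mat n m" and E: "E \<in> carrier_mat n m"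
    and A_eq: "A = B + E"
    and B_app: "\<And>x i. i < n \<Longrightarrow> app m (ent B) x i = app k X (app k Z (app m (tr Y) x)) i"
    and Bt_app: "\<And>y j. j < m \<Longrightarrow> app n (tr (ent B)) y j = app k Y (app k (tr Z) (app n (tr X) y)) j"
    and E_le: "\<And>x. nrm n (app m (ent E) x) \<le> \<epsilon> * nrm m x" and eps: "0 \<le> \<epsilon>"
    and X_le: "\<And>z. nrm n (app k X z) \<le> 2 * nrm k z" and Y_le: "\<And>x. nrm k (app m (tr Y) x) \<le> 2 * nrm m x"
    and k: "1 \<le> k" "k \<le> n" "k \<le> m" and sigma_pos: "0 < sing_val k B"
    and r: "r \<le> k" "k1 \<le> r"
    and Z_block: "\<And>i j. i < k \<Longrightarrow> j < k \<Longrightarrow> (i < r) \<noteq> (j < r) \<Longrightarrow> Z i j = 0"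
begin

abbreviation "\<sigma> \<equiv> sing_val k B"

lemma A_app: "i < n \<Longrightarrow> app m (ent A) x i = app m (ent B) x i + app m (ent E) x i"
  unfolding A_eq by (rule app_add_mat[OF B E])

lemma At_app: "j < m \<Longrightarrow> app n (tr (ent A)) y j = app n (tr (ent B)) y j + app n (tr (ent E)) y j"
  unfolding A_eq app_def tr_def ent_def using B E by (simp add: sum.distrib algebra_simps)

lemma Et_le: "nrm m (app n (tr (ent E)) y) \<le> \<epsilon> * nrm n y"
  by (rule app_adjoint_bound[OF E_le eps])

text \<open>Satisfied by the k leading right singular vectors of \<open>B\<close>; as
  \<open>B\<close> factors through k dimensions, they span its row space.\<close>

definition row_basis :: "(nat \<Rightarrow> nat \<Rightarrow> real) \<Rightarrow> bool" where
  "row_basis V \<longleftrightarrow> (\<forall>c. nrm m (app k V c) = nrm k c) \<and>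
    (\<forall>c. \<sigma> * nrm k c \<le> nrm n (app m (ent B) (app k V c))) \<and>
    (\<forall>c. \<sigma> * nrm n (app m (ent B) (app k V c)) \<le> nrm m (app n (tr (ent B)) (app m (ent B) (app k V c))))"

lemma row_basis_exists: "\<exists>V. row_basis V"
proof -
  have "k \<le> min n m" using k by simp
  from sing_val_subspace[OF B k(1) this] show ?thesis unfolding row_basis_def .
qed

lemma row_basisD:
  assumes "row_basis V"
  shows "nrm m (app k V c) = nrm k c" "\<sigma> * nrm k c \<le> nrm n (app m (ent B) (app k V c))"
    "\<sigma> * nrm n (app m (ent B) (app k V c)) \<le> nrm m (app n (tr (ent B)) (app m (ent B) (app k V c)))"
  using assms[unfolded row_basis_def, THEN conjunct1]
    assms[unfolded row_basis_def, THEN conjunct2, THEN conjunct1]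
    assms[unfolded row_basis_def, THEN conjunct2, THEN conjunct2] by simp_all

lemma row_basis_zero:
  assumes V: "row_basis V" and z: "nrm n (app m (ent B) (app k V c)) = 0"
  shows "nrm k c = 0"
proof -
  have "\<sigma> * nrm k c \<le> 0" using row_basisD(2)[OF V, of c] z by simp
  then show ?thesis using sigma_pos nrm_ge0[of k c] by (simp add: mult_le_0_iff)
qed

lemma norm_Z_row_space:
  assumes V: "row_basis V"
  shows "\<sigma> / 2 * nrm m (app k V c) \<le> nrm k (app k Z (app m (tr Y) (app k V c)))"
proof -
  have "\<sigma> * nrm m (app k V c) \<le> nrm n (app m (ent B) (app k V c))"
    using row_basisD(1,2)[OF V, of c] by simp
  also have "\<dots> = nrm n (app k X (app k Z (app m (tr Y) (app k V c))))" by (intro nrm_cong B_app)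
  also have "\<dots> \<le> 2 * nrm k (app k Z (app m (tr Y) (app k V c)))" by (rule X_le)
  finally show ?thesis by simp
qed

lemma row_basis_inj:
  assumes V: "row_basis V" and z: "\<And>i. i < k \<Longrightarrow> app k Z (app m (tr Y) (app k V c)) i = 0"
  shows "nrm k c = 0"
proof (rule row_basis_zero[OF V])
  have "nrm n (app m (ent B) (app k V c)) = nrm n (app k X (app k Z (app m (tr Y) (app k V c))))"
    by (intro nrm_cong B_app)
  also have "\<dots> = nrm n (\<lambda>_. 0)"
    using z by (intro nrm_cong) (simp add: app_def[of k X])
  finally show "nrm n (app m (ent B) (app k V c)) = 0" by simp
qed

lemma app_assoc3: "app p F (app q G (app s H c)) = app s (\<lambda>i j. \<Sum>l<p. F i l * (\<Sum>t<q. G l t * H t j)) c"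
proof -
  have "app q G (app s H c) = app s (\<lambda>i j. \<Sum>l<q. G i l * H l j) c" by (rule ext) (rule app_app)
  then show ?thesis by (intro ext) (simp only: app_app)
qed

text \<open>The matrix Y^T V is square and injective, so every z is Y^T V c with |z| \<le> 2 |V c|.
  Thus \<open>Z\<close> inherits the k-th singular value of \<open>B\<close>, with one factor 2 lost
  to X and another to Y.\<close>

lemma norm_Z_ge: "\<sigma> / 4 * nrm k z \<le> nrm k (app k Z z)"
proof -
  obtain V where V: "row_basis V" using row_basis_exists by blast
  define W where "W = (\<lambda>i j. \<Sum>l<m. tr Y i l * V l j)"
  have W: "app m (tr Y) (app k V c) i = app k W c i" for c i unfolding W_def by (rule app_app)
  have "\<exists>c. \<forall>i<k. app k W c i = z i"
  proof (rule injective_imp_surjective)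
    fix c assume c: "\<forall>i<k. app k W c i = 0"
    have "nrm k c = 0"
      by (rule row_basis_inj[OF V]) (use c in \<open>simp add: app_def[of k Z] W\<close>)
    then show "\<forall>j<k. c j = 0" by (simp add: nrm_eq0)
  qed
  then obtain c where c: "\<And>i. i < k \<Longrightarrow> app m (tr Y) (app k V c) i = z i" unfolding W by blast
  have "nrm k z = nrm k (app m (tr Y) (app k V c))" using c by (intro nrm_cong) simp
  also have "\<dots> \<le> 2 * nrm m (app k V c)" by (rule Y_le)
  finally have "\<sigma> / 4 * nrm k z \<le> \<sigma> / 4 * (2 * nrm m (app k V c))"
    using sigma_pos by (intro mult_left_mono) auto
  also have "\<dots> = \<sigma> / 2 * nrm m (app k V c)" by simp
  also have "\<dots> \<le> nrm k (app k Z (app m (tr Y) (app k V c)))" by (rule norm_Z_row_space[OF V])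
  also have "\<dots> = nrm k (app k Z z)" using c by (intro nrm_cong app_cong)
  finally show ?thesis .
qed

end

text \<open>The good event for the sampled rows: they miss the nonzero rows of X3, and on them the
  first r columns of X keep singular values of at least \<kappa>. The constant 48 is what
  \<open>interpolation_error\<close> needs for its 1 / 4.\<close>

locale sampled_rows = low_rank_block +
  fixes I :: "nat set" and \<kappa> :: real
  assumes I: "I \<subseteq> {..<n}" and X_zero: "\<And>i j. i \<in> I \<Longrightarrow> r \<le> j \<Longrightarrow> j < k \<Longrightarrow> X i j = 0"
    and X_ge: "\<And>z. \<kappa> * nrm r z \<le> L2_set (app r X z) I"
    and r1: "1 \<le> r" and small: "48 * \<epsilon> * sqrt (real r * real m) \<le> \<sigma> * \<kappa>" and kappa_pos: "0 < \<kappa>"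
begin

abbreviation "A0 \<equiv> sub_rows A I"

lemma finI: "finite I" using I finite_subset by blast

lemma A0: "A0 \<in> carrier_mat (card I) m" by (rule sub_rows_carrier[OF A I])

lemma X_app_I: "i \<in> I \<Longrightarrow> app k X z i = app r X z i"
  unfolding app_def using X_zero r by (intro sum.mono_neutral_right) auto

lemma B_app_I: "L2_set (app m (ent B) x) I = L2_set (app r X (app k Z (app m (tr Y) x))) I"
proof (rule L2_set_cong[OF refl])
  fix i assume "i \<in> I"
  then show "app m (ent B) x i = app r X (app k Z (app m (tr Y) x)) i" using B_app X_app_I I by auto
qed

lemma E_app_I: "L2_set (app m (ent E) x) I \<le> \<epsilon> * nrm m x"
  using L2_set_le_nrm[OF I] E_le order_trans by blast

lemma A_app_I: "L2_set (app m (ent A) x) I = L2_set (\<lambda>i. app m (ent B) x i + app m (ent E) x i) I"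
  using I by (intro L2_set_cong refl A_app) auto

lemma B_app_I_ge: "\<kappa> * nrm r (app k Z (app m (tr Y) x)) \<le> L2_set (app m (ent B) x) I"
  unfolding B_app_I by (rule X_ge)

lemma rm1: "1 \<le> sqrt (real r * real m)"
proof -
  have "1 * 1 \<le> real r * real m" using r1 k by (intro mult_mono) auto
  then show ?thesis by simp
qed

lemma eps_small: "2 * \<epsilon> < \<sigma> * \<kappa>"
proof -
  have "48 * \<epsilon> * 1 \<le> 48 * \<epsilon> * sqrt (real r * real m)" using eps rm1 by (intro mult_left_mono) auto
  then have "48 * \<epsilon> \<le> \<sigma> * \<kappa>" using small by linarith
  moreover have "0 < \<sigma> * \<kappa>" using sigma_pos kappa_pos by simp
  ultimately show ?thesis using eps by (cases "\<epsilon> = 0") auto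
qed

lemma r_le_card: "r \<le> card I"
proof (rule ccontr)
  assume "\<not> r \<le> card I"
  then obtain c where c: "\<exists>j<r. c j \<noteq> 0" "\<forall>i<card I. app r (\<lambda>t. X (pick I t)) c i = 0"
    using underdetermined_kernel[of "card I" r "\<lambda>t. X (pick I t)"] by auto
  have "L2_set (app r X c) I = nrm (card I) (\<lambda>t. app r X c (pick I t))" by (rule nrm_pick[OF finI, symmetric])
  also have "\<dots> = 0" using c(2) by (simp add: nrm_eq0 app_def)
  finally have "\<kappa> * nrm r c \<le> 0" using X_ge[of c] by simp
  then have "nrm r c = 0" using kappa_pos nrm_ge0[of r c] by (simp add: mult_le_0_iff)
  then show False using c(1) unfolding nrm_eq0 by blast
qed

text \<open>On the r-dimensional part of the row space where Z Y^T x has only its first r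
  coordinates, the sampled rows still stretch by at least \<kappa> \<sigma> / 2 - \<epsilon>. This
  is what will make \<open>Ar\<close> invertible.\<close>

lemma sing_val_A0_pos: "0 < sing_val r A0"
proof -
  obtain V where V: "row_basis V" using row_basis_exists by blast
  define G where "G = (\<lambda>i j. \<Sum>l<k. Z i l * (\<Sum>t<m. tr Y l t * V t j))"
  have G: "app k Z (app m (tr Y) (app k V c)) = app k G c" for c unfolding G_def by (rule app_assoc3)
  have "\<exists>N. \<forall>t. \<forall>i<k. app k G (app k N t) i = t i"
  proof (rule injective_imp_right_inverse)
    fix c assume "\<forall>i<k. app k G c i = 0"
    then have "nrm k c = 0" by (intro row_basis_inj[OF V]) (simp add: G)
    then show "\<forall>j<k. c j = 0" by (simp add: nrm_eq0)
  qed
  then obtain N0 where N0: "\<And>t i. i < k \<Longrightarrow> app k G (app k N0 t) i = t i" by blast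
  \<comment> \<open>The columns of \<open>N\<close> are the vectors of the row space that Z Y^T maps
    to the first r unit vectors.\<close>
  define N where "N = (\<lambda>i j. \<Sum>l<k. V i l * N0 l j)"
  define ext where "ext c j = (if j < r then c j else (0::real))" for c j
  have N: "app r N c = app k V (app k N0 (ext c))" for c
  proof (rule ext)
    fix i
    have "app k V (app k N0 (ext c)) i = app k N (ext c) i" unfolding N_def by (rule app_app)
    also have "\<dots> = app r N c i" unfolding app_def ext_def using r
      by (intro sum.mono_neutral_cong_right) auto
    finally show "app r N c i = app k V (app k N0 (ext c)) i" ..
  qed
  have ZN: "app k Z (app m (tr Y) (app r N c)) i = ext c i" if "i < k" for c i
    unfolding N G using N0[OF that] .
  have nrm_ext: "nrm k (ext c) = nrm r c" "nrm r (ext c) = nrm r c" for c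
  proof -
    show "nrm k (ext c) = nrm r c" unfolding nrm_def ip_def ext_def using r
      by (intro arg_cong[of _ _ sqrt] sum.mono_neutral_cong_right) auto
    show "nrm r (ext c) = nrm r c" by (intro nrm_cong) (simp add: ext_def)
  qed
  have ge: "(\<kappa> * \<sigma> / 2 - \<epsilon>) * nrm m (app r N c) \<le> nrm (card I) (app m (ent A0) (app r N c))" for c
  proof -
    let ?x = "app r N c"
    have "\<sigma> / 2 * nrm m ?x \<le> nrm k (app k Z (app m (tr Y) ?x))"
      unfolding N by (rule norm_Z_row_space[OF V])
    also have "\<dots> = nrm k (ext c)" using ZN by (intro nrm_cong)
    also have "\<dots> = nrm r (app k Z (app m (tr Y) ?x))"
      unfolding nrm_ext(1) nrm_ext(2)[of c, symmetric] using ZN r by (intro nrm_cong) simp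
    finally have "\<kappa> * (\<sigma> / 2 * nrm m ?x) \<le> \<kappa> * nrm r (app k Z (app m (tr Y) ?x))"
      using kappa_pos by (intro mult_left_mono) auto
    also have "\<dots> \<le> L2_set (app m (ent B) ?x) I" by (rule B_app_I_ge)
    finally have "\<kappa> * (\<sigma> / 2 * nrm m ?x) - \<epsilon> * nrm m ?x \<le> L2_set (app m (ent B) ?x) I - L2_set (app m (ent E) ?x) I"
      using E_app_I[of ?x] by linarith
    also have "\<dots> \<le> L2_set (app m (ent A) ?x) I" unfolding A_app_I by (rule L2_set_sum_ge)
    finally show ?thesis unfolding nrm_app_sub_rows[OF A I] by (simp add: algebra_simps)
  qed
  have "\<kappa> * \<sigma> / 2 - \<epsilon> \<le> sing_val r A0"
  proof (rule sing_val_ge(1)[OF A0 r1 _ _ ge])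
    show "r \<le> min (card I) m" using r_le_card r k by simp
    fix c assume z: "nrm m (app r N c) = 0"
    have "nrm r c = nrm k (ext c)" by (rule nrm_ext(1)[symmetric])
    also have "\<dots> = nrm k (app k Z (app m (tr Y) (app r N c)))" using ZN by (intro nrm_cong) simp
    also have "\<dots> = nrm k (app k Z (app m (tr Y) (\<lambda>_. 0)))"
      using z unfolding nrm_eq0 by (intro nrm_cong app_cong) simp
    also have "\<dots> = 0" by (simp add: nrm_eq0 app_def)
    finally show "nrm r c = 0" .
  qed
  then show ?thesis using eps_small by (simp add: mult.commute)
qed

text \<open>Some combination of r + 1 leading singular directions has vanishing first r coordinates
  under Z Y^T. The sampled rows of \<open>B\<close> do not see it, so only \<open>E\<close>
  remains.\<close>

lemma sing_val_A0_next:
  assumes "r + 1 \<le> min (card I) m"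
  shows "sing_val (r + 1) A0 \<le> \<epsilon>"
proof -
  have "\<exists>V. \<forall>c. nrm m (app (r+1) V c) = nrm (r+1) c \<and> sing_val (r + 1) A0 * nrm (r+1) c \<le> nrm (card I) (app m (ent A0) (app (r+1) V c))"
    using sing_val_subspace[OF A0 _ assms] by auto
  then obtain V where V: "\<forall>c. nrm m (app (r+1) V c) = nrm (r+1) c \<and> sing_val (r + 1) A0 * nrm (r+1) c \<le> nrm (card I) (app m (ent A0) (app (r+1) V c))"
    by blast
  define G where "G = (\<lambda>i j. \<Sum>l<k. Z i l * (\<Sum>t<m. tr Y l t * V t j))"
  have G: "app k Z (app m (tr Y) (app (r+1) V c)) = app (r+1) G c" for c unfolding G_def by (rule app_assoc3)
  obtain c where c: "\<exists>j<r+1. c j \<noteq> 0" "\<forall>i<r. app (r+1) G c i = 0"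
    using underdetermined_kernel[of r "r+1" G] by auto
  have cz: "nrm (r+1) c \<noteq> 0" unfolding nrm_eq0 using c(1) by blast
  then have cpos: "0 < nrm (r+1) c" using nrm_ge0[of "r+1" c] by linarith
  let ?x = "app (r+1) V c"
  have "L2_set (app m (ent B) ?x) I = L2_set (\<lambda>_. 0) I"
    unfolding B_app_I G using c(2) by (intro L2_set_cong refl) (simp add: app_def[of r X])
  then have B0: "L2_set (app m (ent B) ?x) I = 0" by (simp add: L2_set_def)
  have "sing_val (r + 1) A0 * nrm (r+1) c \<le> nrm (card I) (app m (ent A0) ?x)" using V by blast
  also have "\<dots> = L2_set (app m (ent A) ?x) I" by (rule nrm_app_sub_rows[OF A I])
  also have "\<dots> \<le> L2_set (app m (ent B) ?x) I + L2_set (app m (ent E) ?x) I"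
    unfolding A_app_I by (rule L2_set_triangle_ineq)
  also have "\<dots> \<le> \<epsilon> * nrm (r+1) c" unfolding B0 using E_app_I[of ?x] V by simp
  finally show ?thesis using cpos by simp
qed

text \<open>The interpolation residual is small on the sampled rows of \<open>A\<close>, hence on
  those of \<open>B\<close>; dividing by \<kappa> and by the lower bound for \<open>Z\<close>
  recovers the first r coordinates under Y^T.\<close>

lemma interpolation_error:
  assumes fac: "srrqr_factorization r A0 \<pi> Q Ar Br Cr"
  obtains T where "\<And>i j. i \<notin> \<pi> ` {0..<r} \<Longrightarrow> T i j = 0" "\<And>i j. j < m \<Longrightarrow> \<bar>T i j\<bar> \<le> 1"
    "\<And>x. L2_set (app m (tr Y) (\<lambda>j. x j - app m T x j)) {..<r} \<le> 1 / 4 * nrm m x"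
proof -
  have ex: "\<exists>T. (\<forall>i j. i \<notin> \<pi> ` {0..<r} \<longrightarrow> T i j = 0) \<and> (\<forall>i j. j < m \<longrightarrow> \<bar>T i j\<bar> \<le> 1) \<and>
    (\<forall>x. nrm (card I) (app m (ent A0) (\<lambda>j. x j - app m T x j)) \<le> sqrt (1 + real r * (real m - real r)) * \<epsilon> * nrm m x)"
    by (rule srrqr_interpolation[OF A0 fac r1 sing_val_A0_pos sing_val_A0_next eps])
  then obtain T where T': "(\<forall>i j. i \<notin> \<pi> ` {0..<r} \<longrightarrow> T i j = 0) \<and> (\<forall>i j. j < m \<longrightarrow> \<bar>T i j\<bar> \<le> 1) \<and>
    (\<forall>x. nrm (card I) (app m (ent A0) (\<lambda>j. x j - app m T x j)) \<le> sqrt (1 + real r * (real m - real r)) * \<epsilon> * nrm m x)"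
    by (elim exE) (rule that)
  note T0 = T'[THEN conjunct1, rule_format] and T1 = T'[THEN conjunct2, THEN conjunct1, rule_format]
    and Terr = T'[THEN conjunct2, THEN conjunct2, rule_format]
  let ?J = "\<pi> ` {0..<r}" and ?s = "sqrt (real r * real m)"
  have J: "?J \<subseteq> {..<m}" "card ?J = r" using srrqr_image[OF A0 fac] by auto
  have "L2_set (app m (tr Y) (\<lambda>j. x j - app m T x j)) {..<r} \<le> 1 / 4 * nrm m x" for x
  proof -
    let ?y = "\<lambda>j. x j - app m T x j"
    have "nrm m (app m T x) \<le> 1 * sqrt (card ?J * card {..<m}) * nrm m x"
      by (rule nrm_app_le_entries[where J = ?J and S = "{..<m}"]) (use T0 T1 J(1) in auto)
    then have Tx: "nrm m (app m T x) \<le> ?s * nrm m x" using J(2) by simp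
    have f: "sqrt (1 + real r * (real m - real r)) \<le> ?s"
    proof -
      have "1 * 1 \<le> real r * real r" using r1 by (intro mult_mono) auto
      then show ?thesis by (intro real_sqrt_le_mono) (simp add: algebra_simps)
    qed
    have "L2_set (app m (ent B) ?y) I \<le> L2_set (app m (ent A) ?y) I + L2_set (app m (ent E) ?y) I"
      using L2_set_sum_ge[of "app m (ent B) ?y" I "app m (ent E) ?y"] unfolding A_app_I by linarith
    also have "L2_set (app m (ent A) ?y) I \<le> ?s * \<epsilon> * nrm m x"
    proof -
      have "L2_set (app m (ent A) ?y) I \<le> sqrt (1 + real r * (real m - real r)) * \<epsilon> * nrm m x"
        using Terr[of x] unfolding nrm_app_sub_rows[OF A I] .
      also have "\<dots> \<le> ?s * \<epsilon> * nrm m x" using f eps by (intro mult_right_mono) auto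
      finally show ?thesis .
    qed
    also have "L2_set (app m (ent E) ?y) I \<le> \<epsilon> * (nrm m x + ?s * nrm m x)"
    proof -
      have "nrm m ?y \<le> nrm m x + ?s * nrm m x" using nrm_diff[of m x "app m T x"] Tx by linarith
      then have "\<epsilon> * nrm m ?y \<le> \<epsilon> * (nrm m x + ?s * nrm m x)" using eps by (intro mult_left_mono)
      then show ?thesis using E_app_I[of ?y] by linarith
    qed
    also have "?s * \<epsilon> * nrm m x + \<epsilon> * (nrm m x + ?s * nrm m x) \<le> 3 * ?s * \<epsilon> * nrm m x"
    proof -
      have "1 * (\<epsilon> * nrm m x) \<le> ?s * (\<epsilon> * nrm m x)" using rm1 eps by (intro mult_right_mono) auto
      then show ?thesis by (simp add: algebra_simps)
    qed
    finally have Bs: "\<kappa> * nrm r (app k Z (app m (tr Y) ?y)) \<le> 3 * ?s * \<epsilon> * nrm m x"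
      using B_app_I_ge[of ?y] by linarith
    \<comment> \<open>\<open>Z\<close> is bounded below only as a whole. As it does not couple the
      first r indices with the others, cutting off w at r commutes with \<open>Z\<close>, and the
      bound applies to the cut vector.\<close>
    define w where "w = app m (tr Y) ?y"
    define w' where "w' j = (if j < r then w j else 0)" for j
    have w': "nrm k w' = nrm r w" unfolding nrm_def ip_def w'_def using r
      by (intro arg_cong[of _ _ sqrt] sum.mono_neutral_cong_right) auto
    have Zw: "app k Z w' i = (if i < r then app k Z w i else 0)" if "i < k" for i
    proof (cases "i < r")
      case True
      have "app k Z w' i = app k Z w i" unfolding app_def w'_def
        using Z_block[OF that] True by (intro sum.cong) auto
      then show ?thesis using True by simp
    next
      case False
      have "app k Z w' i = 0" unfolding app_def w'_def
        using Z_block[OF that] False by (intro sum.neutral) auto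
      then show ?thesis using False by simp
    qed
    have "\<sigma> / 4 * nrm r w \<le> nrm k (app k Z w')" using norm_Z_ge[of w'] unfolding w' .
    also have "\<dots> = nrm r (app k Z w)" unfolding nrm_def ip_def using Zw r
      by (intro arg_cong[of _ _ sqrt] sum.mono_neutral_cong_right) auto
    finally have "\<kappa> * (\<sigma> / 4 * nrm r w) \<le> \<kappa> * nrm r (app k Z w)" using kappa_pos by (intro mult_left_mono) auto
    also have "\<dots> \<le> 3 * ?s * \<epsilon> * nrm m x" using Bs unfolding w_def .
    \<comment> \<open>Here 12 = 3 * 4: three error terms of size at most \<epsilon> sqrt (r m) |x|,
      and the 4 / \<sigma> of \<open>norm_Z_ge\<close>. The 48 in the hypothesis makes the quotient
      1 / 4.\<close>
    finally have 1: "\<sigma> * \<kappa> * nrm r w \<le> 12 * \<epsilon> * ?s * nrm m x" by (simp add: algebra_simps)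
    have "48 * \<epsilon> * ?s * nrm m x \<le> \<sigma> * \<kappa> * nrm m x" using small by (intro mult_right_mono) auto
    then have "\<sigma> * \<kappa> * nrm r w \<le> \<sigma> * \<kappa> * (1 / 4 * nrm m x)" using 1 by linarith
    then have "nrm r w \<le> 1 / 4 * nrm m x" using sigma_pos kappa_pos by (simp only: mult_le_cancel_left_pos mult_pos_pos)
    then show ?thesis unfolding w_def nrm_L2 .
  qed
  then show thesis using T0 T1 by (intro that[of T]) auto
qed

text \<open>For u in the coordinates of block 2, T Y2 u is supported on the selected columns, and
  Y2^T T Y2 differs from the identity by at most 1 / 4, so it can be inverted. Since Y2 vanishes
  outside S, only card S columns of \<open>T\<close> enter the norm.\<close>

lemma sparse_block_coefficients:
  assumes fac: "srrqr_factorization r A0 \<pi> Q Ar Br Cr"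
    and orth: "\<And>t t'. k1 \<le> t \<Longrightarrow> t < r \<Longrightarrow> k1 \<le> t' \<Longrightarrow> t' < r \<Longrightarrow> (\<Sum>j<m. Y j t * Y j t') = (if t = t' then 1 else 0)"
    and S: "S \<subseteq> {..<m}" "\<And>j t. j < m \<Longrightarrow> j \<notin> S \<Longrightarrow> k1 \<le> t \<Longrightarrow> t < r \<Longrightarrow> Y j t = 0"
  shows "\<exists>g. (\<forall>j. j \<notin> \<pi> ` {0..<r} \<longrightarrow> g j = 0) \<and> (\<forall>t. k1 \<le> t \<longrightarrow> t < r \<longrightarrow> app m (tr Y) g t = \<tau> t) \<and>
    nrm m g \<le> 2 * sqrt (r * card S) * L2_set \<tau> {k1..<r}"
proof -
  obtain T where T: "\<And>i j. i \<notin> \<pi> ` {0..<r} \<Longrightarrow> T i j = 0" "\<And>i j. j < m \<Longrightarrow> \<bar>T i j\<bar> \<le> 1"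
    "\<And>x. L2_set (app m (tr Y) (\<lambda>j. x j - app m T x j)) {..<r} \<le> 1 / 4 * nrm m x"
    by (rule interpolation_error[OF fac]) (rule that)
  let ?J = "\<pi> ` {0..<r}" and ?k = "r - k1"
  have J: "?J \<subseteq> {..<m}" "card ?J = r" using srrqr_image[OF A0 fac] by auto
  define Y2 where "Y2 j s = Y j (k1 + s)" for j s
  have shift: "nrm ?k (\<lambda>s. f (k1 + s)) = L2_set f {k1..<r}" for f :: "nat \<Rightarrow> real"
  proof -
    have "(\<Sum>s<?k. (f (k1 + s))\<^sup>2) = (\<Sum>t\<in>{k1..<r}. (f t)\<^sup>2)"
      using sum.shift_bounds_nat_ivl[of "\<lambda>t. (f t)\<^sup>2" 0 k1 ?k] r(2) by (simp add: lessThan_atLeast0 add.commute)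
    then show ?thesis unfolding nrm_L2 L2_set_def by simp
  qed
  have iso: "nrm m (app ?k Y2 u) = nrm ?k u" for u
    unfolding nrm_def by (subst app_orthonormal) (auto simp: Y2_def orth)
  have Y2T: "app m (tr Y2) x s = app m (tr Y) x (k1 + s)" for x s unfolding app_def tr_def Y2_def ..
  have Y2Y2: "app m (tr Y2) (app ?k Y2 u) s = u s" if "s < ?k" for u s
  proof -
    have "app m (tr Y2) (app ?k Y2 u) s = (\<Sum>t<?k. if t = s then u t else 0)"
      unfolding app_app unfolding app_def tr_def Y2_def using orth that by (intro sum.cong) auto
    then show ?thesis using that by simp
  qed
  define N where "N u = app m (tr Y2) (app m T (app ?k Y2 u))" for u
  have near: "nrm ?k u \<le> 2 * nrm ?k (N u)" for u
  proof -
    let ?x = "app ?k Y2 u"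
    have "nrm ?k (\<lambda>s. u s - N u s) = nrm ?k (\<lambda>s. app m (tr Y) (\<lambda>j. ?x j - app m T ?x j) (k1 + s))"
      by (intro nrm_cong) (simp add: N_def Y2T[symmetric] app_diff Y2Y2)
    also have "\<dots> = L2_set (app m (tr Y) (\<lambda>j. ?x j - app m T ?x j)) {k1..<r}" by (rule shift)
    also have "\<dots> \<le> L2_set (app m (tr Y) (\<lambda>j. ?x j - app m T ?x j)) {..<r}" by (intro L2_set_mono_set) auto
    also have "\<dots> \<le> 1 / 4 * nrm ?k u" using T(3)[of ?x] unfolding iso .
    finally have "nrm ?k (\<lambda>s. u s - N u s) \<le> 1 / 4 * nrm ?k u" .
    then show ?thesis using nrm_diff_ge[of ?k u "N u"] nrm_ge0[of ?k u] by linarith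
  qed
  define W where "W = (\<lambda>i j. \<Sum>l<m. tr Y2 i l * (\<Sum>t<m. T l t * Y2 t j))"
  have W: "N u = app ?k W u" for u unfolding N_def W_def by (rule app_assoc3)
  have "\<exists>u. \<forall>s<?k. app ?k W u s = \<tau> (k1 + s)"
  proof (rule injective_imp_surjective)
    fix c assume "\<forall>i<?k. app ?k W c i = 0"
    then have "nrm ?k (N c) = 0" unfolding W nrm_eq0 .
    then have "nrm ?k c = 0" using near[of c] nrm_ge0[of ?k c] by simp
    then show "\<forall>j<?k. c j = 0" unfolding nrm_eq0 .
  qed
  then obtain u where u: "\<And>s. s < ?k \<Longrightarrow> N u s = \<tau> (k1 + s)" unfolding W by blast
  define g where "g = app m T (app ?k Y2 u)"
  have "app m (tr Y) g t = \<tau> t" if "k1 \<le> t" "t < r" for t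
  proof -
    have "app m (tr Y) g t = N u (t - k1)" unfolding N_def Y2T g_def using that by simp
    then show ?thesis using u[of "t - k1"] that by simp
  qed
  moreover have "g j = 0" if "j \<notin> ?J" for j unfolding g_def app_def[of m T] using T(1)[OF that] by simp
  moreover have "nrm m g \<le> 2 * sqrt (r * card S) * L2_set \<tau> {k1..<r}"
  proof -
    have "nrm m g \<le> 1 * sqrt (card ?J * card S) * nrm m (app ?k Y2 u)"
      unfolding g_def
    proof (rule nrm_app_le_entries[where J = ?J and S = S])
      fix j assume "j < m" "j \<notin> S"
      then show "app ?k Y2 u j = 0" unfolding app_def Y2_def using S(2) by (intro sum.neutral) auto
    qed (use T J(1) S(1) in auto)
    also have "\<dots> = sqrt (r * card S) * nrm ?k u" unfolding iso J(2) by simp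
    also have "\<dots> \<le> sqrt (r * card S) * (2 * nrm ?k (N u))" by (intro mult_left_mono near) simp
    also have "nrm ?k (N u) = L2_set \<tau> {k1..<r}" unfolding shift[symmetric] using u by (intro nrm_cong)
    finally show ?thesis by (simp add: mult_ac)
  qed
  ultimately show ?thesis by (intro exI[of _ g]) auto
qed

end

section \<open>Least-norm coefficients and their combination\<close>

text \<open>The solution of least norm: with W = U^T U over the rows in J, take g = U x on J, where
  W x = \<tau>. Then |g|^2 = <x, \<tau>> together with c |x| \<le> |g| gives the bound.\<close>

lemma dense_block_coefficients:
  assumes J: "J \<subseteq> {..<m}" and c: "0 < c" and ge: "\<And>x. c * nrm k x \<le> L2_set (app k U x) J"
  shows "\<exists>g. (\<forall>j. j \<notin> J \<longrightarrow> g j = 0) \<and> (\<forall>t<k. app m (tr U) g t = \<tau> t) \<and> nrm m g \<le> 1 / c * nrm k \<tau>"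
proof -
  have mask: "app m (tr U) (\<lambda>j. if j \<in> J then f j else 0) t = (\<Sum>j\<in>J. U j t * f j)" for f t
    unfolding app_def tr_def using J by (intro sum.mono_neutral_cong_right) auto
  define W where "W t s = (\<Sum>j\<in>J. U j t * U j s)" for t s
  have W: "app k W x t = (\<Sum>j\<in>J. U j t * app k U x j)" for x t
  proof -
    have "app k W x t = (\<Sum>s<k. \<Sum>j\<in>J. U j t * (U j s * x s))"
      unfolding app_def W_def by (simp add: sum_distrib_right mult.assoc)
    also have "\<dots> = (\<Sum>j\<in>J. \<Sum>s<k. U j t * (U j s * x s))" by (rule sum.swap)
    finally show ?thesis unfolding app_def by (simp add: sum_distrib_left)
  qed
  have quad: "ip k x (app k W x) = (L2_set (app k U x) J)\<^sup>2" for x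
  proof -
    have "ip k x (app k W x) = (\<Sum>t<k. \<Sum>j\<in>J. x t * (U j t * app k U x j))"
      unfolding ip_def W by (simp add: sum_distrib_left)
    also have "\<dots> = (\<Sum>j\<in>J. \<Sum>t<k. x t * (U j t * app k U x j))" by (rule sum.swap)
    also have "\<dots> = (\<Sum>j\<in>J. app k U x j * app k U x j)"
    proof (rule sum.cong[OF refl])
      fix j
      have "(\<Sum>t<k. x t * (U j t * app k U x j)) = (\<Sum>t<k. U j t * x t) * app k U x j"
        unfolding sum_distrib_right by (intro sum.cong refl) simp
      then show "(\<Sum>t<k. x t * (U j t * app k U x j)) = app k U x j * app k U x j"
        unfolding app_def[of k U x j] .
    qed
    finally show ?thesis unfolding L2_set_def by (simp add: sum_nonneg power2_eq_square)
  qed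
  have "\<exists>x. \<forall>t<k. app k W x t = \<tau> t"
  proof (rule injective_imp_surjective)
    fix x assume "\<forall>t<k. app k W x t = 0"
    then have "ip k x (app k W x) = 0" unfolding ip_def by simp
    then have "L2_set (app k U x) J = 0" unfolding quad by simp
    then have "c * nrm k x \<le> 0" using ge[of x] by simp
    then have "nrm k x = 0" using c nrm_ge0[of k x] by (simp add: mult_le_0_iff)
    then show "\<forall>j<k. x j = 0" unfolding nrm_eq0 .
  qed
  then obtain x where x: "\<And>t. t < k \<Longrightarrow> app k W x t = \<tau> t" by blast
  define g where "g j = (if j \<in> J then app k U x j else 0)" for j
  have "app m (tr U) g t = \<tau> t" if "t < k" for t unfolding g_def mask W[symmetric] using x[OF that] .
  moreover have "nrm m g \<le> 1 / c * nrm k \<tau>"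
  proof -
    have g: "nrm m g = L2_set (app k U x) J"
    proof -
      have "nrm m g = L2_set g J" by (rule nrm_supported[OF J]) (simp add: g_def)
      also have "\<dots> = L2_set (app k U x) J" by (intro L2_set_cong) (simp_all add: g_def)
      finally show ?thesis .
    qed
    have "nrm m g * nrm m g = ip k x (app k W x)" unfolding quad g power2_eq_square ..
    also have "\<dots> = ip k x \<tau>" using x by (intro ip_cong) auto
    also have "\<dots> \<le> nrm k x * nrm k \<tau>" using ip_cauchy[of k x \<tau>] by linarith
    finally have "c * (nrm m g * nrm m g) \<le> c * (nrm k x * nrm k \<tau>)" using c by simp
    also have "\<dots> = (c * nrm k x) * nrm k \<tau>" by simp
    also have "\<dots> \<le> nrm m g * nrm k \<tau>" using ge[of x] unfolding g by (intro mult_right_mono) auto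
    finally have *: "nrm m g * (c * nrm m g) \<le> nrm m g * nrm k \<tau>" by (simp add: mult_ac)
    have "c * nrm m g \<le> nrm k \<tau>"
    proof (cases "nrm m g = 0")
      case False
      then have "0 < nrm m g" using nrm_ge0[of m g] by linarith
      then show ?thesis using * by (simp only: mult_le_cancel_left_pos)
    qed simp
    then show ?thesis using c by (simp add: pos_le_divide_eq mult.commute)
  qed
  moreover have "\<forall>j. j \<notin> J \<longrightarrow> g j = 0" unfolding g_def by simp
  ultimately show ?thesis by (intro exI[of _ g]) blast
qed

text \<open>The coefficients on J are fixed first and disturb the coordinates in K' by at most
  \<eta> |g|. The second vector corrects this and is invisible to the coordinates in K, so one
  correction suffices.\<close>

lemma combine_coefficients:
  fixes Y :: "nat \<Rightarrow> nat \<Rightarrow> real"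
  assumes sparse: "\<And>\<tau>. \<exists>g. (\<forall>j. j \<notin> J \<longrightarrow> g j = 0) \<and> (\<forall>t\<in>K. app m (tr Y) g t = \<tau> t) \<and> nrm m g \<le> a * L2_set \<tau> K"
    and dense: "\<And>\<tau>. \<exists>g. (\<forall>j. j \<notin> J' \<longrightarrow> g j = 0) \<and> (\<forall>t\<in>K'. app m (tr Y) g t = \<tau> t) \<and>
      (\<forall>t\<in>K. app m (tr Y) g t = 0) \<and> nrm m g \<le> b * L2_set \<tau> K'"
    and eta: "\<And>g. (\<forall>j. j \<notin> J \<longrightarrow> g j = 0) \<Longrightarrow> L2_set (app m (tr Y) g) K' \<le> \<eta> * nrm m g"
    and Y: "\<And>x. L2_set (app m (tr Y) x) K \<le> nrm m x" "\<And>x. L2_set (app m (tr Y) x) K' \<le> nrm m x"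
    and nonneg: "0 \<le> a" "0 \<le> b" "0 \<le> \<eta>"
  shows "\<exists>g. (\<forall>j. j \<notin> J \<union> J' \<longrightarrow> g j = 0) \<and> (\<forall>t\<in>K \<union> K'. app m (tr Y) g t = app m (tr Y) x t) \<and>
    nrm m g \<le> (a + b * (1 + \<eta> * a)) * nrm m x"
proof -
  obtain g where g: "\<forall>j. j \<notin> J \<longrightarrow> g j = 0" "\<forall>t\<in>K. app m (tr Y) g t = app m (tr Y) x t"
    "nrm m g \<le> a * L2_set (app m (tr Y) x) K"
    using sparse[of "app m (tr Y) x"] by (elim exE conjE) (rule that)
  let ?\<tau> = "\<lambda>t. app m (tr Y) x t - app m (tr Y) g t"
  obtain h where h: "\<forall>j. j \<notin> J' \<longrightarrow> h j = 0" "\<forall>t\<in>K'. app m (tr Y) h t = ?\<tau> t"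
    "\<forall>t\<in>K. app m (tr Y) h t = 0" "nrm m h \<le> b * L2_set ?\<tau> K'"
    using dense[of ?\<tau>] by (elim exE conjE) (rule that)
  have ga: "nrm m g \<le> a * nrm m x"
    using g(3) mult_left_mono[OF Y(1)[of x] nonneg(1)] by linarith
  have "L2_set ?\<tau> K' \<le> L2_set (app m (tr Y) x) K' + L2_set (app m (tr Y) g) K'"
    using L2_set_triangle_ineq[of "app m (tr Y) x" "\<lambda>t. - app m (tr Y) g t" K'] by (simp add: L2_set_minus)
  also have "\<dots> \<le> nrm m x + \<eta> * nrm m g" using Y(2) eta[OF g(1)] by (intro add_mono)
  also have "\<dots> \<le> nrm m x + \<eta> * (a * nrm m x)" using ga nonneg(3) by (intro add_left_mono mult_left_mono)
  finally have "b * L2_set ?\<tau> K' \<le> b * (nrm m x + \<eta> * (a * nrm m x))" using nonneg(2) by (rule mult_left_mono)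
  then have ha: "nrm m h \<le> b * (nrm m x + \<eta> * (a * nrm m x))" using h(4) by linarith
  let ?f = "\<lambda>j. g j + h j"
  have "nrm m ?f \<le> (a + b * (1 + \<eta> * a)) * nrm m x"
    using nrm_triangle[of m g h] ga ha by (simp add: algebra_simps)
  moreover have "\<forall>j. j \<notin> J \<union> J' \<longrightarrow> ?f j = 0" using g(1) h(1) by simp
  moreover have "\<forall>t\<in>K \<union> K'. app m (tr Y) ?f t = app m (tr Y) x t"
    unfolding app_add using g(2) h(2,3) by auto
  ultimately show ?thesis by (intro exI[of _ ?f]) blast
qed

section \<open>The error of selected columns and rows\<close>

text \<open>All that is kept of the good event: coefficients on J at the cost of a factor \<tau>.
  The rest of the section is deterministic.\<close>

locale column_basis = low_rank_block +
  fixes J :: "nat set" and \<tau> :: real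
  assumes J: "J \<subseteq> {..<m}" and tau_pos: "0 < \<tau>"
    and coeff: "\<And>x. \<exists>g. (\<forall>j. j \<notin> J \<longrightarrow> g j = 0) \<and> (\<forall>t<k. app m (tr Y) g t = app m (tr Y) x t) \<and> nrm m g \<le> \<tau> * nrm m x"
begin

abbreviation "C \<equiv> sub_cols A J"
abbreviation "\<sigma>1 \<equiv> sing_val 1 B"

lemma C: "C \<in> carrier_mat n (card J)" by (rule sub_cols_carrier[OF A J])

lemma coefficients:
  obtains g where "\<And>j. j \<notin> J \<Longrightarrow> g j = 0" "\<And>i. i < n \<Longrightarrow> app m (ent B) g i = app m (ent B) x i"
    "nrm m g \<le> \<tau> * nrm m x"
proof -
  obtain g where g: "\<forall>j. j \<notin> J \<longrightarrow> g j = 0" "\<forall>t<k. app m (tr Y) g t = app m (tr Y) x t" "nrm m g \<le> \<tau> * nrm m x"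
    using coeff[of x] by (elim exE conjE) (rule that)
  have "app m (ent B) g i = app m (ent B) x i" if i: "i < n" for i
  proof -
    have "app k Z (app m (tr Y) g) = app k Z (app m (tr Y) x)"
      by (rule ext) (rule app_cong, use g(2) in blast)
    then show ?thesis unfolding B_app[OF i] by simp
  qed
  then show thesis using g(1,3) by (intro that[of g]) auto
qed

lemma column_error:
  "\<exists>g. nrm n (\<lambda>i. app m (ent A) x i - app (card J) (ent C) g i) \<le> \<epsilon> * (1 + \<tau>) * nrm m x"
proof -
  obtain g where g: "\<And>j. j \<notin> J \<Longrightarrow> g j = 0" "\<And>i. i < n \<Longrightarrow> app m (ent B) g i = app m (ent B) x i"
    "nrm m g \<le> \<tau> * nrm m x"
    by (rule coefficients[of x]) (rule that)
  have "nrm n (\<lambda>i. app m (ent A) x i - app (card J) (ent C) (\<lambda>t. g (pick J t)) i)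
      = nrm n (\<lambda>i. app m (ent E) (\<lambda>j. x j - g j) i)"
  proof (rule nrm_cong)
    fix i assume i: "i < n"
    have "app (card J) (ent C) (\<lambda>t. g (pick J t)) i = app m (ent A) g i"
      by (rule app_sub_cols[OF A J i]) (rule g(1))
    then show "app m (ent A) x i - app (card J) (ent C) (\<lambda>t. g (pick J t)) i = app m (ent E) (\<lambda>j. x j - g j) i"
      using A_app[OF i, of x] A_app[OF i, of g] g(2)[OF i] by (simp add: app_diff)
  qed
  also have "\<dots> \<le> \<epsilon> * nrm m (\<lambda>j. x j - g j)" by (rule E_le)
  also have "\<dots> \<le> \<epsilon> * (nrm m x + \<tau> * nrm m x)"
    using nrm_diff[of m x g] g(3) eps by (intro mult_left_mono) linarith+
  finally show ?thesis by (intro exI[of _ "\<lambda>t. g (pick J t)"]) (simp add: algebra_simps)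
qed

text \<open>The coefficient bound, dualized: for w = B^T y take g on J with B g = B w; then |w|^2 =
  <y, B g> = <w, g> involves w on J only.\<close>

lemma Bt_le_J: "nrm m (app n (tr (ent B)) y) \<le> \<tau> * L2_set (app n (tr (ent B)) y) J"
proof -
  let ?w = "app n (tr (ent B)) y"
  obtain g where g: "\<And>j. j \<notin> J \<Longrightarrow> g j = 0" "\<And>i. i < n \<Longrightarrow> app m (ent B) g i = app m (ent B) ?w i"
    "nrm m g \<le> \<tau> * nrm m ?w"
    by (rule coefficients[of ?w]) (rule that)
  have "nrm m ?w * nrm m ?w = ip n y (app m (ent B) ?w)"
    using nrm_sq[of m ?w] ip_app[of m n "tr (ent B)" y ?w] by (simp add: power2_eq_square)
  also have "\<dots> = ip n y (app m (ent B) g)" using g(2) by (intro ip_cong) auto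
  also have "\<dots> = ip m ?w g" using ip_app[of m n "tr (ent B)" y g] by simp
  also have "\<dots> = (\<Sum>j\<in>J. ?w j * g j)" unfolding ip_def using J g(1) by (intro sum.mono_neutral_right) auto
  also have "\<dots> \<le> (\<Sum>j\<in>J. \<bar>?w j\<bar> * \<bar>g j\<bar>)"
    by (intro sum_mono) (metis abs_ge_self abs_mult)
  also have "\<dots> \<le> L2_set ?w J * L2_set g J" by (rule L2_set_mult_ineq)
  also have "\<dots> \<le> L2_set ?w J * (\<tau> * nrm m ?w)"
  proof (rule mult_left_mono[OF _ L2_set_nonneg])
    show "L2_set g J \<le> \<tau> * nrm m ?w" using L2_set_le_nrm[OF J, of g] g(3) by linarith
  qed
  finally have *: "nrm m ?w * nrm m ?w \<le> nrm m ?w * (\<tau> * L2_set ?w J)"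
    by (simp add: mult_ac)
  show ?thesis
  proof (cases "nrm m ?w = 0")
    case True
    then show ?thesis using tau_pos by (simp add: L2_set_nonneg)
  next
    case False
    then have "0 < nrm m ?w" using nrm_ge0[of m ?w] by linarith
    then show ?thesis using * by (simp only: mult_le_cancel_left_pos)
  qed
qed

lemma At_J_ge: "L2_set (app n (tr (ent B)) y) J - \<epsilon> * nrm n y \<le> L2_set (app n (tr (ent A)) y) J"
proof -
  have "L2_set (app n (tr (ent A)) y) J = L2_set (\<lambda>j. app n (tr (ent B)) y j + app n (tr (ent E)) y j) J"
    using J by (intro L2_set_cong refl At_app) auto
  moreover have "L2_set (app n (tr (ent E)) y) J \<le> \<epsilon> * nrm n y"
    using L2_set_le_nrm[OF J, of "app n (tr (ent E)) y"] Et_le[of y] by linarith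
  ultimately show ?thesis using L2_set_sum_ge[of "app n (tr (ent B)) y" J "app n (tr (ent E)) y"] by linarith
qed

lemma At_J_le: "L2_set (app n (tr (ent A)) y) J \<le> L2_set (app n (tr (ent B)) y) J + \<epsilon> * nrm n y"
proof -
  have "L2_set (app n (tr (ent A)) y) J = L2_set (\<lambda>j. app n (tr (ent B)) y j + app n (tr (ent E)) y j) J"
    using J by (intro L2_set_cong refl At_app) auto
  moreover have "L2_set (app n (tr (ent E)) y) J \<le> \<epsilon> * nrm n y"
    using L2_set_le_nrm[OF J, of "app n (tr (ent E)) y"] Et_le[of y] by linarith
  ultimately show ?thesis using L2_set_triangle_ineq[of "app n (tr (ent B)) y" "app n (tr (ent E)) y" J] by linarith
qed

text \<open>In the application J is a union of two sets that may overlap, so its size has to be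
  inferred: with fewer than k indices, B^T would have a nonzero image vanishing on J.\<close>

lemma k_le_card: "k \<le> card J"
proof (rule ccontr)
  assume "\<not> k \<le> card J"
  obtain V where V: "row_basis V" using row_basis_exists by blast
  define G where "G = (\<lambda>i j. \<Sum>l<n. tr (ent B) i l * (\<Sum>t<m. ent B l t * V t j))"
  have G: "app n (tr (ent B)) (app m (ent B) (app k V c)) = app k G c" for c unfolding G_def by (rule app_assoc3)
  obtain c where c: "\<exists>j<k. c j \<noteq> 0" "\<forall>i<card J. app k (\<lambda>t. G (pick J t)) c i = 0"
    using underdetermined_kernel[of "card J" k "\<lambda>t. G (pick J t)"] \<open>\<not> k \<le> card J\<close> by auto
  let ?y = "app m (ent B) (app k V c)"
  have "finite J" using J finite_subset by blast
  from nrm_pick[OF this, of "app k G c"]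
  have "L2_set (app k G c) J = nrm (card J) (\<lambda>t. app k G c (pick J t))" ..
  also have "(\<lambda>t. app k G c (pick J t)) = app k (\<lambda>t. G (pick J t)) c" by (rule ext) (simp add: app_def)
  also have "nrm (card J) \<dots> = 0" using c(2) unfolding nrm_eq0 .
  finally have "L2_set (app k G c) J = 0" .
  then have "nrm m (app n (tr (ent B)) ?y) \<le> 0" using Bt_le_J[of ?y] unfolding G by simp
  then have "\<sigma> * nrm n ?y \<le> 0" using row_basisD(3)[OF V, of c] by linarith
  then have "nrm n ?y = 0" using sigma_pos nrm_ge0[of n ?y] by (simp add: mult_le_0_iff)
  then have "nrm k c = 0" by (rule row_basis_zero[OF V])
  then show False using c(1) unfolding nrm_eq0 by blast
qed

lemma Ct: "transpose_mat C \<in> carrier_mat (card J) n" using C by simp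

lemma nrm_app_Ct: "nrm (card J) (app n (ent (transpose_mat C)) y) = L2_set (app n (tr (ent A)) y) J"
proof -
  have "nrm (card J) (app n (ent (transpose_mat C)) y) = nrm (card J) (app n (tr (ent C)) y)"
    by (intro nrm_cong app_transpose_mat[OF C])
  also have "\<dots> = L2_set (app n (tr (ent A)) y) J" by (rule nrm_app_tr_sub_cols[OF A J])
  finally show ?thesis .
qed

text \<open>On the range of \<open>B\<close> the transpose stretches by at least \<sigma>.
  Restriction to J costs the factor \<tau>, and passing from \<open>B\<close> to \<open>A\<close>
  costs \<epsilon>.\<close>

lemma sing_val_Ct: "\<sigma> / \<tau> - \<epsilon> \<le> sing_val k (transpose_mat C)"
proof -
  obtain V where V: "row_basis V" using row_basis_exists by blast
  define N where "N = (\<lambda>i j. \<Sum>l<m. ent B i l * V l j)"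
  have N: "app m (ent B) (app k V c) = app k N c" for c unfolding N_def by (rule ext) (rule app_app)
  show ?thesis
  proof (rule sing_val_ge(1)[OF Ct k(1)])
    show "k \<le> min (card J) n" using k_le_card k by simp
    show "nrm k c = 0" if "nrm n (app k N c) = 0" for c
      using row_basis_zero[OF V, of c] that unfolding N .
    show "(\<sigma> / \<tau> - \<epsilon>) * nrm n (app k N c) \<le> nrm (card J) (app n (ent (transpose_mat C)) (app k N c))" for c
    proof -
      let ?y = "app k N c"
      have "\<sigma> * nrm n ?y \<le> \<tau> * L2_set (app n (tr (ent B)) ?y) J"
        using row_basisD(3)[OF V, of c] Bt_le_J[of ?y] unfolding N by linarith
      then have "\<sigma> / \<tau> * nrm n ?y \<le> L2_set (app n (tr (ent B)) ?y) J"
        using tau_pos by (simp add: pos_divide_le_eq mult.commute)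
      then show ?thesis unfolding nrm_app_Ct using At_J_ge[of ?y] by (simp add: algebra_simps)
    qed
  qed
qed

lemma B_le: "nrm n (app m (ent B) x) \<le> \<sigma>1 * nrm m x" by (rule norm_le_sing_val_1[OF B])

lemma sigma_le: "\<sigma> \<le> \<sigma>1"
proof -
  obtain V where V: "row_basis V" using row_basis_exists by blast
  let ?c = "\<lambda>_. 1 :: real"
  have "nrm k ?c \<noteq> 0" unfolding nrm_eq0 using k(1) by (auto intro!: exI[of _ 0])
  then have pos: "0 < nrm k ?c" using nrm_ge0[of k ?c] by linarith
  have "\<sigma> * nrm k ?c \<le> \<sigma>1 * nrm k ?c"
    using row_basisD(1,2)[OF V, of ?c] B_le[of "app k V ?c"] by simp
  then show ?thesis using pos by simp
qed

lemma row_error: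
  assumes fac: "srrqr_factorization q (transpose_mat C) \<pi> Q Ar Br Cr" and q: "k \<le> q"
    and f: "sqrt (1 + real q * (real n - real q)) \<le> f" and small: "\<epsilon> * (4 * f * \<tau>) \<le> \<sigma>"
  shows "\<exists>g. nrm m (\<lambda>i. app n (tr (ent A)) y i - app (card (\<pi> ` {0..<q})) (tr (ent (sub_rows A (\<pi> ` {0..<q})))) g i)
    \<le> \<epsilon> * (1 + 2 * (\<sigma>1 / \<sigma>) * f * \<tau>) * nrm n y"
proof -
  let ?I = "\<pi> ` {0..<q}" and ?f = "sqrt (1 + real q * (real n - real q))"
  have I: "?I \<subseteq> {..<n}" by (rule srrqr_image(1)[OF Ct fac])
  have "q \<le> n" using srrqr_factorizationD(1)[OF Ct fac] by simp
  then have f1: "1 \<le> ?f" by simp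
  then have f0: "1 \<le> f" using f by linarith
  obtain V where V': "(\<forall>c i. i \<notin> ?I \<longrightarrow> app k V c i = 0) \<and> (\<forall>c. nrm n (app k V c) = nrm k c) \<and>
    (\<forall>c. sing_val k (transpose_mat C) / ?f * nrm k c \<le> nrm (card J) (app n (ent (transpose_mat C)) (app k V c)))"
    using srrqr_subspace[OF Ct fac k(1) q] by (elim exE) (rule that)
  note V0 = V'[THEN conjunct1, rule_format] and V1 = V'[THEN conjunct2, THEN conjunct1, rule_format]
    and V2 = V'[THEN conjunct2, THEN conjunct2, rule_format]
  \<comment> \<open>The factorization leaves (\<sigma> / \<tau> - \<epsilon>) / f for the selected
    rows of \<open>A\<close>. As \<epsilon> \<le> \<sigma> / (4 f \<tau>), this perturbation and the
    passage to \<open>B\<close> each cost at most a quarter of \<sigma> / (f \<tau>); one half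
    remains.\<close>
  define s where "s = \<sigma> / (2 * f * \<tau>)"
  have s: "0 < s" unfolding s_def using sigma_pos tau_pos f0 by simp
  have s_le: "s + \<epsilon> \<le> sing_val k (transpose_mat C) / ?f"
  proof -
    have e: "\<epsilon> \<le> \<sigma> / (4 * f * \<tau>)" using small tau_pos f0 by (simp add: pos_le_divide_eq)
    have "(s + \<epsilon>) * ?f \<le> (s + \<epsilon>) * f" using s eps f by (intro mult_left_mono) auto
    also have "\<dots> \<le> (s + \<sigma> / (4 * f * \<tau>)) * f" using e f0 by (intro mult_right_mono) auto
    also have "\<dots> = \<sigma> / \<tau> - \<sigma> / (4 * \<tau>)" unfolding s_def using f0 tau_pos by (simp add: field_simps)
    also have "\<dots> \<le> \<sigma> / \<tau> - \<epsilon>"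
    proof -
      have "\<sigma> / (4 * f * \<tau>) \<le> \<sigma> / (4 * \<tau>)" using sigma_pos tau_pos f0
        by (intro divide_left_mono) auto
      then show ?thesis using e by linarith
    qed
    also have "\<dots> \<le> sing_val k (transpose_mat C)" by (rule sing_val_Ct)
    finally show ?thesis using f1 by (subst pos_le_divide_eq) auto
  qed
  have ge: "s * nrm n (app k V c) \<le> L2_set (app n (tr (ent B)) (app k V c)) J" for c
  proof -
    have "(s + \<epsilon>) * nrm k c \<le> sing_val k (transpose_mat C) / ?f * nrm k c" using s_le by (rule mult_right_mono) simp
    also have "\<dots> \<le> L2_set (app n (tr (ent A)) (app k V c)) J" using V2[of c] unfolding nrm_app_Ct .
    also have "\<dots> \<le> L2_set (app n (tr (ent B)) (app k V c)) J + \<epsilon> * nrm n (app k V c)" by (rule At_J_le)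
    finally show ?thesis unfolding V1 by (simp add: algebra_simps)
  qed
  define W where "W = (\<lambda>i j. \<Sum>l<n. tr X i l * V l j)"
  have W: "app n (tr X) (app k V c) i = app k W c i" for c i unfolding W_def by (rule app_app)
  have BtX: "app n (tr (ent B)) u j = app n (tr (ent B)) u' j"
    if "\<And>i. i < k \<Longrightarrow> app n (tr X) u i = app n (tr X) u' i" "j < m" for u u' j
  proof -
    have "app k (tr Z) (app n (tr X) u) = app k (tr Z) (app n (tr X) u')"
      by (rule ext) (rule app_cong, rule that(1))
    then show ?thesis unfolding Bt_app[OF that(2)] by simp
  qed
  have "\<exists>c. \<forall>i<k. app k W c i = app n (tr X) y i"
  proof (rule injective_imp_surjective)
    fix c assume c: "\<forall>i<k. app k W c i = 0"
    have "app n (tr (ent B)) (app k V c) j = 0" if "j < m" for j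
      using BtX[OF _ that, of "app k V c" "\<lambda>_. 0"] c by (simp add: W)
    then have "L2_set (app n (tr (ent B)) (app k V c)) J = L2_set (\<lambda>_. 0) J"
      using J by (intro L2_set_cong) auto
    then have "s * nrm n (app k V c) \<le> 0" using ge[of c] by (simp add: L2_set_def)
    then have "nrm k c = 0" using s nrm_ge0[of k c] unfolding V1 by (simp add: mult_le_0_iff)
    then show "\<forall>j<k. c j = 0" unfolding nrm_eq0 .
  qed
  then obtain c where c: "\<And>i. i < k \<Longrightarrow> app n (tr X) (app k V c) i = app n (tr X) y i" unfolding W by blast
  let ?u = "app k V c"
  have Bu: "app n (tr (ent B)) ?u j = app n (tr (ent B)) y j" if "j < m" for j by (rule BtX[OF c that])
  have s10: "0 \<le> \<sigma>1" using sigma_le sigma_pos by linarith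
  have u_le: "nrm n ?u \<le> 2 * (\<sigma>1 / \<sigma>) * f * \<tau> * nrm n y"
  proof -
    have "s * nrm n ?u \<le> nrm m (app n (tr (ent B)) ?u)" using ge[of c] L2_set_le_nrm[OF J] order_trans by blast
    also have "\<dots> = nrm m (app n (tr (ent B)) y)" using Bu by (intro nrm_cong)
    also have "\<dots> \<le> \<sigma>1 * nrm n y" by (rule app_adjoint_bound[OF B_le s10])
    finally have "nrm n ?u \<le> \<sigma>1 * nrm n y / s" using s by (simp add: pos_le_divide_eq mult.commute)
    also have "\<dots> = 2 * (\<sigma>1 / \<sigma>) * f * \<tau> * nrm n y" unfolding s_def by simp
    finally show ?thesis .
  qed
  have "nrm m (\<lambda>i. app n (tr (ent A)) y i - app (card ?I) (tr (ent (sub_rows A ?I))) (\<lambda>t. ?u (pick ?I t)) i)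
      = nrm m (app n (tr (ent E)) (\<lambda>i. y i - ?u i))"
  proof (rule nrm_cong)
    fix j assume j: "j < m"
    have "app (card ?I) (tr (ent (sub_rows A ?I))) (\<lambda>t. ?u (pick ?I t)) j = app n (tr (ent A)) ?u j"
      by (rule app_tr_sub_rows[OF A I j]) (rule V0)
    then show "app n (tr (ent A)) y j - app (card ?I) (tr (ent (sub_rows A ?I))) (\<lambda>t. ?u (pick ?I t)) j
      = app n (tr (ent E)) (\<lambda>i. y i - ?u i) j"
      using At_app[OF j, of y] At_app[OF j, of ?u] Bu[OF j] by (simp add: app_diff)
  qed
  also have "\<dots> \<le> \<epsilon> * nrm n (\<lambda>i. y i - ?u i)" by (rule Et_le)
  also have "\<dots> \<le> \<epsilon> * (nrm n y + 2 * (\<sigma>1 / \<sigma>) * f * \<tau> * nrm n y)"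
    using nrm_diff[of n y ?u] u_le eps by (intro mult_left_mono) linarith+
  also have "\<dots> = \<epsilon> * (1 + 2 * (\<sigma>1 / \<sigma>) * f * \<tau>) * nrm n y" by (simp add: algebra_simps)
  finally show ?thesis by (intro exI[of _ "\<lambda>t. ?u (pick ?I t)"])
qed

text \<open>If \<epsilon> is too large for \<open>row_error\<close>, then \<sigma>, and with it
  \<open>\<sigma>1\<close>, is at most a multiple of \<epsilon>, and the trivial bound 2 (\<sigma>1
  + \<epsilon>) suffices. The coefficients 4 and 8 cover both cases.\<close>

theorem cur_error_bound:
  assumes fac: "srrqr_factorization q (transpose_mat C) \<pi> Q Ar Br Cr" and q: "k \<le> q"
    and f: "sqrt (1 + real q * (real n - real q)) \<le> f"
  shows "spectral_norm (A - C * pinv C * A * pinv (sub_rows A (\<pi> ` {0..<q})) * sub_rows A (\<pi> ` {0..<q}))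
    \<le> \<epsilon> * (4 + \<tau> + 8 * (\<sigma>1 / \<sigma>) * f * \<tau>)"
proof -
  let ?I = "\<pi> ` {0..<q}" and ?\<kappa> = "\<sigma>1 / \<sigma>"
  have I: "?I \<subseteq> {..<n}" by (rule srrqr_image(1)[OF Ct fac])
  have R: "sub_rows A ?I \<in> carrier_mat (card ?I) m" by (rule sub_rows_carrier[OF A I])
  have "q \<le> n" using srrqr_factorizationD(1)[OF Ct fac] by simp
  then have "1 \<le> sqrt (1 + real q * (real n - real q))" by simp
  then have f0: "1 \<le> f" using f by linarith
  have s10: "0 \<le> \<sigma>1" using sigma_le sigma_pos by linarith
  have kf: "0 \<le> ?\<kappa> * f * \<tau>" using s10 sigma_pos f0 tau_pos by simp
  have lin: "2 + t + 2 * x \<le> 4 + t + 8 * x" if "0 \<le> x" for t x :: real using that by simp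
  show ?thesis
  proof (cases "\<epsilon> * (4 * f * \<tau>) \<le> \<sigma>")
    case True
    have "spectral_norm (A - C * pinv C * A * pinv (sub_rows A ?I) * sub_rows A ?I)
      \<le> \<epsilon> * (1 + \<tau>) + \<epsilon> * (1 + 2 * ?\<kappa> * f * \<tau>)"
      using eps tau_pos kf
      by (intro cur_error[OF A C R column_error row_error[OF fac q f True]]) (simp_all add: mult.assoc)
    also have "\<dots> = \<epsilon> * (2 + \<tau> + 2 * (?\<kappa> * f * \<tau>))" by (simp add: algebra_simps)
    also have "\<dots> \<le> \<epsilon> * (4 + \<tau> + 8 * (?\<kappa> * f * \<tau>))" by (intro mult_left_mono lin kf eps)
    finally show ?thesis by (simp add: mult.assoc)
  next
    case False
    have A_le: "nrm n (app m (ent A) x) \<le> (\<sigma>1 + \<epsilon>) * nrm m x" for x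
    proof -
      have "nrm n (app m (ent A) x) = nrm n (\<lambda>i. app m (ent B) x i + app m (ent E) x i)"
        by (intro nrm_cong A_app)
      also have "\<dots> \<le> nrm n (app m (ent B) x) + nrm n (app m (ent E) x)" by (rule nrm_triangle)
      finally show ?thesis using B_le[of x] E_le[of x] by (simp add: distrib_right)
    qed
    have At_le: "nrm m (app n (tr (ent A)) y) \<le> (\<sigma>1 + \<epsilon>) * nrm n y" for y
      using s10 eps by (intro app_adjoint_bound[OF A_le]) simp
    have "spectral_norm (A - C * pinv C * A * pinv (sub_rows A ?I) * sub_rows A ?I) \<le> (\<sigma>1 + \<epsilon>) + (\<sigma>1 + \<epsilon>)"
    proof (rule cur_error[OF A C R])
      show "\<exists>g. nrm n (\<lambda>i. app m (ent A) x i - app (card J) (ent C) g i) \<le> (\<sigma>1 + \<epsilon>) * nrm m x" for x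
        using A_le[of x] by (intro exI[of _ "\<lambda>_. 0"]) simp
      show "\<exists>g. nrm m (\<lambda>i. app n (tr (ent A)) y i - app (card ?I) (tr (ent (sub_rows A ?I))) g i) \<le> (\<sigma>1 + \<epsilon>) * nrm n y" for y
        using At_le[of y] by (intro exI[of _ "\<lambda>_. 0"]) simp
    qed (use s10 eps in simp_all)
    also have "\<dots> = 2 * (?\<kappa> * \<sigma>) + 2 * \<epsilon>" using sigma_pos by simp
    also have "\<dots> \<le> 2 * (?\<kappa> * (\<epsilon> * (4 * f * \<tau>))) + 2 * \<epsilon>"
      using False s10 sigma_pos by (intro add_right_mono mult_left_mono) auto
    also have "\<dots> = \<epsilon> * (2 + 8 * (?\<kappa> * f * \<tau>))" by (simp add: algebra_simps)
    also have "\<dots> \<le> \<epsilon> * (4 + \<tau> + 8 * (?\<kappa> * f * \<tau>))" using eps tau_pos by (intro mult_left_mono) auto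
    finally show ?thesis by (simp add: mult.assoc)
  qed
qed

end

section \<open>Coherence and random index sets\<close>

text \<open>A maximal independent subset of the set of columns has as many elements as the rank;
  listing it without repetition gives the column indices.\<close>

lemma independent_columns_of_rank:
  fixes M :: "real mat"
  assumes M: "M \<in> carrier_mat n m" and rk: "vec_space.rank n M = k"
  shows "\<exists>s. (\<forall>t<k. s t < m) \<and> (\<forall>c. (\<forall>i<n. (\<Sum>t<k. ent M i (s t) * c t) = 0) \<longrightarrow> (\<forall>t<k. c t = 0))"
proof -
  interpret vec_space "TYPE(real)" n .
  have fin: "finite (set (cols M))" by simp
  have "\<exists>S. maximal S (\<lambda>T. T \<subseteq> set (cols M) \<and> lin_indpt T)"
    using maximal_exists[of "\<lambda>T. T \<subseteq> set (cols M) \<and> lin_indpt T" "card (set (cols M))" "{}"]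
    by (simp add: card_mono finite_subset[OF _ fin] lin_dep_def) blast
  then obtain S where S: "maximal S (\<lambda>T. T \<subseteq> set (cols M) \<and> lin_indpt T)" by blast
  then have S': "S \<subseteq> set (cols M)" "lin_indpt S" unfolding maximal_def by auto
  have cardS: "card S = k" using rank_card_indpt[OF M S] rk by simp
  have finS: "finite S" using S'(1) fin finite_subset by blast
  then obtain vs where vs: "set vs = S" "distinct vs" using finite_distinct_list by blast
  then have len: "length vs = k" using cardS distinct_card by force
  have "\<exists>j<m. vs ! t = Matrix.col M j" if "t < k" for t
  proof -
    have "vs ! t \<in> set (cols M)" using that vs(1) S'(1) len nth_mem by blast
    then show ?thesis using M unfolding cols_def by auto
  qed
  then obtain s where s: "\<And>t. t < k \<Longrightarrow> s t < m \<and> vs ! t = Matrix.col M (s t)" by metis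
  define N where "N = mat_of_cols n vs"
  have N: "N \<in> carrier_mat n k" unfolding N_def using len by auto
  have vsc: "set vs \<subseteq> carrier_vec n" using vs(1) S'(1) cols_dim[of M] M by auto
  have colsN: "cols N = vs" unfolding N_def by (rule cols_mat_of_cols[OF vsc])
  have "c t = 0" if z: "\<forall>i<n. (\<Sum>t<k. ent M i (s t) * c t) = 0" and t: "t < k" for c t
  proof (rule ccontr)
    assume "c t \<noteq> 0"
    let ?v = "Matrix.vec k c"
    have v: "?v \<in> carrier_vec k" "?v \<noteq> 0\<^sub>v k" using \<open>c t \<noteq> 0\<close> t by (auto dest: arg_cong[of _ _ "\<lambda>v. v $ t"])
    have "N *\<^sub>v ?v = 0\<^sub>v n"
    proof (rule eq_vecI)
      fix i assume "i < dim_vec (0\<^sub>v n :: real Matrix.vec)"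
      then have i: "i < n" by simp
      have "(N *\<^sub>v ?v) $ i = (\<Sum>t<k. N $$ (i,t) * c t)" using N i by (simp add: scalar_prod_def lessThan_atLeast0)
      also have "\<dots> = (\<Sum>t<k. ent M i (s t) * c t)"
      proof (intro sum.cong refl arg_cong2[of _ _ _ _ "(*)"])
        fix t assume "t \<in> {..<k}"
        then show "N $$ (i,t) = ent M i (s t)"
          using s[of t] i len M unfolding N_def ent_def by (simp add: mat_of_cols_index)
      qed
      finally show "(N *\<^sub>v ?v) $ i = (0\<^sub>v n :: real Matrix.vec) $ i" using z i by simp
    qed (use N in simp)
    then have "lin_dep (set (cols N))" by (rule lin_depI[OF N v]) (simp add: colsN vs(2))
    then show False using S'(2) vs(1) colsN by simp
  qed
  then show ?thesis using s by (intro exI[of _ s]) blast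
qed

text \<open>Restricted to k independent columns \<open>M\<close> is injective, and the second claim
  of \<open>sing_val_ge\<close> applies to the matrix \<open>N\<close> that selects them.\<close>

lemma sing_val_rank_pos:
  fixes M :: "real mat"
  assumes M: "M \<in> carrier_mat n m" and rk: "vec_space.rank n M = k" and k: "1 \<le> k"
  shows "k \<le> n" "k \<le> m" "0 < sing_val k M"
proof -
  obtain s where s: "\<forall>t<k. s t < m"
    "\<forall>c. (\<forall>i<n. (\<Sum>t<k. ent M i (s t) * c t) = 0) \<longrightarrow> (\<forall>t<k. c t = 0)"
    using independent_columns_of_rank[OF M rk] by (elim exE conjE) (rule that)
  define N where "N j t = (if j = s t then 1 else 0 :: real)" for j t
  have MN: "app m (ent M) (app k N c) i = (\<Sum>t<k. ent M i (s t) * c t)" for c i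
  proof -
    have "app m (ent M) (app k N c) i = (\<Sum>t<k. (\<Sum>l<m. if l = s t then ent M i l else 0) * c t)"
      unfolding app_app unfolding app_def N_def by (intro sum.cong refl arg_cong2[of _ _ _ _ "(*)"]) auto
    also have "\<dots> = (\<Sum>t<k. ent M i (s t) * c t)" using s(1) by (intro sum.cong refl) auto
    finally show ?thesis .
  qed
  show kn: "k \<le> n"
  proof (rule ccontr)
    assume "\<not> k \<le> n"
    then obtain c where c: "\<exists>j<k. c j \<noteq> 0" "\<forall>i<n. app k (\<lambda>i t. ent M i (s t)) c i = 0"
      using underdetermined_kernel[of n k "\<lambda>i t. ent M i (s t)"] by auto
    then show False using s(2) unfolding app_def by blast
  qed
  show km: "k \<le> m" using vec_space.rank_le_nc[OF M] rk by simp
  have inj: "nrm k c = 0" if "nrm n (app m (ent M) (app k N c)) = 0" for c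
    using that s(2) unfolding nrm_eq0 MN by blast
  show "0 < sing_val k M"
  proof (rule sing_val_ge(2)[OF M k, where N = N and s = 0])
    show "k \<le> min n m" using kn km by simp
    show "nrm k c = 0" if "nrm m (app k N c) = 0" for c
    proof (rule inj)
      have "nrm n (app m (ent M) (app k N c)) = nrm n (app m (ent M) (\<lambda>_. 0))"
        using that unfolding nrm_eq0 by (intro nrm_cong app_cong) simp
      then show "nrm n (app m (ent M) (app k N c)) = 0" by (simp add: nrm_eq0)
    qed
  qed (use inj in auto)
qed

section \<open>Block matrices and coherence\<close>

lemma hcat2:
  assumes "X1 \<in> carrier_mat n a" "X2 \<in> carrier_mat n b"
  shows "hcat n [X1, X2] \<in> carrier_mat n (a + b)"
    "i < n \<Longrightarrow> j < a \<Longrightarrow> ent (hcat n [X1, X2]) i j = ent X1 i j"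
    "i < n \<Longrightarrow> j < b \<Longrightarrow> ent (hcat n [X1, X2]) i (a + j) = ent X2 i j"
  using assms unfolding hcat_def ent_def by (auto simp: mat_of_cols_index nth_append)

lemma hcat3:
  assumes "X1 \<in> carrier_mat n a" "X2 \<in> carrier_mat n b" "X3 \<in> carrier_mat n c"
  shows "hcat n [X1, X2, X3] \<in> carrier_mat n (a + b + c)"
    "i < n \<Longrightarrow> j < a \<Longrightarrow> ent (hcat n [X1, X2, X3]) i j = ent X1 i j"
    "i < n \<Longrightarrow> j < b \<Longrightarrow> ent (hcat n [X1, X2, X3]) i (a + j) = ent X2 i j"
    "i < n \<Longrightarrow> j < c \<Longrightarrow> ent (hcat n [X1, X2, X3]) i (a + b + j) = ent X3 i j"
  using assms unfolding hcat_def ent_def by (auto simp: mat_of_cols_index nth_append)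

lemma diag_block3:
  assumes "Z1 \<in> carrier_mat a a" "Z2 \<in> carrier_mat b b" "Z3 \<in> carrier_mat c c"
  shows "diag_block_mat [Z1, Z2, Z3] \<in> carrier_mat (a + b + c) (a + b + c)"
    "i < a + b + c \<Longrightarrow> j < a + b + c \<Longrightarrow> (i < a + b) \<noteq> (j < a + b) \<Longrightarrow> ent (diag_block_mat [Z1, Z2, Z3 :: real mat]) i j = 0"
  using assms unfolding ent_def by (auto simp: Let_def)

lemma orthonormal_cols_sum:
  assumes "U \<in> carrier_mat n a" "orthonormal_cols U" "i < a" "j < a"
  shows "(\<Sum>l<n. ent U l i * ent U l j) = (if i = j then 1 else 0)"
proof -
  have "(transpose_mat U * U) $$ (i,j) = (1\<^sub>m a :: real mat) $$ (i,j)"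
    using assms(1,2) unfolding orthonormal_cols_def by simp
  then show ?thesis using assms by (simp add: ent_def scalar_prod_def lessThan_atLeast0)
qed

lemma nrm_app_orthonormal:
  assumes "U \<in> carrier_mat n a" "orthonormal_cols U"
  shows "nrm n (app a (ent U) z) = nrm a z"
  unfolding nrm_def by (subst app_orthonormal[of a]) (auto simp: orthonormal_cols_sum[OF assms])

lemma coherent_entry:
  assumes U: "U \<in> carrier_mat n a" and coh: "coherent \<mu> U" and ij: "i < n" "j < a"
  shows "(ent U i j)\<^sup>2 \<le> \<mu> / n"
proof -
  have "\<mu> = real n * (max_norm U)\<^sup>2" using U coh ij unfolding coherent_def by auto
  moreover have "(ent U i j)\<^sup>2 \<le> (max_norm U)\<^sup>2"
    using power_mono[OF max_norm_ge[of i U j], of 2] U ij unfolding ent_def by simp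
  ultimately show ?thesis using ij by (simp add: field_simps)
qed

text \<open>The squares in a unit column sum to 1, and each of the n squares is at most \<mu> /
  n.\<close>

lemma coherent_ge_1:
  assumes U: "U \<in> carrier_mat n a" and coh: "coherent \<mu> U" and a: "0 < a"
  shows "1 \<le> \<mu>"
proof -
  have "1 = (\<Sum>l<n. (ent U l 0)\<^sup>2)"
    using orthonormal_cols_sum[OF U, of 0 0] coh a unfolding coherent_def by (simp add: power2_eq_square)
  also have "\<dots> \<le> (\<Sum>l<n. \<mu> / n)" using coherent_entry[OF U coh _ a] by (intro sum_mono) auto
  also have "\<dots> \<le> \<mu>"
  proof -
    have "0 \<le> \<mu>" using coh U a unfolding coherent_def by auto
    then show ?thesis by simp
  qed
  finally show ?thesis .
qed

section \<open>Uniformly random index sets\<close>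

lemma finite_subsets [simp]: "finite {I. I \<subseteq> {0..<n::nat} \<and> card I = l}"
  by (rule finite_subset[of _ "Pow {0..<n}"]) auto

lemma card_subsets: "card {I. I \<subseteq> {0..<n::nat} \<and> card I = l} = n choose l"
  using n_subsets[of "{0..<n}" l] by simp

lemma subsets_nonempty: "l \<le> n \<Longrightarrow> {I. I \<subseteq> {0..<n::nat} \<and> card I = l} \<noteq> {}"
  using card_subsets[of n l] by (metis binomial_eq_0_iff card.empty not_less)

lemma prob_random_subset:
  assumes "l \<le> n"
  shows "measure_pmf.prob (random_subset n l) S = card ({I. I \<subseteq> {0..<n} \<and> card I = l} \<inter> S) / (n choose l)"
  unfolding random_subset_def using measure_pmf_of_set[OF subsets_nonempty[OF assms] finite_subsets] card_subsets
  by simp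

lemma set_random_subset: "l \<le> n \<Longrightarrow> set_pmf (random_subset n l) = {I. I \<subseteq> {0..<n} \<and> card I = l}"
  unfolding random_subset_def using subsets_nonempty by (intro set_pmf_of_set) auto

text \<open>The l-sets that contain i are counted by (n - 1) choose (l - 1), a fraction l / n of all
  l-sets.\<close>

lemma prob_random_subset_mem:
  assumes l: "l \<le> n" and i: "i < n"
  shows "measure_pmf.prob (random_subset n l) {I. i \<in> I} \<le> l / n"
proof (cases l)
  case 0
  have "{I. I \<subseteq> {0..<n} \<and> card I = 0} \<inter> {I. i \<in> I} = {}"
    by (auto simp: card_eq_0_iff dest: finite_subset[OF _ finite_atLeastLessThan])
  then show ?thesis unfolding prob_random_subset[OF l] unfolding 0 by simp
next
  case (Suc l')
  let ?K = "{K. K \<subseteq> {0..<n} - {i} \<and> card K = l'}"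
  have "{I. I \<subseteq> {0..<n} \<and> card I = l} \<inter> {I. i \<in> I} \<subseteq> insert i ` ?K"
  proof
    fix I assume I: "I \<in> {I. I \<subseteq> {0..<n} \<and> card I = l} \<inter> {I. i \<in> I}"
    then have "finite I" using finite_subset by blast
    then have "card (I - {i}) = l'" "insert i (I - {i}) = I" using I Suc by auto
    then show "I \<in> insert i ` ?K" using I by (intro image_eqI[of _ _ "I - {i}"]) auto
  qed
  then have "card ({I. I \<subseteq> {0..<n} \<and> card I = l} \<inter> {I. i \<in> I}) \<le> card (insert i ` ?K)"
    by (intro card_mono finite_imageI finite_subset[of ?K "Pow {0..<n}"]) auto
  also have "\<dots> \<le> card ?K" by (intro card_image_le finite_subset[of ?K "Pow {0..<n}"]) auto
  also have "\<dots> = (n - 1) choose l'" using n_subsets[of "{0..<n} - {i}" l'] i by simp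
  finally have "real (card ({I. I \<subseteq> {0..<n} \<and> card I = l} \<inter> {I. i \<in> I})) \<le> real ((n - 1) choose l')" by simp
  moreover have "real n * real ((n - 1) choose l') = real l * real (n choose l)"
    using binomial_absorption[of l' n] Suc by (metis of_nat_mult)
  moreover have "0 < real (n choose l)" using l by simp
  ultimately have "real n * real (card ({I. I \<subseteq> {0..<n} \<and> card I = l} \<inter> {I. i \<in> I})) \<le> real l * real (n choose l)"
    by (metis mult_left_mono of_nat_0_le_iff)
  with \<open>0 < real (n choose l)\<close> show ?thesis unfolding prob_random_subset[OF l] using i
    by (simp add: pos_divide_le_eq pos_le_divide_eq mult.commute)
qed

lemma prob_random_subset_hit:
  assumes l: "l \<le> n" and W: "W \<subseteq> {..<n}"
  shows "measure_pmf.prob (random_subset n l) {I. I \<inter> W \<noteq> {}} \<le> card W * (l / n)"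
proof -
  have fin: "finite W" using W finite_subset by blast
  have "measure_pmf.prob (random_subset n l) {I. I \<inter> W \<noteq> {}} = measure_pmf.prob (random_subset n l) (\<Union>i\<in>W. {I. i \<in> I})"
    by (intro arg_cong[of _ _ "measure_pmf.prob _"]) auto
  also have "\<dots> \<le> (\<Sum>i\<in>W. measure_pmf.prob (random_subset n l) {I. i \<in> I})"
    using fin by (intro measure_pmf.finite_measure_subadditive_finite) auto
  also have "\<dots> \<le> (\<Sum>i\<in>W. l / n)" using W prob_random_subset_mem[OF l] by (intro sum_mono) auto
  finally show ?thesis by simp
qed

text \<open>By coherence every row of \<open>U\<close> has squared norm at most L = a \<mu> / n, so
  the prescribed sample size is l = \<alpha> L n, as the tail bound requires.\<close>

lemma prob_random_subset_coherent:
  assumes U: "U \<in> carrier_mat n a" and coh: "coherent \<mu> U" and n: "0 < n"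
    and l: "l \<le> n" "real l = \<alpha> * \<mu> * a" and \<alpha>: "1 \<le> \<alpha>"
  shows "measure_pmf.prob (random_subset n l) {I. \<exists>x. L2_set (app a (ent U) x) I < sqrt (l / (8 * n)) * nrm a x}
    \<le> a * exp (- \<alpha> / 20)"
proof -
  let ?B = "{I. I \<subseteq> {..<n} \<and> card I = l \<and> (\<exists>x. (\<Sum>i\<in>I. (app a (ent U) x i)\<^sup>2) < real l / (8 * real n) * ip a x x)}"
  have mu0: "0 \<le> a * \<mu>"
    using coherent_ge_1[OF U coh] by (cases "a = 0") auto
  have "real (card ?B) \<le> (n choose l) * (a * exp (- \<alpha> / 20))"
  proof (rule sampled_rows_lower_tail)
    show "(\<Sum>i<n. ent U i t * ent U i t') = (if t = t' then 1 else 0)" if "t < a" "t' < a" for t t'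
      using orthonormal_cols_sum[OF U _ that] coh unfolding coherent_def by blast
    show "(\<Sum>t<a. (ent U i t)\<^sup>2) \<le> a * \<mu> / n" if "i < n" for i
    proof -
      have "(\<Sum>t<a. (ent U i t)\<^sup>2) \<le> (\<Sum>t<a. \<mu> / n)" by (intro sum_mono coherent_entry[OF U coh that]) simp
      then show ?thesis by simp
    qed
    show "0 \<le> a * \<mu> / n" using mu0 by simp
    show "real l = \<alpha> * (a * \<mu> / n) * n" using l(2) n by simp
  qed (use l \<alpha> in auto)
  moreover have "{I. I \<subseteq> {0..<n} \<and> card I = l} \<inter> {I. \<exists>x. L2_set (app a (ent U) x) I < sqrt (l / (8 * n)) * nrm a x} = ?B"
  proof -
    have "L2_set (app a (ent U) x) I < sqrt (l / (8 * n)) * nrm a x \<longleftrightarrow> (\<Sum>i\<in>I. (app a (ent U) x i)\<^sup>2) < real l / (8 * real n) * ip a x x" for x I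
      unfolding L2_set_def nrm_def real_sqrt_mult[symmetric] by simp
    then show ?thesis by (auto simp: lessThan_atLeast0)
  qed
  moreover have "0 < real (n choose l)" using l by simp
  ultimately show ?thesis unfolding prob_random_subset[OF l(1)] by (simp add: divide_le_eq mult_ac)
qed

text \<open>Drawing 0 new rows yields the empty set, so all randomness is in an independent pair,
  the form to which \<open>prob_pair_ge\<close> applies.\<close>

lemma srrqr_iteration_no_new_rows:
  "srrqr_iteration S A l0 a b c 0 = map_pmf
     (\<lambda>(I0, Jn). let J1 = srrqr_select S a (sub_rows A I0) \<union> Jn
        in (srrqr_select S c (transpose_mat (sub_cols A J1)), J1))
     (pair_pmf (random_subset (dim_row A) l0) (random_subset (dim_col A) b))"
proof -
  have "{I. I \<subseteq> {0..<dim_row A} \<and> card I = 0} = {{}}"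
    by (auto simp: card_eq_0_iff dest: finite_subset[OF _ finite_atLeastLessThan])
  then have "random_subset (dim_row A) 0 = return_pmf {}"
    unfolding random_subset_def by (simp add: pmf_of_set_singleton)
  then show ?thesis
    unfolding srrqr_iteration_def pair_pmf_def map_bind_pmf
    by (simp add: bind_return_pmf Let_def map_pmf_def bind_assoc_pmf)
qed

lemma prob_pair_ge:
  assumes good: "\<And>x y. x \<in> set_pmf p \<Longrightarrow> y \<in> set_pmf q \<Longrightarrow> x \<notin> B1 \<Longrightarrow> y \<notin> B2 \<Longrightarrow> h (x, y) \<in> T"
  shows "1 - (measure_pmf.prob p B1 + measure_pmf.prob q B2) \<le> measure_pmf.prob (map_pmf h (pair_pmf p q)) T"
proof -
  let ?r = "pair_pmf p q"
  have 1: "measure_pmf.prob p B1 = measure_pmf.prob ?r (fst -` B1)"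
    using measure_map_pmf[of fst ?r B1] by (simp add: map_fst_pair_pmf)
  have 2: "measure_pmf.prob q B2 = measure_pmf.prob ?r (snd -` B2)"
    using measure_map_pmf[of snd ?r B2] by (simp add: map_snd_pair_pmf)
  have "measure_pmf.prob ?r (- (h -` T)) = measure_pmf.prob ?r (- (h -` T) \<inter> set_pmf ?r)"
    by (rule measure_Int_set_pmf[symmetric])
  also have "\<dots> \<le> measure_pmf.prob ?r (fst -` B1 \<union> snd -` B2)"
    using good by (intro measure_pmf.finite_measure_mono) auto
  also have "\<dots> \<le> measure_pmf.prob ?r (fst -` B1) + measure_pmf.prob ?r (snd -` B2)"
    by (intro measure_Un_le) auto
  finally have "measure_pmf.prob ?r (- (h -` T)) \<le> measure_pmf.prob p B1 + measure_pmf.prob q B2"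
    unfolding 1 2 .
  moreover have "measure_pmf.prob ?r (- (h -` T)) = 1 - measure_pmf.prob ?r (h -` T)"
    using measure_pmf.prob_compl[of "h -` T" ?r] by (simp add: Compl_eq_Diff_UNIV)
  ultimately show ?thesis by (simp add: measure_map_pmf)
qed

lemma orthonormal_adjoint_le:
  assumes "U \<in> carrier_mat n a" "orthonormal_cols U"
  shows "nrm a (app n (tr (ent U)) y) \<le> nrm n y"
  using app_adjoint_bound[of n a "ent U" 1 y] nrm_app_orthonormal[OF assms] by simp

lemma L2_set_Un_disjoint_le:
  assumes "finite P" "finite R" "P \<inter> R = {}"
  shows "L2_set f (P \<union> R) \<le> L2_set f P + L2_set f R"
  unfolding L2_set_def sum.union_disjoint[OF assms]
  by (intro sqrt_add_le_add_sqrt sum_nonneg) auto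

lemma L2_set_reindex: "bij_betw \<phi> {..<a} K \<Longrightarrow> L2_set f K = nrm a (\<lambda>s. f (\<phi> s))"
  unfolding nrm_L2 L2_set_def using sum.reindex_bij_betw[of \<phi> "{..<a}" K "\<lambda>t. (f t)\<^sup>2"] by simp

section \<open>One iteration of the algorithm\<close>

text \<open>Here \<open>l1\<close> is the number of new columns. The theorem assumes only \<alpha> >
  0; that \<alpha> \<ge> 1 and \<open>sparse_small\<close> hold may be supposed because its
  probability bound is at most 0 otherwise.\<close>

locale cur_problem =
  fixes n m k k1 k2 k3 :: nat and A E X X1 X2 X3 Y Y1 Y2 Y3 Z Z1 Z2 Z3 :: "real mat"
    and \<epsilon> \<mu> \<alpha> :: real and \<beta> l0 l1 l :: nat and S :: "nat \<Rightarrow> real mat \<Rightarrow> nat set"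
  assumes k_pos: "0 < k" and k_eq: "k = k1 + k2 + k3"
    and X1: "X1 \<in> carrier_mat n k1" and X2: "X2 \<in> carrier_mat n k2" and X3: "X3 \<in> carrier_mat n k3"
    and Y1: "Y1 \<in> carrier_mat m k1" and Y2: "Y2 \<in> carrier_mat m k2" and Y3: "Y3 \<in> carrier_mat m k3"
    and Z1: "Z1 \<in> carrier_mat k1 k1" and Z2: "Z2 \<in> carrier_mat k2 k2" and Z3: "Z3 \<in> carrier_mat k3 k3"
    and E: "E \<in> carrier_mat n m"
    and X_def: "X = hcat n [X1, X2, X3]" and Y_def: "Y = hcat m [Y1, Y2, Y3]"
    and Z_def: "Z = diag_block_mat [Z1, Z2, Z3]"
    and A_def: "A = X * Z * transpose_mat Y + E"
    and rank: "vec_space.rank n (X * Z * transpose_mat Y) = k"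
    and E_norm: "spectral_norm E \<le> \<epsilon>"
    and cohX: "coherent \<mu> (hcat n [X1, X2])" and cohY: "coherent \<mu> (hcat m [Y1, Y3])"
    and orthX3: "orthonormal_cols X3" and sparseX3: "sparse_cols \<beta> X3"
    and orthY2: "orthonormal_cols Y2" and sparseY2: "sparse_cols \<beta> Y2"
    and \<alpha>: "1 \<le> \<alpha>"
    and l0: "real l0 = \<alpha> * \<mu> * real (k1 + k2)" "l0 \<le> n"
    and l1: "real l1 = \<alpha> * \<mu> * real (k1 + k3)" "l1 \<le> m"
    and l: "l = max l0 (max (k1 + k2) l1)"
    and eps_small: "\<epsilon> * sqrt (real n * real m * real k / real l)
        \<le> 1 / 144 * sing_val k (X * Z * transpose_mat Y)"
    and S: "srrqr_selection S"
    and sparse_small: "real k * (real \<beta> * real l) \<le> real m"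
begin

abbreviation "r \<equiv> k1 + k2"
abbreviation "k13 \<equiv> k1 + k3"
abbreviation "B \<equiv> X * Z * transpose_mat Y"
abbreviation "X12 \<equiv> hcat n [X1, X2]"
abbreviation "Y13 \<equiv> hcat m [Y1, Y3]"
abbreviation "K2 \<equiv> {k1..<r}"
abbreviation "K13 \<equiv> {..<k} - {k1..<r}"
text \<open>Embeds the columns of \<open>[Y1 Y3]\<close> into those of \<open>Y\<close> by skipping
  block 2. The corresponding blocks 1 and 2 of \<open>X\<close> are adjacent.\<close>

abbreviation "\<phi> \<equiv> \<lambda>s. if s < k1 then s else s + k2"

definition X3_rows :: "nat set" where "X3_rows = {i. i < n \<and> (\<exists>j<k3. ent X3 i j \<noteq> 0)}"
definition Y2_rows :: "nat set" where "Y2_rows = {i. i < m \<and> (\<exists>j<k2. ent Y2 i j \<noteq> 0)}"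

lemmas X12 = hcat2[OF X1 X2]
lemmas Y13 = hcat2[OF Y1 Y3]

lemma X: "X \<in> carrier_mat n k" unfolding X_def k_eq by (rule hcat3[OF X1 X2 X3])
lemma Y: "Y \<in> carrier_mat m k" unfolding Y_def k_eq by (rule hcat3[OF Y1 Y2 Y3])
lemma Z: "Z \<in> carrier_mat k k" unfolding Z_def k_eq by (rule diag_block3[OF Z1 Z2 Z3])
lemma B: "B \<in> carrier_mat n m" using X Y Z by simp
lemma A: "A \<in> carrier_mat n m" unfolding A_def using B E by simp

lemma orthX12: "orthonormal_cols X12" and orthY13: "orthonormal_cols Y13"
  using cohX cohY unfolding coherent_def by auto

lemma X_ent12: "i < n \<Longrightarrow> j < r \<Longrightarrow> ent X i j = ent X12 i j"
proof -
  assume ij: "i < n" "j < r"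
  show ?thesis
  proof (cases "j < k1")
    case True
    then show ?thesis using ij X12(2) hcat3(2)[OF X1 X2 X3] unfolding X_def by simp
  next
    case False
    then have "j - k1 < k2" "k1 + (j - k1) = j" using ij by auto
    then show ?thesis using ij X12(3)[of i "j - k1"] hcat3(3)[OF X1 X2 X3, of i "j - k1"] unfolding X_def by simp
  qed
qed

lemma X_ent3: "i < n \<Longrightarrow> j < k3 \<Longrightarrow> ent X i (r + j) = ent X3 i j"
  unfolding X_def by (rule hcat3(4)[OF X1 X2 X3])

lemma Y_ent2: "i < m \<Longrightarrow> j < k2 \<Longrightarrow> ent Y i (k1 + j) = ent Y2 i j"
  unfolding Y_def by (rule hcat3(3)[OF Y1 Y2 Y3])

lemma Y_ent13: "i < m \<Longrightarrow> s < k13 \<Longrightarrow> ent Y i (\<phi> s) = ent Y13 i s"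
proof -
  assume ij: "i < m" "s < k13"
  show ?thesis
  proof (cases "s < k1")
    case True
    then show ?thesis using ij Y13(2) hcat3(2)[OF Y1 Y2 Y3] unfolding Y_def by simp
  next
    case False
    then have "s - k1 < k3" "k1 + (s - k1) = s" "k1 + k2 + (s - k1) = s + k2" using ij by auto
    then show ?thesis using False ij Y13(3)[of i "s - k1"] hcat3(4)[OF Y1 Y2 Y3, of i "s - k1"] unfolding Y_def by (simp add: add.commute)
  qed
qed

lemma bij_phi: "bij_betw \<phi> {..<k13} K13"
proof (rule bij_betw_imageI)
  show "inj_on \<phi> {..<k13}" by (intro inj_onI) (auto split: if_splits)
  show "\<phi> ` {..<k13} = K13"
  proof
    show "\<phi> ` {..<k13} \<subseteq> K13" using k_eq by auto
    show "K13 \<subseteq> \<phi> ` {..<k13}"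
    proof
      fix t assume t: "t \<in> K13"
      show "t \<in> \<phi> ` {..<k13}"
      proof (cases "t < k1")
        case True
        then show ?thesis by (intro image_eqI[of _ _ t]) auto
      next
        case False
        then have "r \<le> t" "t < k" using t by auto
        then show ?thesis using k_eq by (intro image_eqI[of _ _ "t - k2"]) auto
      qed
    qed
  qed
qed

lemma bij_shift: "bij_betw (\<lambda>s. k1 + s) {..<k2} K2"
  by (rule bij_betw_byWitness[of _ "\<lambda>t. t - k1"]) auto

lemma Yt13: "s < k13 \<Longrightarrow> app m (tr (ent Y)) x (\<phi> s) = app m (tr (ent Y13)) x s"
  unfolding app_def tr_def using Y_ent13 by (intro sum.cong refl) simp

lemma Yt2: "s < k2 \<Longrightarrow> app m (tr (ent Y)) x (k1 + s) = app m (tr (ent Y2)) x s"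
  unfolding app_def tr_def using Y_ent2 by (intro sum.cong refl) simp

lemma L2_Yt13: "L2_set (app m (tr (ent Y)) x) K13 = nrm k13 (app m (tr (ent Y13)) x)"
  unfolding L2_set_reindex[OF bij_phi] by (intro nrm_cong Yt13)

lemma L2_Yt2: "L2_set (app m (tr (ent Y)) x) K2 = nrm k2 (app m (tr (ent Y2)) x)"
  unfolding L2_set_reindex[OF bij_shift] by (intro nrm_cong Yt2)

lemma L2_Yt13_le: "L2_set (app m (tr (ent Y)) x) K13 \<le> nrm m x"
  unfolding L2_Yt13 by (rule orthonormal_adjoint_le[OF Y13(1) orthY13])

lemma L2_Yt2_le: "L2_set (app m (tr (ent Y)) x) K2 \<le> nrm m x"
  unfolding L2_Yt2 by (rule orthonormal_adjoint_le[OF Y2 orthY2])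

lemma K_union: "K2 \<union> K13 = {..<k}" using k_eq by auto

lemma Yt_le: "nrm k (app m (tr (ent Y)) x) \<le> 2 * nrm m x"
proof -
  have "L2_set (app m (tr (ent Y)) x) (K2 \<union> K13) \<le> L2_set (app m (tr (ent Y)) x) K2 + L2_set (app m (tr (ent Y)) x) K13"
    by (rule L2_set_Un_disjoint_le) auto
  then show ?thesis unfolding K_union nrm_L2[symmetric] using L2_Yt13_le[of x] L2_Yt2_le[of x] by linarith
qed

text \<open>Blocks 1 and 2 together have orthonormal columns, and so has block 3, but the two groups
  may be correlated; each contributes at most |y|.\<close>

lemma Xt_le: "nrm k (app n (tr (ent X)) y) \<le> 2 * nrm n y"
proof -
  let ?f = "app n (tr (ent X)) y"
  have u: "{..<r} \<union> {r..<k} = {..<k}" using k_eq by auto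
  have "L2_set ?f ({..<r} \<union> {r..<k}) \<le> L2_set ?f {..<r} + L2_set ?f {r..<k}"
    by (rule L2_set_Un_disjoint_le) auto
  moreover have "L2_set ?f {..<r} \<le> nrm n y"
  proof -
    have "L2_set ?f {..<r} = nrm r (app n (tr (ent X12)) y)"
      unfolding nrm_L2 by (intro L2_set_cong refl) (simp add: app_def tr_def X_ent12)
    then show ?thesis using orthonormal_adjoint_le[OF X12(1) orthX12, of y] by simp
  qed
  moreover have "L2_set ?f {r..<k} \<le> nrm n y"
  proof -
    have "bij_betw (\<lambda>s. r + s) {..<k3} {r..<k}"
      using k_eq by (intro bij_betw_byWitness[of _ "\<lambda>t. t - r"]) auto
    from L2_set_reindex[OF this, of ?f]
    have "L2_set ?f {r..<k} = nrm k3 (\<lambda>s. ?f (r + s))" .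
    also have "\<dots> = nrm k3 (app n (tr (ent X3)) y)"
      by (intro nrm_cong) (simp add: app_def tr_def X_ent3)
    also have "\<dots> \<le> nrm n y" by (rule orthonormal_adjoint_le[OF X3 orthX3])
    finally show ?thesis .
  qed
  ultimately show ?thesis unfolding u nrm_L2[symmetric] by linarith
qed

lemma X_le: "nrm n (app k (ent X) z) \<le> 2 * nrm k z"
  using app_adjoint_bound[of k n "tr (ent X)" 2 z] Xt_le by simp

lemma eps_ge0: "0 \<le> \<epsilon>" using spectral_norm_ge0[of E] E_norm by linarith

lemma E_le: "nrm n (app m (ent E) x) \<le> \<epsilon> * nrm m x"
proof -
  have "nrm n (app m (ent E) x) \<le> spectral_norm E * nrm m x" by (rule norm_le_spectral_norm[OF E])
  also have "\<dots> \<le> \<epsilon> * nrm m x" by (rule mult_right_mono[OF E_norm]) simp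
  finally show ?thesis .
qed

lemma one_le_k: "1 \<le> k" using k_pos by simp

lemmas rank_facts = sing_val_rank_pos[OF B rank one_le_k]

lemma B_app: "i < n \<Longrightarrow> app m (ent B) x i = app k (ent X) (app k (ent Z) (app m (tr (ent Y)) x)) i"
proof -
  assume i: "i < n"
  have XZ: "X * Z \<in> carrier_mat n k" using X Z by simp
  have YT: "transpose_mat Y \<in> carrier_mat k m" using Y by simp
  have "app m (ent B) x i = app k (ent (X * Z)) (app m (ent (transpose_mat Y)) x) i"
    by (rule app_mult_mat[OF XZ YT i])
  also have "\<dots> = app k (ent X) (app k (ent Z) (app m (ent (transpose_mat Y)) x)) i"
    by (rule app_mult_mat[OF X Z i])
  also have "app k (ent Z) (app m (ent (transpose_mat Y)) x) = app k (ent Z) (app m (tr (ent Y)) x)"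
    by (rule ext) (rule app_cong, rule app_transpose_mat[OF Y])
  finally show ?thesis .
qed

lemma Bt_app: "j < m \<Longrightarrow> app n (tr (ent B)) y j = app k (ent Y) (app k (tr (ent Z)) (app n (tr (ent X)) y)) j"
proof -
  assume j: "j < m"
  have XZ: "X * Z \<in> carrier_mat n k" using X Z by simp
  have YT: "transpose_mat Y \<in> carrier_mat k m" using Y by simp
  have BT: "transpose_mat B = Y * transpose_mat (X * Z)" using transpose_mult[OF XZ YT] by simp
  have ZX: "transpose_mat (X * Z) = transpose_mat Z * transpose_mat X" by (rule transpose_mult[OF X Z])
  have XT: "transpose_mat X \<in> carrier_mat k n" and ZT: "transpose_mat Z \<in> carrier_mat k k" using X Z by auto
  have "app n (tr (ent B)) y j = app n (ent (transpose_mat B)) y j" by (rule app_transpose_mat[OF B j, symmetric])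
  also have "\<dots> = app k (ent Y) (app n (ent (transpose_mat (X * Z))) y) j"
    unfolding BT using XZ by (intro app_mult_mat[OF Y _ j]) simp
  also have "\<dots> = app k (ent Y) (app k (tr (ent Z)) (app n (tr (ent X)) y)) j"
  proof (rule app_cong)
    fix t assume t: "t < k"
    have "app n (ent (transpose_mat (X * Z))) y t = app k (ent (transpose_mat Z)) (app n (ent (transpose_mat X)) y) t"
      unfolding ZX by (rule app_mult_mat[OF ZT XT t])
    also have "\<dots> = app k (tr (ent Z)) (app n (ent (transpose_mat X)) y) t" by (rule app_transpose_mat[OF Z t])
    also have "\<dots> = app k (tr (ent Z)) (app n (tr (ent X)) y) t" by (rule app_cong) (rule app_transpose_mat[OF X])
    finally show "app n (ent (transpose_mat (X * Z))) y t = app k (tr (ent Z)) (app n (tr (ent X)) y) t" .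
  qed
  finally show ?thesis .
qed

sublocale low_rank_block n m k r k1 "ent X" "ent Y" "ent Z" A B E \<epsilon>
proof
  show "app m (ent B) x i = app k (ent X) (app k (ent Z) (app m (tr (ent Y)) x)) i" if "i < n" for x i
    by (rule B_app[OF that])
  show "app n (tr (ent B)) y j = app k (ent Y) (app k (tr (ent Z)) (app n (tr (ent X)) y)) j" if "j < m" for y j
    by (rule Bt_app[OF that])
  show "ent Z i j = 0" if "i < k" "j < k" "(i < r) \<noteq> (j < r)" for i j
    using diag_block3(2)[OF Z1 Z2 Z3, of i j] that unfolding Z_def k_eq by blast
  show "r \<le> k" using k_eq by simp
qed (fact A B E A_def E_le eps_ge0 X_le Yt_le one_le_k rank_facts | simp)+

lemma mu_ge1: "1 \<le> \<mu>"
\<comment> \<open>An empty \<open>X12\<close> is coherent for every \<mu>; as k > 0,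
  \<open>Y13\<close> then has a column.\<close>
proof (cases "r = 0")
  case True
  then have "0 < k13" using k_pos k_eq by simp
  then show ?thesis by (rule coherent_ge_1[OF Y13(1) cohY])
next
  case False
  then show ?thesis using coherent_ge_1[OF X12(1) cohX] by simp
qed

lemma alpha_mu: "1 \<le> \<alpha> * \<mu>" using mult_mono[of 1 \<alpha> 1 \<mu>] \<alpha> mu_ge1 by simp

lemma r_le_l: "r \<le> l" unfolding l by simp

text \<open>This removes l from the hypothesis on \<epsilon>, through 1 / (\<alpha> \<mu>) \<le> k /
  l.\<close>

lemma l_le: "real l \<le> \<alpha> * \<mu> * real k"
proof -
  have 0: "0 \<le> \<alpha> * \<mu>" using alpha_mu by linarith
  have "real l0 \<le> \<alpha> * \<mu> * real k" "real l1 \<le> \<alpha> * \<mu> * real k"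
    unfolding l0(1) l1(1) using 0 k_eq by (auto intro!: mult_left_mono)
  moreover have "real r \<le> \<alpha> * \<mu> * real k"
  proof -
    have "real r \<le> 1 * real k" using k_eq by simp
    also have "\<dots> \<le> \<alpha> * \<mu> * real k" using alpha_mu by (intro mult_right_mono) auto
    finally show ?thesis .
  qed
  ultimately show ?thesis unfolding l by (simp add: max_def)
qed

lemma l_pos: "0 < real l"
proof (cases "r = 0")
  case True
  then have "0 < k13" using k_pos k_eq by simp
  then have "0 < real l1" unfolding l1(1) using alpha_mu by (intro mult_pos_pos[of "\<alpha> * \<mu>"]) auto
  then show ?thesis unfolding l by simp
next
  case False
  then have "0 < r" by simp
  then have "0 < l" using r_le_l by (rule less_le_trans)
  then show ?thesis by simp
qed

lemma card_rows_le:
  assumes U: "U \<in> carrier_mat p a" and sp: "sparse_cols \<beta> U"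
  shows "card {i. i < p \<and> (\<exists>j<a. ent U i j \<noteq> 0)} \<le> a * \<beta>"
proof -
  have "{i. i < p \<and> (\<exists>j<a. ent U i j \<noteq> 0)} = (\<Union>j<a. {i. i < p \<and> ent U i j \<noteq> 0})" by auto
  then have "card {i. i < p \<and> (\<exists>j<a. ent U i j \<noteq> 0)} \<le> (\<Sum>j<a. card {i. i < p \<and> ent U i j \<noteq> 0})"
    using card_UN_le[of "{..<a}" "\<lambda>j. {i. i < p \<and> ent U i j \<noteq> 0}"] by simp
  also have "\<dots> \<le> (\<Sum>j<a. \<beta>)" using sp U unfolding sparse_cols_def ent_def by (intro sum_mono) auto
  finally show ?thesis by simp
qed

lemma card_X3_rows: "card X3_rows \<le> k3 * \<beta>" unfolding X3_rows_def by (rule card_rows_le[OF X3 sparseX3])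
lemma card_Y2_rows: "card Y2_rows \<le> k2 * \<beta>" unfolding Y2_rows_def by (rule card_rows_le[OF Y2 sparseY2])

text \<open>Put c = \<alpha> \<mu>. As l0 = c r, the product r m equals (8 n m / c) (l0 / (8 n)),
  and 1 / c \<le> k / l reduces the first factor to the hypothesis on \<epsilon>. Its 144 is 48 * 3,
  the 3 being sqrt 9 in place of sqrt 8.\<close>

lemma sampling_small:
  assumes r1: "1 \<le> r"
  shows "48 * \<epsilon> * sqrt (real r * real m) \<le> sing_val k B * sqrt (l0 / (8 * n))" and "0 < sqrt (l0 / (8 * n))"
proof -
  have n0: "0 < real n" and m0: "0 < real m" and k0: "0 < real k" using k rank_facts by auto
  let ?c = "\<alpha> * \<mu>"
  have c0: "0 < ?c" using alpha_mu by linarith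
  have l0r: "real l0 = ?c * real r" using l0(1) by simp
  have l0p: "0 < real l0" unfolding l0r using c0 r1 by simp
  show pos: "0 < sqrt (l0 / (8 * n))" using l0p n0 by simp
  have "R * M = (N * M / c * 8) * (c * R / (8 * N))" if "0 < c" "0 < N" for R M N c :: real
    using that by (simp add: field_simps)
  from this[OF c0 n0, of "real r" "real m"]
  have "sqrt (real r * real m) = sqrt (real n * real m / ?c * 8) * sqrt (l0 / (8 * n))"
    unfolding real_sqrt_mult[symmetric] l0r by simp
  also have "sqrt (real n * real m / ?c * 8) \<le> sqrt (real n * real m * real k / real l * 9)"
  proof (intro real_sqrt_le_mono mult_mono)
    have "real n * real m / ?c = real n * real m * real k / (?c * real k)" using k0 by simp
    also have "\<dots> \<le> real n * real m * real k / real l" using l_le l_pos by (intro divide_left_mono) auto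
    finally show "real n * real m / ?c \<le> real n * real m * real k / real l" .
  qed auto
  also have "sqrt (real n * real m * real k / real l * 9) = 3 * sqrt (real n * real m * real k / real l)"
    by (simp only: real_sqrt_mult) simp
  finally have "sqrt (real r * real m) \<le> 3 * sqrt (real n * real m * real k / real l) * sqrt (l0 / (8 * n))"
    using pos by simp
  then have "48 * \<epsilon> * sqrt (real r * real m) \<le> 48 * \<epsilon> * (3 * sqrt (real n * real m * real k / real l) * sqrt (l0 / (8 * n)))"
    using eps_ge0 by (intro mult_left_mono) auto
  also have "\<dots> = 144 * (\<epsilon> * sqrt (real n * real m * real k / real l)) * sqrt (l0 / (8 * n))" by simp
  also have "\<dots> \<le> 144 * (1 / 144 * sing_val k B) * sqrt (l0 / (8 * n))"
    using eps_small pos by (intro mult_right_mono mult_left_mono) auto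
  finally show "48 * \<epsilon> * sqrt (real r * real m) \<le> sing_val k B * sqrt (l0 / (8 * n))" by simp
qed

text \<open>A nonzero y in the range of \<open>X\<close> is fixed by \<open>X * pinv X\<close>, so
  |y| \<le> 2 |pinv X y|. The bound lets plain constants be absorbed into the norms of the
  pseudoinverses.\<close>

lemma norm_pinv_X: "1 / 2 \<le> spectral_norm (pinv X)"
proof -
  obtain V where V: "row_basis V" using row_basis_exists by blast
  let ?c = "\<lambda>_. 1 :: real"
  have cz: "nrm k ?c \<noteq> 0" unfolding nrm_eq0 using k_pos by auto
  define y where "y = app k (ent X) (app k (ent Z) (app m (tr (ent Y)) (app k V ?c)))"
  have "nrm n y = nrm n (app m (ent B) (app k V ?c))" unfolding y_def by (intro nrm_cong B_app[symmetric])
  then have "nrm n y \<noteq> 0" using row_basis_zero[OF V, of ?c] cz by auto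
  then have y0: "0 < nrm n y" using nrm_ge0[of n y] by linarith
  have G: "pinv X \<in> carrier_mat k n" "X * pinv X * X = X" using is_pinv_pinv[of X] X unfolding is_pinv_def by auto
  have XG: "X * pinv X \<in> carrier_mat n n" using X G by simp
  have "nrm n y = nrm n (app n (ent (X * pinv X)) y)"
  proof (rule nrm_cong)
    fix i assume i: "i < n"
    show "y i = app n (ent (X * pinv X)) y i"
      unfolding y_def using column_projection(2)[OF X i, of "app k (ent Z) (app m (tr (ent Y)) (app k V ?c))"] by simp
  qed
  also have "\<dots> = nrm n (app k (ent X) (app n (ent (pinv X)) y))" by (intro nrm_cong app_mult_mat[OF X G(1)])
  also have "\<dots> \<le> 2 * nrm k (app n (ent (pinv X)) y)" by (rule X_le)
  also have "nrm k (app n (ent (pinv X)) y) \<le> spectral_norm (pinv X) * nrm n y" by (rule norm_le_spectral_norm[OF G(1)])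
  finally have "1 * nrm n y \<le> 2 * spectral_norm (pinv X) * nrm n y" by simp
  then show ?thesis using y0 by (simp only: mult_le_cancel_right_pos)
qed

end

lemma srrqr_select_factorization:
  assumes S: "srrqr_selection S" and M: "M \<in> carrier_mat p q"
  obtains \<pi> Q Ar Br Cr where "srrqr_factorization (min r (min p q)) M \<pi> Q Ar Br Cr"
    "srrqr_select S r M = \<pi> ` {0..<min r (min p q)}"
proof -
  have "min r (min p q) \<le> min (dim_row M) (dim_col M)" using M by auto
  then have "\<exists>\<pi> Q Ar Br Cr. srrqr_factorization (min r (min p q)) M \<pi> Q Ar Br Cr \<and>
      S (min r (min p q)) M = \<pi> ` {0..<min r (min p q)}"
    using S unfolding srrqr_selection_def by blast
  moreover have "srrqr_select S r M = S (min r (min p q)) M" using M unfolding srrqr_select_def by simp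
  ultimately show thesis by (elim exE conjE) (rule that, assumption, simp)
qed

lemma sqrt_1_mult_diff_le:
  assumes "1 \<le> q" "q \<le> (n::nat)"
  shows "sqrt (1 + real q * (real n - real q)) \<le> real n"
proof (rule real_le_lsqrt)
  have "1 \<le> real q * real q" "real q * real n \<le> real n * real n"
    using assms by (auto intro!: mult_right_mono simp flip: of_nat_mult)
  then show "1 + real q * (real n - real q) \<le> (real n)\<^sup>2" by (simp add: algebra_simps power2_eq_square)
qed (use assms in auto)

context cur_problem
begin

text \<open>Applies \<open>sampled_rows\<close> to a good row sample; the factor sqrt (r * card
  Y2_rows) of its coefficients is at most sqrt m by \<open>sparse_small\<close>. For r = 0 nothing
  is selected and block 2 is empty.\<close>

lemma sparse_columns:
  assumes I0: "I0 \<subseteq> {..<n}" "I0 \<inter> X3_rows = {}"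
    and ge: "\<And>x. sqrt (real l0 / (8 * real n)) * nrm r x \<le> L2_set (app r (ent X12) x) I0"
  defines "J0 \<equiv> srrqr_select S r (sub_rows A I0)"
  shows "J0 \<subseteq> {..<m}" "card J0 = r"
    "\<exists>g. (\<forall>j. j \<notin> J0 \<longrightarrow> g j = 0) \<and> (\<forall>t\<in>K2. app m (tr (ent Y)) g t = \<tau> t) \<and> nrm m g \<le> 2 * sqrt (real m) * L2_set \<tau> K2"
proof -
  let ?P = "J0 \<subseteq> {..<m} \<and> card J0 = r \<and>
    (\<exists>g. (\<forall>j. j \<notin> J0 \<longrightarrow> g j = 0) \<and> (\<forall>t\<in>K2. app m (tr (ent Y)) g t = \<tau> t) \<and> nrm m g \<le> 2 * sqrt (real m) * L2_set \<tau> K2)"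
  have A0: "sub_rows A I0 \<in> carrier_mat (card I0) m" by (rule sub_rows_carrier[OF A I0(1)])
  obtain \<pi> Q Ar Br Cr where fac: "srrqr_factorization (min r (min (card I0) m)) (sub_rows A I0) \<pi> Q Ar Br Cr"
    and sel: "J0 = \<pi> ` {0..<min r (min (card I0) m)}"
    unfolding J0_def by (rule srrqr_select_factorization[OF S A0])
  have ?P
  proof (cases "r = 0")
    case True
    have "J0 = {}" unfolding sel True by simp
    moreover have "nrm m (\<lambda>_. 0) \<le> 2 * sqrt (real m) * L2_set \<tau> K2"
      using L2_set_nonneg[of \<tau> K2] by (simp add: nrm_L2 L2_set_def[of "\<lambda>_. 0"])
    ultimately show ?thesis using True by (intro conjI exI[of _ "\<lambda>_. 0"]) auto
  next
    case False
    then have r1: "1 \<le> r" by linarith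
    interpret sampled_rows n m k r k1 "ent X" "ent Y" "ent Z" A B E \<epsilon> I0 "sqrt (real l0 / (8 * real n))"
    proof
      show "ent X i j = 0" if "i \<in> I0" "r \<le> j" "j < k" for i j
      proof -
        have i: "i < n" "i \<notin> X3_rows" using that I0 by auto
        have j: "j - r < k3" "r + (j - r) = j" using that k_eq by auto
        show ?thesis using X_ent3[OF i(1) j(1)] i j unfolding X3_rows_def by auto
      qed
      show "sqrt (real l0 / (8 * real n)) * nrm r z \<le> L2_set (app r (ent X) z) I0" for z
      proof -
        have "L2_set (app r (ent X) z) I0 = L2_set (app r (ent X12) z) I0"
        proof (rule L2_set_cong[OF refl])
          fix i assume "i \<in> I0"
          then have "i < n" using I0 by auto
          then show "app r (ent X) z i = app r (ent X12) z i"
            unfolding app_def using X_ent12 by (intro sum.cong refl) simp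
        qed
        then show ?thesis using ge[of z] by simp
      qed
      show "48 * \<epsilon> * sqrt (real r * real m) \<le> \<sigma> * sqrt (real l0 / (8 * real n))"
        using sampling_small(1)[OF r1] by simp
      show "0 < sqrt (real l0 / (8 * real n))" using sampling_small(2)[OF r1] by simp
    qed (fact I0 r1)+
    \<comment> \<open>A good sample has at least r rows, so the cut-off in
      \<open>srrqr_select\<close> does not take effect.\<close>
    have min: "min r (min (card I0) m) = r" using r_le_card r(1) k by simp
    note fac' = fac[unfolded min] and sel' = sel[unfolded min]
    have orth: "(\<Sum>j<m. ent Y j t * ent Y j t') = (if t = t' then 1 else 0)"
      if "k1 \<le> t" "t < r" "k1 \<le> t'" "t' < r" for t t'
    proof -
      have t: "t - k1 < k2" "k1 + (t - k1) = t" "t' - k1 < k2" "k1 + (t' - k1) = t'" using that by auto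
      have "(\<Sum>j<m. ent Y j t * ent Y j t') = (\<Sum>j<m. ent Y2 j (t - k1) * ent Y2 j (t' - k1))"
        using Y_ent2[OF _ t(1)] Y_ent2[OF _ t(3)] t by (intro sum.cong refl) simp
      also have "\<dots> = (if t - k1 = t' - k1 then 1 else 0)" by (rule orthonormal_cols_sum[OF Y2 orthY2 t(1,3)])
      finally show ?thesis using that by auto
    qed
    have zero: "ent Y j t = 0" if "j < m" "j \<notin> Y2_rows" "k1 \<le> t" "t < r" for j t
    proof -
      have t: "t - k1 < k2" "k1 + (t - k1) = t" using that by auto
      show ?thesis using Y_ent2[OF that(1) t(1)] that(1,2) t unfolding Y2_rows_def by auto
    qed
    have sub: "Y2_rows \<subseteq> {..<m}" unfolding Y2_rows_def by auto
    have "\<exists>g. (\<forall>j. j \<notin> \<pi> ` {0..<r} \<longrightarrow> g j = 0) \<and> (\<forall>t. k1 \<le> t \<longrightarrow> t < r \<longrightarrow> app m (tr (ent Y)) g t = \<tau> t) \<and>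
        nrm m g \<le> 2 * sqrt (real (r * card Y2_rows)) * L2_set \<tau> K2"
      by (rule sparse_block_coefficients[OF fac' _ sub]) (simp add: orth, simp add: zero)
    then obtain g where g: "\<forall>j. j \<notin> J0 \<longrightarrow> g j = 0" "\<forall>t. k1 \<le> t \<longrightarrow> t < r \<longrightarrow> app m (tr (ent Y)) g t = \<tau> t"
      "nrm m g \<le> 2 * sqrt (real (r * card Y2_rows)) * L2_set \<tau> K2"
      unfolding sel'[symmetric] by (elim exE conjE) (rule that)
    have "r * card Y2_rows \<le> l * (k * \<beta>)"
      using r_le_l card_Y2_rows k_eq by (intro mult_le_mono order_trans[OF card_Y2_rows]) auto
    then have "real (r * card Y2_rows) \<le> real (l * (k * \<beta>))" by (simp only: of_nat_le_iff)
    also have "\<dots> \<le> real m" using sparse_small by (simp add: ac_simps)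
    finally have "2 * sqrt (real (r * card Y2_rows)) * L2_set \<tau> K2 \<le> 2 * sqrt (real m) * L2_set \<tau> K2"
      by (intro mult_right_mono mult_left_mono real_sqrt_le_mono) (auto simp: L2_set_nonneg)
    with g(3) have "nrm m g \<le> 2 * sqrt (real m) * L2_set \<tau> K2" by linarith
    with g(1,2) have "\<exists>g. (\<forall>j. j \<notin> J0 \<longrightarrow> g j = 0) \<and> (\<forall>t\<in>K2. app m (tr (ent Y)) g t = \<tau> t) \<and> nrm m g \<le> 2 * sqrt (real m) * L2_set \<tau> K2"
      by (intro exI[of _ g]) auto
    then show ?thesis using srrqr_image[OF A0 fac'] unfolding sel' by blast
  qed
  then show "J0 \<subseteq> {..<m}" "card J0 = r"
    "\<exists>g. (\<forall>j. j \<notin> J0 \<longrightarrow> g j = 0) \<and> (\<forall>t\<in>K2. app m (tr (ent Y)) g t = \<tau> t) \<and> nrm m g \<le> 2 * sqrt (real m) * L2_set \<tau> K2"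
    by auto
qed

lemma dense_columns:
  assumes Jn: "Jn \<subseteq> {..<m}" "Jn \<inter> Y2_rows = {}"
    and ge: "\<And>x. sqrt (real l1 / (8 * real m)) * nrm k13 x \<le> L2_set (app k13 (ent Y13) x) Jn"
  shows "\<exists>g. (\<forall>j. j \<notin> Jn \<longrightarrow> g j = 0) \<and> (\<forall>t\<in>K13. app m (tr (ent Y)) g t = \<tau> t) \<and>
    (\<forall>t\<in>K2. app m (tr (ent Y)) g t = 0) \<and> nrm m g \<le> 1 / sqrt (real l1 / (8 * real m)) * L2_set \<tau> K13"
proof -
  \<comment> \<open>\<open>Jn\<close> avoids the nonzero rows of \<open>Y2\<close>, so every vector
    supported on it is invisible to block 2.\<close>
  have K2: "\<forall>t\<in>K2. app m (tr (ent Y)) g t = 0" if g: "\<forall>j. j \<notin> Jn \<longrightarrow> g j = 0" for g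
  proof
    fix t assume t: "t \<in> K2"
    have s: "t - k1 < k2" "k1 + (t - k1) = t" using t by auto
    have "ent Y j t * g j = 0" if "j < m" for j
    proof (cases "j \<in> Jn")
      case True
      then have "j \<notin> Y2_rows" using Jn by auto
      then have "ent Y2 j (t - k1) = 0" using that s unfolding Y2_rows_def by auto
      then show ?thesis using Y_ent2[OF that s(1)] s(2) by simp
    qed (use g in simp)
    then show "app m (tr (ent Y)) g t = 0" unfolding app_def tr_def by (intro sum.neutral) simp
  qed
  show ?thesis
  proof (cases "k13 = 0")
    case True
    then have K13: "K13 = {}" using k_eq by auto
    show ?thesis unfolding K13 using K2[of "\<lambda>_. 0"]
      by (intro exI[of _ "\<lambda>_. 0"]) (simp add: nrm_L2 L2_set_def)
  next
    case False
    then have "0 < real k13" unfolding of_nat_0_less_iff by (rule neq0_conv[THEN iffD1])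
    then have "0 < real l1" unfolding l1(1) using alpha_mu by (intro mult_pos_pos[of "\<alpha> * \<mu>"]) auto
    then have c: "0 < sqrt (real l1 / (8 * real m))" using k by simp
    obtain g where g: "\<forall>j. j \<notin> Jn \<longrightarrow> g j = 0" "\<forall>s<k13. app m (tr (ent Y13)) g s = \<tau> (\<phi> s)"
      "nrm m g \<le> 1 / sqrt (real l1 / (8 * real m)) * nrm k13 (\<lambda>s. \<tau> (\<phi> s))"
      using dense_block_coefficients[OF Jn(1) c ge, of "\<lambda>s. \<tau> (\<phi> s)"] by (elim exE conjE) (rule that)
    have "app m (tr (ent Y)) g t = \<tau> t" if "t \<in> K13" for t
    proof -
      have "t \<in> \<phi> ` {..<k13}" using that bij_betw_imp_surj_on[OF bij_phi] by blast
      then obtain s where "s < k13" "t = \<phi> s" by (elim imageE) (rule that, simp_all only: lessThan_iff)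
      then show ?thesis using Yt13[of s g] g(2) by simp
    qed
    moreover have "nrm k13 (\<lambda>s. \<tau> (\<phi> s)) = L2_set \<tau> K13" by (rule L2_set_reindex[OF bij_phi, symmetric])
    ultimately show ?thesis using g(1,3) K2[OF g(1)] by (intro exI[of _ g] conjI) auto
  qed
qed

text \<open>Coherence bounds the entries of \<open>[Y1 Y3]\<close> by sqrt (\<mu> / m), and g lives
  on r columns; this supplies the \<eta> of \<open>combine_coefficients\<close>.\<close>

lemma coherent_columns:
  assumes J0: "J0 \<subseteq> {..<m}" "card J0 = r" and g: "\<forall>j. j \<notin> J0 \<longrightarrow> g j = 0"
  shows "L2_set (app m (tr (ent Y)) g) K13 \<le> sqrt (\<mu> / m) * sqrt (real k13 * real r) * nrm m g"
proof -
  have "\<bar>tr (ent Y13) s j\<bar> \<le> sqrt (\<mu> / m)" if "s < k13" "j < m" for s j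
    using real_sqrt_le_mono[OF coherent_entry[OF Y13(1) cohY that(2,1)]] unfolding tr_def by simp
  then have "nrm k13 (app m (tr (ent Y13)) g) \<le> sqrt (\<mu> / m) * sqrt (card {..<k13} * card J0) * nrm m g"
    using J0 g mu_ge1 by (intro nrm_app_le_entries) auto
  then show ?thesis unfolding L2_Yt13 J0(2) by simp
qed

text \<open>As \<mu> (k1 + k3) \<le> l1, b \<eta> \<le> sqrt (8 r) \<le> 3 sqrt k, while b = sqrt (8
  m / l1) \<le> 3 sqrt m. The sum is at most 2 sqrt m + 3 sqrt m + 6 sqrt (k m), whence the
  11.\<close>

lemma coefficient_bound:
  defines "b \<equiv> 1 / sqrt (real l1 / (8 * real m))" and "\<eta> \<equiv> sqrt (\<mu> / m) * sqrt (real k13 * real r)"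
  shows "2 * sqrt m + b * (1 + \<eta> * (2 * sqrt m)) \<le> 11 * sqrt (real m * real k)"
proof -
  have m0: "0 < real m" and k1: "1 \<le> sqrt (real k)" using k by auto
  have s9: "sqrt 9 = (3::real)" by simp
  have b: "b \<le> 3 * sqrt m \<and> b * \<eta> \<le> 3 * sqrt (real k)"
  proof (cases "l1 = 0")
    case True
    \<comment> \<open>For l1 = 0 the value of \<open>b\<close> is 1 / 0 = 0.\<close>
    then show ?thesis unfolding b_def by simp
  next
    case False
    then have l1': "1 \<le> real l1" by simp
    have b_eq: "b = sqrt (8 * real m / real l1)" unfolding b_def by (simp add: real_sqrt_divide)
    have "8 * real m / real l1 \<le> 9 * real m"
    proof -
      have "8 * real m / real l1 \<le> 8 * real m / 1" using l1' m0 by (intro divide_left_mono) auto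
      then show ?thesis using m0 by simp
    qed
    then have "b \<le> sqrt (9 * real m)" unfolding b_eq by (rule real_sqrt_le_mono)
    then have 1: "b \<le> 3 * sqrt m" unfolding real_sqrt_mult s9 .
    have mul: "\<mu> * real k13 \<le> real l1"
    proof -
      have "1 * (\<mu> * real k13) \<le> \<alpha> * (\<mu> * real k13)" using \<alpha> mu_ge1 by (intro mult_right_mono) auto
      then show ?thesis unfolding l1(1) by (simp add: mult.assoc)
    qed
    have id: "8 * M / L * (U / M * (P * R)) = 8 * R * (U * P / L)" if "0 < M" for M L U P R :: real
      using that by (simp add: field_simps)
    have "8 * real m / real l1 * (\<mu> / m * (real k13 * real r)) = 8 * real r * (\<mu> * real k13 / real l1)"
      by (rule id[OF m0])
    also have "\<dots> \<le> 8 * real r * 1" using mul l1' by (intro mult_left_mono) auto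
    also have "\<dots> \<le> 9 * real k"
    proof -
      have "real r \<le> real k" unfolding of_nat_le_iff by (rule r(1))
      moreover have "8 * R * 1 \<le> 9 * K" if "R \<le> K" "0 \<le> K" for R K :: real using that by simp
      ultimately show ?thesis by simp
    qed
    finally have "b * \<eta> \<le> sqrt (9 * real k)"
      unfolding b_eq \<eta>_def real_sqrt_mult[symmetric] by (rule real_sqrt_le_mono)
    then have 2: "b * \<eta> \<le> 3 * sqrt (real k)" unfolding real_sqrt_mult s9 .
    show ?thesis using 1 2 by simp
  qed
  have "b * \<eta> * (2 * sqrt m) \<le> 3 * sqrt (real k) * (2 * sqrt m)" using b by (intro mult_right_mono) auto
  moreover have "1 * sqrt m \<le> sqrt (real k) * sqrt m" using k1 by (intro mult_right_mono) auto
  ultimately show ?thesis using b unfolding real_sqrt_mult by (simp add: algebra_simps)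
qed

theorem good_event_bound:
  assumes I0: "I0 \<subseteq> {..<n}" "I0 \<inter> X3_rows = {}"
    "\<And>x. sqrt (real l0 / (8 * real n)) * nrm r x \<le> L2_set (app r (ent X12) x) I0"
    and Jn: "Jn \<subseteq> {..<m}" "card Jn = l1" "Jn \<inter> Y2_rows = {}"
    "\<And>x. sqrt (real l1 / (8 * real m)) * nrm k13 x \<le> L2_set (app k13 (ent Y13) x) Jn"
  defines "J1 \<equiv> srrqr_select S r (sub_rows A I0) \<union> Jn"
  defines "I1 \<equiv> srrqr_select S (r + l1) (transpose_mat (sub_cols A J1))"
  shows "spectral_norm (A - sub_cols A J1 * pinv (sub_cols A J1) * A * pinv (sub_rows A I1) * sub_rows A I1)
    \<le> 206 * \<epsilon> * real n * sqrt (real m * real k) * (sing_val 1 B / sing_val k B)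
      * (spectral_norm (pinv X) + spectral_norm (pinv Y))"
proof -
  let ?J0 = "srrqr_select S r (sub_rows A I0)"
  let ?\<tau> = "11 * sqrt (real m * real k)"
  note J0 = sparse_columns[OF I0]
  have J1: "J1 \<subseteq> {..<m}" unfolding J1_def using J0(1) Jn(1) by blast
  have cardJ1: "card J1 \<le> r + l1" unfolding J1_def using card_Un_le[of ?J0 Jn] J0(2) Jn(2) by simp
  let ?a = "2 * sqrt m" and ?b = "1 / sqrt (real l1 / (8 * real m))" and ?\<eta> = "sqrt (\<mu> / m) * sqrt (real k13 * real r)"
  have comb: "\<exists>g. (\<forall>j. j \<notin> ?J0 \<union> Jn \<longrightarrow> g j = 0) \<and> (\<forall>t\<in>K2 \<union> K13. app m (tr (ent Y)) g t = app m (tr (ent Y)) x t) \<and>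
    nrm m g \<le> (?a + ?b * (1 + ?\<eta> * ?a)) * nrm m x" for x
    by (rule combine_coefficients[OF J0(3) dense_columns[OF Jn(1,3,4)] _ L2_Yt2_le L2_Yt13_le])
      (rule coherent_columns[OF J0(1,2)], assumption, use mu_ge1 in simp_all)
  interpret column_basis n m k r k1 "ent X" "ent Y" "ent Z" A B E \<epsilon> J1 ?\<tau>
  proof
    show "\<exists>g. (\<forall>j. j \<notin> J1 \<longrightarrow> g j = 0) \<and> (\<forall>t<k. app m (tr (ent Y)) g t = app m (tr (ent Y)) x t) \<and> nrm m g \<le> ?\<tau> * nrm m x" for x
    proof -
      obtain g where g: "\<forall>j. j \<notin> ?J0 \<union> Jn \<longrightarrow> g j = 0"
        "\<forall>t\<in>K2 \<union> K13. app m (tr (ent Y)) g t = app m (tr (ent Y)) x t"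
        "nrm m g \<le> (2 * sqrt m + 1 / sqrt (real l1 / (8 * real m)) *
          (1 + sqrt (\<mu> / m) * sqrt (real k13 * real r) * (2 * sqrt m))) * nrm m x"
        using comb[of x] by (elim exE conjE) (rule that)
      have "nrm m g \<le> ?\<tau> * nrm m x"
        by (rule order_trans[OF g(3)]) (rule mult_right_mono[OF coefficient_bound nrm_ge0])
      then show ?thesis using g(1,2) unfolding J1_def K_union by (intro exI[of _ g]) auto
    qed
    show "0 < ?\<tau>" using k by simp
  qed (rule J1)
  let ?q = "min (r + l1) (min (card J1) n)"
  obtain \<pi> Q Ar Br Cr where fac: "srrqr_factorization ?q (transpose_mat (sub_cols A J1)) \<pi> Q Ar Br Cr"
    and sel: "I1 = \<pi> ` {0..<?q}"
    unfolding I1_def by (rule srrqr_select_factorization[OF S Ct])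
  \<comment> \<open>\<open>J1\<close> has at most r + l1 elements, so the requested number does not
    cut below card J1, which is at least k.\<close>
  have q: "k \<le> ?q" using k_le_card k(2) cardJ1 by simp
  have f: "sqrt (1 + real ?q * (real n - real ?q)) \<le> real n"
    using q k(1) by (intro sqrt_1_mult_diff_le) auto
  let ?p = "spectral_norm (pinv X) + spectral_norm (pinv Y)" and ?s = "sqrt (real m * real k)"
  define W where "W = \<sigma>1 / \<sigma> * real n * ?s"
  have kap: "1 \<le> \<sigma>1 / \<sigma>" using sigma_le sigma_pos by simp
  have n1: "1 \<le> real n" using k by simp
  have "1 * 1 \<le> real m * real k" using k by (intro mult_mono) auto
  then have s1: "1 \<le> ?s" by simp
  have "1 * 1 \<le> \<sigma>1 / \<sigma> * real n" using kap n1 by (intro mult_mono) auto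
  then have "1 * ?s \<le> W" unfolding W_def using s1 by (intro mult_right_mono) auto
  then have W: "1 \<le> W" "?s \<le> W" using s1 by linarith+
  have p: "1 / 2 \<le> ?p" using norm_pinv_X spectral_norm_ge0[of "pinv Y"] by linarith
  have "spectral_norm (A - sub_cols A J1 * pinv (sub_cols A J1) * A * pinv (sub_rows A I1) * sub_rows A I1)
      \<le> \<epsilon> * (4 + ?\<tau> + 8 * (\<sigma>1 / \<sigma>) * real n * ?\<tau>)"
    unfolding sel by (rule cur_error_bound[OF fac q f])
  also have "\<dots> = \<epsilon> * (4 + 11 * ?s + 88 * W)" unfolding W_def by simp
  \<comment> \<open>As W dominates both 1 and \<open>?s\<close>, the sum 4 + 11 s + 88 W is at most
    103 W; doubling to 206 makes room for the lower bound 1 / 2 on the pseudoinverse norms.\<close>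
  also have "\<dots> \<le> \<epsilon> * (206 * W * (1 / 2))" using W eps by (intro mult_left_mono) linarith+
  also have "\<dots> \<le> \<epsilon> * (206 * W * ?p)" using W p eps by (intro mult_left_mono) linarith+
  also have "\<dots> = 206 * \<epsilon> * real n * ?s * (\<sigma>1 / \<sigma>) * ?p" unfolding W_def by simp
  finally show ?thesis .
qed

text \<open>Four bad events: the row sample meets the support of X3 or is ill conditioned for
  \<open>[X1 X2]\<close>, and the new columns do the same with Y2 and \<open>[Y1 Y3]\<close>.
  Outside them the error bound is deterministic.\<close>

lemma iteration_bound:
  "1 - real k * (real \<beta> * real l / real n + real \<beta> * real l / real m + exp (- \<alpha> / 20) + exp (- \<alpha> / 20))
    \<le> measure_pmf.prob (srrqr_iteration S A l0 r l1 (r + l1) 0)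
      {(I1, J1). spectral_norm (A - sub_cols A J1 * pinv (sub_cols A J1) * A * pinv (sub_rows A I1) * sub_rows A I1)
        \<le> 206 * \<epsilon> * real n * sqrt (real m * real k) * (sing_val 1 B / sing_val k B)
          * (spectral_norm (pinv X) + spectral_norm (pinv Y))}" (is "_ \<le> measure_pmf.prob _ ?T")
proof -
  have n0: "0 < n" and m0: "0 < m" using k by auto
  define F1 where "F1 = {I. \<exists>x. L2_set (app r (ent X12) x) I < sqrt (real l0 / (8 * real n)) * nrm r x}"
  define F2 where "F2 = {I. \<exists>x. L2_set (app k13 (ent Y13) x) I < sqrt (real l1 / (8 * real m)) * nrm k13 x}"
  define H1 where "H1 = {I. I \<inter> X3_rows \<noteq> {}}"
  define H2 where "H2 = {I. I \<inter> Y2_rows \<noteq> {}}"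
  let ?h = "\<lambda>(I0, Jn). let J1 = srrqr_select S r (sub_rows A I0) \<union> Jn
        in (srrqr_select S (r + l1) (transpose_mat (sub_cols A J1)), J1)"
  have dims: "dim_row A = n" "dim_col A = m" using A by auto
  have good: "?h (I0, Jn) \<in> ?T" if I0: "I0 \<in> set_pmf (random_subset n l0)" and Jn: "Jn \<in> set_pmf (random_subset m l1)"
    and nI: "I0 \<notin> F1 \<union> H1" and nJ: "Jn \<notin> F2 \<union> H2" for I0 Jn
  proof -
    have 1: "I0 \<subseteq> {..<n}" using I0 unfolding set_random_subset[OF l0(2)] by auto
    have 2: "Jn \<subseteq> {..<m}" "card Jn = l1" using Jn unfolding set_random_subset[OF l1(2)] by auto
    have 3: "sqrt (real l0 / (8 * real n)) * nrm r x \<le> L2_set (app r (ent X12) x) I0" for x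
    proof -
      have "\<not> L2_set (app r (ent X12) x) I0 < sqrt (real l0 / (8 * real n)) * nrm r x" using nI unfolding F1_def by blast
      then show ?thesis by simp
    qed
    have 4: "sqrt (real l1 / (8 * real m)) * nrm k13 x \<le> L2_set (app k13 (ent Y13) x) Jn" for x
    proof -
      have "\<not> L2_set (app k13 (ent Y13) x) Jn < sqrt (real l1 / (8 * real m)) * nrm k13 x" using nJ unfolding F2_def by blast
      then show ?thesis by simp
    qed
    have 5: "I0 \<inter> X3_rows = {}" "Jn \<inter> Y2_rows = {}" using nI nJ unfolding H1_def H2_def by auto
    show ?thesis unfolding Let_def prod.case mem_Collect_eq
      by (rule good_event_bound[OF 1 5(1) 3 2 5(2) 4])
  qed
  let ?p = "random_subset n l0" and ?q = "random_subset m l1"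
  have main: "1 - (measure_pmf.prob ?p (F1 \<union> H1) + measure_pmf.prob ?q (F2 \<union> H2))
      \<le> measure_pmf.prob (srrqr_iteration S A l0 r l1 (r + l1) 0) ?T"
    unfolding srrqr_iteration_no_new_rows dims by (rule prob_pair_ge) (rule good)
  have hit: "real (card W) * (real j / real p) \<le> real k * (real \<beta> * real l / real p)"
    if "card W \<le> a * \<beta>" "a \<le> k" "j \<le> l" for W :: "nat set" and a j p
  proof -
    have "card W * j \<le> (k * \<beta>) * l"
      using that by (intro mult_le_mono order_trans[OF that(1)]) auto
    then have "real (card W * j) \<le> real (k * \<beta> * l)" by (simp only: of_nat_le_iff)
    then have "real (card W * j) / real p \<le> real (k * \<beta> * l) / real p" by (intro divide_right_mono) auto
    then show ?thesis by simp
  qed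
  have F: "real a * exp (- \<alpha> / 20) \<le> real k * exp (- \<alpha> / 20)" if "a \<le> k" for a
    using that by (intro mult_right_mono) auto
  have lr: "r \<le> k" "k13 \<le> k" "k3 \<le> k" "k2 \<le> k" using k_eq by auto
  have ll: "l0 \<le> l" "l1 \<le> l" unfolding l by auto
  have "measure_pmf.prob ?p (F1 \<union> H1) \<le> measure_pmf.prob ?p F1 + measure_pmf.prob ?p H1"
    by (intro measure_Un_le) auto
  moreover have "measure_pmf.prob ?p F1 \<le> real r * exp (- \<alpha> / 20)"
    unfolding F1_def by (rule prob_random_subset_coherent[OF X12(1) cohX n0 l0(2,1) \<alpha>])
  moreover have "measure_pmf.prob ?p H1 \<le> real (card X3_rows) * (real l0 / real n)"
    unfolding H1_def by (rule prob_random_subset_hit[OF l0(2)]) (auto simp: X3_rows_def)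
  moreover have "measure_pmf.prob ?q (F2 \<union> H2) \<le> measure_pmf.prob ?q F2 + measure_pmf.prob ?q H2"
    by (intro measure_Un_le) auto
  moreover have "measure_pmf.prob ?q F2 \<le> real k13 * exp (- \<alpha> / 20)"
    unfolding F2_def by (rule prob_random_subset_coherent[OF Y13(1) cohY m0 l1(2,1) \<alpha>])
  moreover have "measure_pmf.prob ?q H2 \<le> real (card Y2_rows) * (real l1 / real m)"
    unfolding H2_def by (rule prob_random_subset_hit[OF l1(2)]) (auto simp: Y2_rows_def)
  ultimately show ?thesis
    using main F[OF lr(1)] F[OF lr(2)] hit[OF card_X3_rows lr(3) ll(1), of n] hit[OF card_Y2_rows lr(4) ll(2), of m]
    unfolding distrib_left by linarith
qed

end

theorem theorem25:
  shows "\<exists>c1 c2 c C :: real.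
    0 < c1 \<and> c1 < 1 \<and> 0 < c2 \<and> c2 < 1 \<and> 0 < c \<and> 0 < C \<and>
    (\<forall>(n :: nat) (m :: nat) (k :: nat) (k1 :: nat) (k2 :: nat) (k3 :: nat)
      (A :: real mat) (E :: real mat)
      (X :: real mat) (X1 :: real mat) (X2 :: real mat) (X3 :: real mat)
      (Y :: real mat) (Y1 :: real mat) (Y2 :: real mat) (Y3 :: real mat)
      (Z :: real mat) (Z1 :: real mat) (Z2 :: real mat) (Z3 :: real mat)
      (\<epsilon> :: real) (\<mu> :: real) (\<beta> :: nat) (\<alpha> :: real)
      (l0 :: nat) (l_srrqr_col :: nat) (l_new_col :: nat)
      (l_srrqr_row :: nat) (l_new_row :: nat) (l :: nat)
      (S :: nat \<Rightarrow> real mat \<Rightarrow> nat set).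
      0 < k \<longrightarrow> k = k1 + k2 + k3 \<longrightarrow>
      X1 \<in> carrier_mat n k1 \<longrightarrow> X2 \<in> carrier_mat n k2 \<longrightarrow> X3 \<in> carrier_mat n k3 \<longrightarrow>
      Y1 \<in> carrier_mat m k1 \<longrightarrow> Y2 \<in> carrier_mat m k2 \<longrightarrow> Y3 \<in> carrier_mat m k3 \<longrightarrow>
      Z1 \<in> carrier_mat k1 k1 \<longrightarrow> Z2 \<in> carrier_mat k2 k2 \<longrightarrow> Z3 \<in> carrier_mat k3 k3 \<longrightarrow>
      E \<in> carrier_mat n m \<longrightarrow>
      X = hcat n [X1, X2, X3] \<longrightarrow> Y = hcat m [Y1, Y2, Y3] \<longrightarrow>
      Z = diag_block_mat [Z1, Z2, Z3] \<longrightarrow>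
      A = X * Z * transpose_mat Y + E \<longrightarrow>
      vec_space.rank n (X * Z * transpose_mat Y) = k \<longrightarrow>
      spectral_norm E \<le> \<epsilon> \<longrightarrow>
      coherent \<mu> (hcat n [X1, X2]) \<longrightarrow> coherent \<mu> (hcat m [Y1, Y3]) \<longrightarrow>
      orthonormal_cols X3 \<longrightarrow> sparse_cols \<beta> X3 \<longrightarrow>
      orthonormal_cols Y2 \<longrightarrow> sparse_cols \<beta> Y2 \<longrightarrow>
      0 < \<alpha> \<longrightarrow>
      real l0 = \<alpha> * \<mu> * real (k1 + k2) \<longrightarrow> l0 \<le> n \<longrightarrow>
      l_srrqr_col = k1 + k2 \<longrightarrow>
      real l_new_col = \<alpha> * \<mu> * real (k1 + k3) \<longrightarrow> l_new_col \<le> m \<longrightarrow>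
      l_srrqr_row = l_srrqr_col + l_new_col \<longrightarrow>
      l_new_row = 0 \<longrightarrow>
      l = max l0 (max l_srrqr_col l_new_col) \<longrightarrow>
      \<epsilon> * sqrt (real n * real m * real k / real l)
        \<le> c * sing_val k (X * Z * transpose_mat Y) \<longrightarrow>
      srrqr_selection S \<longrightarrow>
      measure_pmf.prob
        (srrqr_iteration S A l0 l_srrqr_col l_new_col l_srrqr_row l_new_row)
        {(I1, J1).
           spectral_norm
             (A - sub_cols A J1 * pinv (sub_cols A J1) * A * pinv (sub_rows A I1) * sub_rows A I1)
           \<le> C * \<epsilon> * real n * sqrt (real m * real k)
               * (sing_val 1 (X * Z * transpose_mat Y) / sing_val k (X * Z * transpose_mat Y))
               * (spectral_norm (pinv X) + spectral_norm (pinv Y))}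
      \<ge> 1 - real k * (real \<beta> * real l / real n + real \<beta> * real l / real m
                        + c1 powr \<alpha> + c2 powr \<alpha>))"
proof (rule exI[of _ "exp (- 1 / 20)"], rule exI[of _ "exp (- 1 / 20)"], rule exI[of _ "1 / 144"], rule exI[of _ 206],
    intro conjI allI impI, goal_cases)
  case (7 n m k k1 k2 k3 A E X X1 X2 X3 Y Y1 Y2 Y3 Z Z1 Z2 Z3 \<epsilon> \<mu> \<beta> \<alpha> l0 l_srrqr_col l_new_col l_srrqr_row l_new_row l S)
  note H = 7
  let ?e = "exp (- \<alpha> / 20)"
  let ?bad = "real k * (real \<beta> * real l / real n + real \<beta> * real l / real m + ?e + ?e)"
  \<comment> \<open>This determines c1 and c2: the tail bound for either sample is exp (- \<alpha> /
    20).\<close>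
  have pw: "exp (- 1 / 20) powr \<alpha> = ?e" by (simp add: powr_def)
  show ?case
  proof (cases "1 \<le> ?bad")
    case True
    then have "1 - ?bad \<le> 0" by simp
    then show ?thesis unfolding pw by (rule order_trans) (rule measure_nonneg)
  next
    case False
    have k1: "1 \<le> real k" using H(1) by simp
    have bad: "?bad < 1" using False by simp
    have nonneg: "0 \<le> real \<beta> * real l / real n" "0 \<le> real \<beta> * real l / real m" by auto
    \<comment> \<open>As k \<ge> 1, the two exponential terms alone stay below 1, so exp (- \<alpha>
      / 20) < 1 / 2; this forces \<alpha> > 10.\<close>
    have "1 * (?e + ?e) \<le> ?bad" using k1 nonneg by (intro mult_mono) auto
    then have e: "?e + ?e < 1" unfolding mult_1_left using bad by (rule le_less_trans)
    have "1 + - \<alpha> / 20 \<le> ?e" by (rule exp_ge_add_one_self)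
    then have \<alpha>: "1 \<le> \<alpha>" using e by linarith
    have "X * Z * transpose_mat Y \<in> carrier_mat n m"
    proof -
      have "X \<in> carrier_mat n k" unfolding H(2,13) by (rule hcat3(1)[OF H(3-5)])
      moreover have "Y \<in> carrier_mat m k" unfolding H(2,14) by (rule hcat3(1)[OF H(6-8)])
      moreover have "Z \<in> carrier_mat k k" unfolding H(2,15) by (rule diag_block3(1)[OF H(9-11)])
      ultimately show ?thesis by simp
    qed
    \<comment> \<open>Division by m = 0 would give 0, so the sparsity term carries information only
      for m > 0, which the rank k \<ge> 1 ensures.\<close>
    from sing_val_rank_pos(2)[OF this H(17)] H(1) have m0: "0 < real m" by simp
    have "real k * (real \<beta> * real l / real m) \<le> ?bad"
      using nonneg by (intro mult_left_mono) auto
    then have "real k * (real \<beta> * real l / real m) < 1" using bad by linarith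
    then have sp: "real k * (real \<beta> * real l) \<le> real m" using m0 by (simp add: field_simps)
    have l: "l = max l0 (max (k1 + k2) l_new_col)" using H by simp
    interpret cur_problem n m k k1 k2 k3 A E X X1 X2 X3 Y Y1 Y2 Y3 Z Z1 Z2 Z3 \<epsilon> \<mu> \<alpha> \<beta> l0 l_new_col l S
      by unfold_locales (fact H \<alpha> sp l)+
    show ?thesis using iteration_bound unfolding pw \<open>l_srrqr_row = _\<close> \<open>l_srrqr_col = _\<close> \<open>l_new_row = 0\<close> .
  qed
qed simp_all

end
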